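(* Let $G$ be the Grigorchuk group (in which case $p=2$) or a Gupta-Sidki $p$-group for a prime $p\geq 3$. Let $f:\mathbb{N}\to\mathbb{N}$ be a non-decreasing function such that $\frac{f(n)}{n}\to\infty$ and $\frac{f(n)}{p^n}\to 0$ as $n\to\infty$. Then there exists a transitive action of $G$ on a set $X$ such that $o_{p^n}(G,X)\leq f(n)$ for all sufficiently large $n$, and $o_{p^n}(G,X)\geq\frac1p f(n)$ for infinitely many $n$.
   Context: For a group $G$ acting transitively on a set $X$, $o_n(G,X)$ is the maximal number of orbits on $X$ of a subgroup $U$ of index at most $n$ in $G$. $T$ is the $p$-regular rooted tree. For automorphisms $\varphi_1,\dots,\varphi_p$ of $T$, $(\varphi_1,\dots,\varphi_p)$ denotes the automorphism of $T$ fixing level 1 pointwise and acting by $\varphi_i$ on the subtree below the $i$-th vertex of level 1 (identified with $T$). The Grigorchuk group ($p=2$) is $G=\langle a,b,c,d\rangle\leq \mathrm{Aut}(T)$, where $a$ interchanges the two subtrees at level 1, and $b=(a,c)$, $c=(a,d)$, $d=(1,b)$. The Gupta-Sidki $p$-group ($p\ge 3$) is $G=\langle a,b\rangle\leq\mathrm{Aut}(T)$, where $a$ cyclically permutes the $p$ subtrees at level 1, and $b=(a,a^{-1},1,\dots,1,b)$. *)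

theory Defs
  imports Complex_Main "HOL-Algebra.Algebra"
begin

section \<open>The regular rooted tree and its automorphism group\<close>

text \<open>
  Vertices of the \<open>p\<close>-regular rooted tree are the words over \<open>{0, ..., p - 1}\<close>, the empty word is
  the root, and the children of \<open>w\<close> are the words \<open>w @ [i]\<close>. The subtree below the \<open>i\<close>-th vertex of
  level 1 consists of the words \<open>i # w\<close> and is identified with the whole tree by deleting \<open>i\<close>.
  Letters count from 0, so the vertices of level 1 are \<open>[0], ..., [p - 1]\<close>.
\<close>

definition tree :: "nat \<Rightarrow> nat list set" where
  "tree p = lists {..<p}"

definition tree_adj :: "nat list \<Rightarrow> nat list \<Rightarrow> bool" where
  "tree_adj u v \<longleftrightarrow> (\<exists>i. v = u @ [i] \<or> u = v @ [i])"

definition tree_aut :: "nat \<Rightarrow> (nat list \<Rightarrow> nat list) monoid" where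
  "tree_aut p = BijGroup (tree p)
     \<lparr>carrier := {\<phi> \<in> Bij (tree p). \<phi> [] = [] \<and>
        (\<forall>u\<in>tree p. \<forall>v\<in>tree p. tree_adj (\<phi> u) (\<phi> v) \<longleftrightarrow> tree_adj u v)}\<rparr>"

text \<open>
  The automorphism \<open>(\<phi>\<^sub>1, ..., \<phi>\<^sub>p)\<close>, with \<open>p\<close> the length of the list.
\<close>

definition tree_tuple :: "(nat list \<Rightarrow> nat list) list \<Rightarrow> nat list \<Rightarrow> nat list" where
  "tree_tuple \<phi>s = (\<lambda>w\<in>tree (length \<phi>s). case w of [] \<Rightarrow> [] | i # v \<Rightarrow> i # (\<phi>s ! i) v)"


section \<open>The Grigorchuk group and the Gupta-Sidki groups\<close>

fun rot_word :: "nat \<Rightarrow> nat list \<Rightarrow> nat list" where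
  "rot_word p [] = []"
| "rot_word p (i # w) = ((i + 1) mod p) # w"

definition rot :: "nat \<Rightarrow> nat list \<Rightarrow> nat list" where
  "rot p = restrict (rot_word p) (tree p)"

text \<open>
  The remaining generators are given by self-referential tuples. They are defined by recursion on
  words; the defining tuple equations are \<open>grig_b_eq\<close>, \<open>grig_c_eq\<close>, \<open>grig_d_eq\<close> and \<open>gs_b_eq\<close> below.
\<close>

fun grig_b_word grig_c_word grig_d_word :: "nat list \<Rightarrow> nat list" where
  "grig_b_word [] = []"
| "grig_b_word (i # w) = i # (if i = 0 then rot_word 2 w else grig_c_word w)"
| "grig_c_word [] = []"
| "grig_c_word (i # w) = i # (if i = 0 then rot_word 2 w else grig_d_word w)"
| "grig_d_word [] = []"
| "grig_d_word (i # w) = i # (if i = 0 then w else grig_b_word w)"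

definition grig_a :: "nat list \<Rightarrow> nat list" where
  "grig_a = rot 2"

definition grig_b :: "nat list \<Rightarrow> nat list" where
  "grig_b = restrict grig_b_word (tree 2)"

definition grig_c :: "nat list \<Rightarrow> nat list" where
  "grig_c = restrict grig_c_word (tree 2)"

definition grig_d :: "nat list \<Rightarrow> nat list" where
  "grig_d = restrict grig_d_word (tree 2)"

definition grigorchuk_group :: "(nat list \<Rightarrow> nat list) monoid" where
  "grigorchuk_group = subgroup_generated (tree_aut 2) {grig_a, grig_b, grig_c, grig_d}"

fun gs_b_word :: "nat \<Rightarrow> nat list \<Rightarrow> nat list" where
  "gs_b_word p [] = []"
| "gs_b_word p (i # w) = i # (if i = 0 then rot_word p w
      else if i = 1 then (rot_word p ^^ (p - 1)) w
      else if i = p - 1 then gs_b_word p w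
      else w)"

definition gs_a :: "nat \<Rightarrow> nat list \<Rightarrow> nat list" where
  "gs_a p = rot p"

definition gs_b :: "nat \<Rightarrow> nat list \<Rightarrow> nat list" where
  "gs_b p = restrict (gs_b_word p) (tree p)"

definition gupta_sidki_group :: "nat \<Rightarrow> (nat list \<Rightarrow> nat list) monoid" where
  "gupta_sidki_group p = subgroup_generated (tree_aut p) {gs_a p, gs_b p}"


section \<open>The maximal number of orbits of subgroups of bounded index\<close>

text \<open>
  The condition \<open>finite (rcosets U)\<close> is needed because \<open>card\<close> is \<open>0\<close> on infinite sets.
  If the action is transitive and \<open>n \<ge> 1\<close>, the maximum is taken over a finite nonempty set
  of genuine cardinalities (lemmas \<open>card_orbits_le_index\<close> and \<open>max_orbits_set\<close>).
\<close>

definition max_orbits ::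
  "nat \<Rightarrow> ('g, 'm) monoid_scheme \<Rightarrow> 'x set \<Rightarrow> ('g \<Rightarrow> 'x \<Rightarrow> 'x) \<Rightarrow> nat" where
  "max_orbits n G \<Omega> \<phi> = Max {card (orbits (G\<lparr>carrier := U\<rparr>) \<Omega> \<phi>) | U.
     subgroup U G \<and> finite (rcosets\<^bsub>G\<^esub> U) \<and> card (rcosets\<^bsub>G\<^esub> U) \<le> n}"


section \<open>Basic facts\<close>

lemma tree_Nil [simp]: "[] \<in> tree p"
  by (simp add: tree_def)

lemma tree_Cons [simp]: "i # w \<in> tree p \<longleftrightarrow> i < p \<and> w \<in> tree p"
  by (simp add: tree_def)

lemma tree_append [simp]: "u @ v \<in> tree p \<longleftrightarrow> u \<in> tree p \<and> v \<in> tree p"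
  by (auto simp: tree_def)

lemma group_tree_aut: "group (tree_aut p)"
proof -
  let ?A = "carrier (tree_aut p)"
  interpret B: group "BijGroup (tree p)" by (rule group_BijGroup)
  have "subgroup ?A (BijGroup (tree p))"
  proof (rule B.subgroupI)
    show "?A \<subseteq> carrier (BijGroup (tree p))"
      by (auto simp: tree_aut_def BijGroup_def)
    have "(\<lambda>x\<in>tree p. x) \<in> ?A"
      by (auto simp: tree_aut_def id_Bij)
    thus "?A \<noteq> {}" by blast
  next
    fix f assume f: "f \<in> ?A"
    let ?g = "\<lambda>x\<in>tree p. inv_into (tree p) f x"
    have fB: "f \<in> Bij (tree p)" and f0: "f [] = []"
      and fadj: "\<And>u v. u \<in> tree p \<Longrightarrow> v \<in> tree p \<Longrightarrow> tree_adj (f u) (f v) \<longleftrightarrow> tree_adj u v"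
      using f by (auto simp: tree_aut_def)
    have bij: "bij_betw f (tree p) (tree p)" using fB by (simp add: Bij_def)
    have gin: "inv_into (tree p) f u \<in> tree p" if "u \<in> tree p" for u
      using that fB by (simp add: Bij_inv_into_mem)
    have fg: "f (inv_into (tree p) f u) = u" if "u \<in> tree p" for u
      using that bij by (simp add: bij_betw_inv_into_right)
    have "inv_into (tree p) f [] = []"
      using bij f0 by (metis bij_betw_inv_into_left tree_Nil)
    moreover have "tree_adj (inv_into (tree p) f u) (inv_into (tree p) f v) \<longleftrightarrow> tree_adj u v"
      if "u \<in> tree p" "v \<in> tree p" for u v
      using fadj[OF gin[OF that(1)] gin[OF that(2)]] fg that by simp
    ultimately have "?g \<in> ?A"
      using restrict_inv_into_Bij[OF fB] by (auto simp: tree_aut_def)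
    thus "inv\<^bsub>BijGroup (tree p)\<^esub> f \<in> ?A"
      by (simp add: inv_BijGroup[OF fB])
  next
    fix f g assume fg: "f \<in> ?A" "g \<in> ?A"
    hence B: "f \<in> Bij (tree p)" "g \<in> Bij (tree p)" by (auto simp: tree_aut_def)
    have "\<And>u. u \<in> tree p \<Longrightarrow> g u \<in> tree p"
      using B(2) Bij_imp_funcset by blast
    hence "compose (tree p) f g \<in> ?A"
      using fg compose_Bij[OF B] by (auto simp: tree_aut_def compose_def)
    thus "f \<otimes>\<^bsub>BijGroup (tree p)\<^esub> g \<in> ?A"
      using B by (simp add: BijGroup_def)
  qed
  from B.subgroup_imp_group[OF this] show ?thesis
    by (simp add: tree_aut_def)
qed

lemma tree_autI:
  assumes Nil: "f [] = []"
    and snoc: "\<And>w i. w \<in> tree p \<Longrightarrow> i < p \<Longrightarrow> \<exists>j<p. f (w @ [i]) = f w @ [j]"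
    and inj: "inj_on f (tree p)"
  shows "restrict f (tree p) \<in> carrier (tree_aut p)"
proof -
  have len: "length (f w) = length w \<and> f w \<in> tree p" if "w \<in> tree p" for w
    using that
  proof (induction w rule: rev_induct)
    case Nil
    show ?case by (simp add: assms(1))
  next
    case (snoc i w)
    with assms(2)[of w i] show ?case by auto
  qed
  have surj: "f ` tree p = tree p"
  proof
    show "f ` tree p \<subseteq> tree p" using len by auto
    show "tree p \<subseteq> f ` tree p"
    proof
      fix w assume w: "w \<in> tree p"
      let ?L = "{u. set u \<subseteq> {..<p} \<and> length u = length w}"
      have L: "?L \<subseteq> tree p" by (auto simp: tree_def)
      have "finite ?L" by (rule finite_lists_length_eq) simp
      moreover have "f ` ?L \<subseteq> ?L"
      proof
        fix v assume "v \<in> f ` ?L"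
        then obtain u where u: "u \<in> ?L" "v = f u" by blast
        hence "length v = length u \<and> v \<in> tree p" using len L by blast
        thus "v \<in> ?L" using u by (auto simp: tree_def)
      qed
      moreover have "inj_on f ?L" using inj L inj_on_subset by blast
      ultimately have "f ` ?L = ?L" by (rule endo_inj_surj)
      moreover have "w \<in> ?L" using w by (auto simp: tree_def)
      ultimately show "w \<in> f ` tree p" using L by blast
    qed
  qed
  have child: "(\<exists>i. f v = f u @ [i]) \<longleftrightarrow> (\<exists>i. v = u @ [i])"
    if uv: "u \<in> tree p" "v \<in> tree p" for u v
  proof
    assume "\<exists>i. v = u @ [i]"
    thus "\<exists>i. f v = f u @ [i]" using snoc[OF uv(1)] uv(2) by (metis tree_Cons tree_append)
  next
    assume "\<exists>i. f v = f u @ [i]"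
    then obtain i where i: "f v = f u @ [i]" ..
    hence "v \<noteq> []" using Nil by auto
    then obtain v' x where v: "v = v' @ [x]" by (metis rev_exhaust)
    hence v': "v' \<in> tree p" "x < p" using uv by auto
    from snoc[OF this] i v have "f v' = f u" by auto
    hence "v' = u" using inj v' uv by (auto dest: inj_onD)
    thus "\<exists>i. v = u @ [i]" using v by blast
  qed
  have "tree_adj (f u) (f v) \<longleftrightarrow> tree_adj u v" if "u \<in> tree p" "v \<in> tree p" for u v
    unfolding tree_adj_def ex_disj_distrib using child that by simp
  moreover have "restrict f (tree p) \<in> Bij (tree p)"
    using surj inj by (simp add: Bij_def bij_betw_def cong: inj_on_cong)
  ultimately show ?thesis
    using Nil by (simp add: tree_aut_def)
qed

lemma rot_word_in_tree: "w \<in> tree p \<Longrightarrow> rot_word p w \<in> tree p"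
  by (cases w) auto

lemma rot_word_snoc:
  assumes "w \<in> tree p" "i < p"
  shows "\<exists>j<p. rot_word p (w @ [i]) = rot_word p w @ [j]"
  using assms by (cases w) auto

lemma mod_Suc_inj: "i < p \<Longrightarrow> j < p \<Longrightarrow> Suc i mod p = Suc j mod p \<Longrightarrow> i = j"
  by (auto simp: mod_Suc split: if_splits)

lemma inj_rot_word: "inj_on (rot_word p) (tree p)"
proof (rule inj_onI)
  fix u v assume "u \<in> tree p" "v \<in> tree p" "rot_word p u = rot_word p v"
  thus "u = v" by (cases u; cases v) (auto dest: mod_Suc_inj)
qed

lemma rot_carrier: "rot p \<in> carrier (tree_aut p)"
  unfolding rot_def
  using rot_word_snoc inj_rot_word by (intro tree_autI) auto

lemma rot_word_funpow:
  "(rot_word p ^^ k) w = (case w of [] \<Rightarrow> [] | i # v \<Rightarrow> (if k = 0 then i else (i + k) mod p) # v)"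
  by (induction k) (auto split: list.splits simp: mod_Suc_eq)

lemma rot_word_funpow_Nil [simp]: "(rot_word p ^^ k) [] = []"
  by (simp add: rot_word_funpow)

lemma rot_word_funpow_in_tree: "w \<in> tree p \<Longrightarrow> (rot_word p ^^ k) w \<in> tree p"
  by (induction k) (auto simp: rot_word_in_tree)

lemma rot_word_funpow_snoc:
  assumes "w \<in> tree p" "i < p"
  shows "\<exists>j<p. (rot_word p ^^ k) (w @ [i]) = (rot_word p ^^ k) w @ [j]"
proof (induction k)
  case (Suc k)
  then obtain j where "j < p" "(rot_word p ^^ k) (w @ [i]) = (rot_word p ^^ k) w @ [j]" by blast
  thus ?case
    using rot_word_snoc[OF rot_word_funpow_in_tree[OF assms(1)], of j k] by simp
qed (use assms in auto)

lemma inj_rot_word_funpow: "inj_on (rot_word p ^^ k) (tree p)"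
proof (induction k)
  case (Suc k)
  have "inj_on (rot_word p) ((rot_word p ^^ k) ` tree p)"
    by (rule inj_on_subset[OF inj_rot_word]) (auto simp: rot_word_funpow_in_tree)
  from comp_inj_on[OF Suc this] show ?case by (simp add: comp_def)
qed simp

lemma inv_rot:
  assumes "p > 0"
  shows "inv\<^bsub>tree_aut p\<^esub> (rot p) = restrict (rot_word p ^^ (p - 1)) (tree p)"
proof -
  interpret group "tree_aut p" by (rule group_tree_aut)
  let ?r = "restrict (rot_word p ^^ (p - 1)) (tree p)"
  have r: "?r \<in> carrier (tree_aut p)"
    using rot_word_funpow_snoc inj_rot_word_funpow
    by (intro tree_autI) (auto simp: rot_word_funpow)
  have "?r (rot p w) = w" if "w \<in> tree p" for w
  proof -
    have "?r (rot p w) = (rot_word p ^^ (p - 1)) (rot_word p w)"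
      using that by (simp add: rot_def rot_word_in_tree)
    also have "\<dots> = (rot_word p ^^ p) w"
      using assms by (metis Suc_diff_1 funpow_Suc_right o_apply)
    also have "\<dots> = w"
      using that assms by (auto simp: rot_word_funpow split: list.splits)
    finally show ?thesis .
  qed
  hence "compose (tree p) ?r (rot p) = (\<lambda>w\<in>tree p. w)"
    by (auto simp: compose_def)
  moreover have "?r \<in> Bij (tree p)" "rot p \<in> Bij (tree p)"
    using r rot_carrier by (simp_all add: tree_aut_def)
  ultimately have "?r \<otimes>\<^bsub>tree_aut p\<^esub> rot p = \<one>\<^bsub>tree_aut p\<^esub>"
    by (simp add: tree_aut_def BijGroup_def)
  thus ?thesis using inv_equality r rot_carrier by blast
qed

lemma one_tree_aut: "\<one>\<^bsub>tree_aut p\<^esub> = (\<lambda>w\<in>tree p. w)"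
  by (simp add: tree_aut_def BijGroup_def)

lemma grig_b_eq: "grig_b = tree_tuple [grig_a, grig_c]"
  and grig_c_eq: "grig_c = tree_tuple [grig_a, grig_d]"
  and grig_d_eq: "grig_d = tree_tuple [\<one>\<^bsub>tree_aut 2\<^esub>, grig_b]"
  by (auto simp: grig_a_def grig_b_def grig_c_def grig_d_def rot_def tree_tuple_def one_tree_aut
      less_2_cases_iff numeral_2_eq_2 fun_eq_iff restrict_def split: list.splits)

lemma gs_b_eq:
  assumes "p \<ge> 3"
  shows "gs_b p = tree_tuple
    ([gs_a p, inv\<^bsub>tree_aut p\<^esub> (gs_a p)] @ replicate (p - 3) \<one>\<^bsub>tree_aut p\<^esub> @ [gs_b p])"
    (is "_ = tree_tuple ?l")
proof -
  have len: "length ?l = p" using assms by simp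
  have inv: "inv\<^bsub>tree_aut p\<^esub> (gs_a p) = restrict (rot_word p ^^ (p - 1)) (tree p)"
    using assms by (simp add: gs_a_def inv_rot)
  have nth: "?l ! i = (if i = 0 then gs_a p else if i = 1 then inv\<^bsub>tree_aut p\<^esub> (gs_a p)
      else if i = p - 1 then gs_b p else \<one>\<^bsub>tree_aut p\<^esub>)" if "i < p" for i
    using that assms by (auto simp: nth_append nth_Cons' )
  show ?thesis
  proof
    fix w
    show "gs_b p w = tree_tuple ?l w"
    proof (cases w)
      case Nil
      thus ?thesis by (simp add: gs_b_def tree_tuple_def)
    next
      case (Cons i v)
      show ?thesis
      proof (cases "w \<in> tree p")
        case True
        hence i: "i < p" and v: "v \<in> tree p" using Cons by auto
        have "tree_tuple ?l w = i # (?l ! i) v"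
          unfolding tree_tuple_def len using True Cons by simp
        also have "\<dots> = gs_b_word p w"
          unfolding nth[OF i] unfolding inv Cons using v by (simp add: gs_a_def rot_def gs_b_def one_tree_aut)
        finally show ?thesis using True by (simp add: gs_b_def)
      next
        case False
        thus ?thesis unfolding tree_tuple_def len by (simp add: gs_b_def)
      qed
    qed
  qed
qed

lemma grig_word_in_tree:
  "(w \<in> tree 2 \<longrightarrow> grig_b_word w \<in> tree 2) \<and> (w \<in> tree 2 \<longrightarrow> grig_c_word w \<in> tree 2) \<and>
   (w \<in> tree 2 \<longrightarrow> grig_d_word w \<in> tree 2)"
  by (induction w) (auto simp: rot_word_in_tree)

lemma grig_word_snoc:
  assumes "i < 2" "w \<in> tree 2"
  shows "(\<exists>j<2. grig_b_word (w @ [i]) = grig_b_word w @ [j]) \<and>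
    (\<exists>j<2. grig_c_word (w @ [i]) = grig_c_word w @ [j]) \<and>
    (\<exists>j<2. grig_d_word (w @ [i]) = grig_d_word w @ [j])"
  using assms(2)
proof (induction w)
  case (Cons x w)
  thus ?case using rot_word_snoc[of w 2 i] assms(1) by auto
qed (use assms in auto)

lemma grig_word_inj:
  assumes "u \<in> tree 2" "v \<in> tree 2"
  shows "(grig_b_word u = grig_b_word v \<longrightarrow> u = v) \<and> (grig_c_word u = grig_c_word v \<longrightarrow> u = v) \<and>
    (grig_d_word u = grig_d_word v \<longrightarrow> u = v)"
  using assms
proof (induction u arbitrary: v)
  case Nil
  thus ?case by (cases v) auto
next
  case (Cons x u)
  show ?case
  proof (cases v)
    case (Cons y v')
    with Cons.prems Cons.IH[of v'] inj_onD[OF inj_rot_word[of 2], of u v'] show ?thesis by auto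
  qed auto
qed

lemma grig_carrier: "{grig_a, grig_b, grig_c, grig_d} \<subseteq> carrier (tree_aut 2)"
proof -
  have "grig_b \<in> carrier (tree_aut 2)" unfolding grig_b_def
    using grig_word_snoc grig_word_inj by (intro tree_autI inj_onI) auto
  moreover have "grig_c \<in> carrier (tree_aut 2)" unfolding grig_c_def
    using grig_word_snoc grig_word_inj by (intro tree_autI inj_onI) auto
  moreover have "grig_d \<in> carrier (tree_aut 2)" unfolding grig_d_def
    using grig_word_snoc grig_word_inj by (intro tree_autI inj_onI) auto
  ultimately show ?thesis using rot_carrier by (simp add: grig_a_def)
qed

lemma gs_b_word_snoc:
  assumes "i < p" "w \<in> tree p"
  shows "\<exists>j<p. gs_b_word p (w @ [i]) = gs_b_word p w @ [j]"
  using assms(2)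
proof (induction w)
  case (Cons x w)
  thus ?case using rot_word_snoc[of w p i] rot_word_funpow_snoc[of w p i "p - 1"] assms(1) by auto
qed (use assms in auto)

lemma gs_b_word_inj:
  assumes "u \<in> tree p" "v \<in> tree p" "gs_b_word p u = gs_b_word p v"
  shows "u = v"
  using assms
proof (induction u arbitrary: v)
  case Nil
  thus ?case by (cases v) auto
next
  case (Cons x u)
  then obtain v' where v: "v = x # v'" by (cases v) auto
  with Cons.prems Cons.IH[of v'] inj_onD[OF inj_rot_word[of p], of u v']
    inj_onD[OF inj_rot_word_funpow[of "p - 1" p], of u v']
  show ?case by (auto split: if_splits)
qed

lemma gs_carrier: "{gs_a p, gs_b p} \<subseteq> carrier (tree_aut p)"
proof -
  have "gs_b p \<in> carrier (tree_aut p)" unfolding gs_b_def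
    using gs_b_word_snoc gs_b_word_inj by (intro tree_autI inj_onI) auto
  thus ?thesis using rot_carrier by (simp add: gs_a_def)
qed

lemma card_orbits_le_index:
  assumes "transitive_action G \<Omega> \<phi>" and U: "subgroup U G" and fin: "finite (rcosets\<^bsub>G\<^esub> U)"
  shows "finite (orbits (G\<lparr>carrier := U\<rparr>) \<Omega> \<phi>)"
    and "card (orbits (G\<lparr>carrier := U\<rparr>) \<Omega> \<phi>) \<le> card (rcosets\<^bsub>G\<^esub> U)"
proof -
  interpret transitive_action G \<Omega> \<phi> by fact
  interpret group G using group_hom group_hom.axioms(1) by auto
  have "finite (orbits (G\<lparr>carrier := U\<rparr>) \<Omega> \<phi>) \<and>
    card (orbits (G\<lparr>carrier := U\<rparr>) \<Omega> \<phi>) \<le> card (rcosets\<^bsub>G\<^esub> U)"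
  proof (cases "\<Omega> = {}")
    case True
    thus ?thesis by (simp add: orbits_def)
  next
    case False
    then obtain x where x: "x \<in> \<Omega>" by blast
    have "orbits (G\<lparr>carrier := U\<rparr>) \<Omega> \<phi> \<subseteq> (\<lambda>C. (\<lambda>g. \<phi> g x) ` C) ` (rcosets\<^bsub>G\<^esub> U)"
    proof
      fix Y assume "Y \<in> orbits (G\<lparr>carrier := U\<rparr>) \<Omega> \<phi>"
      then obtain y where y: "y \<in> \<Omega>" "Y = {\<phi> u y | u. u \<in> U}"
        by (auto simp: orbits_def orbit_def)
      obtain g where g: "g \<in> carrier G" "\<phi> g x = y" using unique_orbit x y by blast
      have "\<phi> u y = \<phi> (u \<otimes>\<^bsub>G\<^esub> g) x" if "u \<in> U" for u
        using composition_rule[OF x, of u g] subgroup.mem_carrier[OF U that] g by simp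
      hence "Y = (\<lambda>g. \<phi> g x) ` (U #>\<^bsub>G\<^esub> g)"
        unfolding y(2) r_coset_def by force
      thus "Y \<in> (\<lambda>C. (\<lambda>g. \<phi> g x) ` C) ` (rcosets\<^bsub>G\<^esub> U)"
        using g by (auto simp: RCOSETS_def)
    qed
    thus ?thesis
      using fin by (meson finite_imageI finite_subset surj_card_le)
  qed
  thus "finite (orbits (G\<lparr>carrier := U\<rparr>) \<Omega> \<phi>)"
    and "card (orbits (G\<lparr>carrier := U\<rparr>) \<Omega> \<phi>) \<le> card (rcosets\<^bsub>G\<^esub> U)" by blast+
qed

lemma max_orbits_set:
  fixes G (structure)
  assumes "transitive_action G \<Omega> \<phi>" and "n \<ge> 1"
  defines "S \<equiv> {card (orbits (G\<lparr>carrier := U\<rparr>) \<Omega> \<phi>) | U.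
     subgroup U G \<and> finite (rcosets U) \<and> card (rcosets U) \<le> n}"
  shows "finite S" and "S \<noteq> {}"
proof -
  interpret transitive_action G \<Omega> \<phi> by fact
  interpret group G using group_hom group_hom.axioms(1) by auto
  have "S \<subseteq> {..n}"
    unfolding S_def using card_orbits_le_index(2)[OF assms(1)] le_trans by blast
  thus "finite S" using finite_subset by blast
  have "rcosets (carrier G) = {carrier G}"
    using coset_join2[OF _ subgroup_self] by (auto simp: RCOSETS_def intro!: bexI[of _ \<one>])
  hence "card (orbits (G\<lparr>carrier := carrier G\<rparr>) \<Omega> \<phi>) \<in> S"
    unfolding S_def using subgroup_self assms(2) by (intro CollectI exI[of _ "carrier G"]) auto
  thus "S \<noteq> {}" by blast
qed

end

theory Submission
  imports Defs
begin

text \<open>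
  The action is the one on the left cosets of a subgroup \<open>H\<close>, for which the orbits of \<open>U\<close> are the
  double cosets \<open>U g H\<close>. The subgroup \<open>H\<close> interpolates between two extremes. Let \<open>Q k\<close> be the pointwise
  stabiliser of the subtree below the vertex \<open>0 ^ k\<close> and let \<open>Q\<close> be the ascending union of the \<open>Q k\<close>.

  \<^item> Each \<open>Q k\<close> has almost as many double cosets as possible: \<open>Q k\<close> fixes the \<open>p ^ (n - k)\<close> vertices of
    level \<open>n\<close> below \<open>0 ^ k\<close>, and a vertex of level \<open>n\<close> has a stabiliser of index at most \<open>p ^ n\<close>
    (\<open>card_double_cosets_cone_fix\<close>).

  \<^item> The union \<open>Q\<close> has only linearly many: \<open>O(n)\<close> double cosets for all subgroups of index at most
    \<open>p ^ n\<close> (\<open>card_double_cosets_linear\<close>). This is where branching enters. Let \<open>L\<close> be a normal subgroup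
    of finite index that contains a copy of itself acting below each vertex, and let \<open>U\<close> be a subgroup of
    index \<open>s\<close> in \<open>L\<close>. On the subtree below a vertex \<open>v\<close> of a fixed level, \<open>U\<close> acts through a subgroup of
    index \<open>s v\<close> in \<open>L\<close>, and the product of the \<open>s v\<close> is at most \<open>s\<close>. Either the product drops to
    \<open>s / 2\<close>, or \<open>U\<close> permutes that level as \<open>L\<close> does, and then a nontrivial \<open>s v\<close> never comes alone. In
    both cases induction on \<open>s\<close> gives a bound that is logarithmic in \<open>s\<close>.

  As \<open>f\<close> grows faster than \<open>n\<close> and slower than \<open>p ^ n\<close>, the number of double cosets stays below \<open>f\<close> for
  \<open>Q\<close> from some \<open>n0\<close> on, and for each \<open>Q k\<close> it exceeds \<open>f\<close> somewhere beyond \<open>n0\<close>. Starting from \<open>Q\<close>, a descending sequence of subgroups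
  \<open>H i\<close> that stay below \<open>f\<close> is constructed (\<open>slow_step\<close>, \<open>prescribed_growth\<close>). Given \<open>H i\<close>, choose \<open>k\<close> so
  large that \<open>F i = H i \<inter> Q k\<close> has the same image as \<open>H i\<close> in a prescribed finite quotient of the group;
  then \<open>F i\<close> cannot be told from \<open>H i\<close> by subgroups of small index, but it exceeds \<open>f\<close> somewhere. The
  excess is already visible in the quotient by a level stabiliser; this quotient is a \<open>p\<close>-group, so there is a
  chain from \<open>F i\<close> up to \<open>H i\<close> with steps of index \<open>p\<close>, and a step of index \<open>p\<close> changes the number of
  double cosets by a factor of at most \<open>p\<close>. The first member of the chain that stays below \<open>f\<close> everywhere is
  therefore at least \<open>f / p\<close> somewhere, and it is taken as the next subgroup. The subgroup \<open>H\<close> is the union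
  of the \<open>F i\<close>: it has the same image as \<open>H i\<close> in the \<open>i\<close>-th finite quotient, so it inherits the upper
  bound as well as the infinitely many lower bounds. The finite quotients can be chosen to control all
  subgroups of bounded index at once because a finitely generated group has only finitely many of them
  (\<open>finite_bounded_index\<close>).

  It remains to exhibit \<open>L\<close>. For the Grigorchuk group it is the normal closure of \<open>(a b)\<^sup>2\<close>, for the
  Gupta-Sidki groups the normal closure of the commutator of \<open>a\<close> and \<open>b\<^sup>2\<close>
  (\<open>grigorchuk_group_branching\<close>, \<open>gupta_sidki_group_branching\<close>).
\<close>

section \<open>Cosets and double cosets\<close>

text \<open>
  Counting the cosets of \<open>U\<close> that meet \<open>A\<close> gives the index of \<open>A \<inter> U\<close> in \<open>A\<close> when \<open>A\<close> is a subgroup,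
  without passing to another ambient group.
\<close>

definition cosets_meeting :: "('a, 'b) monoid_scheme \<Rightarrow> 'a set \<Rightarrow> 'a set \<Rightarrow> 'a set set" where
  "cosets_meeting G U A = (\<lambda>x. U #>\<^bsub>G\<^esub> x) ` A"

definition double_coset :: "('a, 'b) monoid_scheme \<Rightarrow> 'a set \<Rightarrow> 'a set \<Rightarrow> 'a \<Rightarrow> 'a set" where
  "double_coset G U H g = {u \<otimes>\<^bsub>G\<^esub> g \<otimes>\<^bsub>G\<^esub> h | u h. u \<in> U \<and> h \<in> H}"

definition double_cosets :: "('a, 'b) monoid_scheme \<Rightarrow> 'a set \<Rightarrow> 'a set \<Rightarrow> 'a set set" where
  "double_cosets G U H = double_coset G U H ` carrier G"

lemma double_cosetE:
  assumes "x \<in> double_coset G U H g"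
  obtains u h where "u \<in> U" "h \<in> H" "x = u \<otimes>\<^bsub>G\<^esub> g \<otimes>\<^bsub>G\<^esub> h"
  using assms by (auto simp: double_coset_def)

lemma rcosets_eq_cosets_meeting: "rcosets\<^bsub>G\<^esub> U = cosets_meeting G U (carrier G)"
  by (auto simp: RCOSETS_def cosets_meeting_def)

context group
begin

lemma inv_mult_cancel:
  assumes "x \<in> carrier G" "y \<in> carrier G"
  shows "inv x \<otimes> (x \<otimes> y) = y" "x \<otimes> (inv x \<otimes> y) = y"
  using assms by (simp_all add: m_assoc[symmetric])

lemma rcos_eq_iff:
  assumes "subgroup U G" "x \<in> carrier G" "y \<in> carrier G"
  shows "U #> x = U #> y \<longleftrightarrow> x \<otimes> inv y \<in> U"
proof -
  interpret subgroup U G by fact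
  have "U #> x = U #> y \<longleftrightarrow> x \<in> U #> y"
    using assms repr_independence[of x U y] rcos_self[of x U] by auto
  thus ?thesis using rcos_module[of y x] assms is_group by auto
qed

text \<open>
  Upper bounds on an index come from an invariant with values in a finite set that separates the cosets.
\<close>

lemma card_cosets_meeting_le:
  assumes "subgroup U G" "A \<subseteq> carrier G" "finite S" "f ` A \<subseteq> S"
    and "\<And>x y. x \<in> A \<Longrightarrow> y \<in> A \<Longrightarrow> f x = f y \<Longrightarrow> x \<otimes> inv y \<in> U"
  shows "finite (cosets_meeting G U A)" "card (cosets_meeting G U A) \<le> card S"
proof -
  have "cosets_meeting G U A \<subseteq> (\<lambda>s. U #> (SOME x. x \<in> A \<and> f x = s)) ` S"
  proof
    fix C assume "C \<in> cosets_meeting G U A"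
    then obtain x where x: "x \<in> A" "C = U #> x" by (auto simp: cosets_meeting_def)
    define y where "y = (SOME y. y \<in> A \<and> f y = f x)"
    have y: "y \<in> A \<and> f y = f x" unfolding y_def by (rule someI[of _ x]) (use x in auto)
    hence "C = U #> y" using x assms rcos_eq_iff[of U x y] by auto
    thus "C \<in> (\<lambda>s. U #> (SOME x. x \<in> A \<and> f x = s)) ` S" using x assms(4) y_def by blast
  qed
  thus "finite (cosets_meeting G U A)" "card (cosets_meeting G U A) \<le> card S"
    using assms(3) by (auto intro: finite_subset surj_card_le)
qed

text \<open>
  Lower bounds on an index come from a family of elements in distinct cosets.
\<close>

lemma card_le_cosets_meeting:
  assumes "subgroup U G" "A \<subseteq> carrier G" "finite (cosets_meeting G U A)" "f ` T \<subseteq> A"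
    and "\<And>x y. x \<in> T \<Longrightarrow> y \<in> T \<Longrightarrow> f x \<otimes> inv (f y) \<in> U \<Longrightarrow> x = y"
  shows "finite T" "card T \<le> card (cosets_meeting G U A)"
proof -
  have inj: "inj_on (\<lambda>x. U #> f x) T"
  proof (rule inj_onI)
    fix x y assume xy: "x \<in> T" "y \<in> T" "U #> f x = U #> f y"
    hence "f x \<in> carrier G" "f y \<in> carrier G" using assms(2,4) by auto
    thus "x = y" using rcos_eq_iff[OF assms(1)] assms(5) xy by blast
  qed
  have sub: "(\<lambda>x. U #> f x) ` T \<subseteq> cosets_meeting G U A"
    using assms(4) by (auto simp: cosets_meeting_def)
  show "finite T" "card T \<le> card (cosets_meeting G U A)"
    using inj_on_finite[OF inj sub assms(3)] card_inj_on_le[OF inj sub assms(3)] by blast+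
qed

lemma transversal_exists:
  assumes "subgroup U G" "A \<subseteq> carrier G" "finite (cosets_meeting G U A)"
  shows "\<exists>T\<subseteq>A. finite T \<and> card T = card (cosets_meeting G U A) \<and>
    (\<forall>x\<in>A. \<exists>t\<in>T. x \<otimes> inv t \<in> U) \<and> (\<forall>x\<in>T. \<forall>y\<in>T. x \<otimes> inv y \<in> U \<longrightarrow> x = y)"
proof -
  obtain T where T: "T \<subseteq> A" "inj_on (\<lambda>x. U #> x) T" "(\<lambda>x. U #> x) ` T = cosets_meeting G U A"
    using subset_image_inj[of "cosets_meeting G U A" "\<lambda>x. U #> x" A] unfolding cosets_meeting_def by auto
  have TG: "T \<subseteq> carrier G" using T(1) assms(2) by blast
  have "finite T" using T assms(3) by (metis finite_imageD)
  moreover have "card T = card (cosets_meeting G U A)" using card_image[OF T(2)] T(3) by simp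
  moreover have "\<exists>t\<in>T. x \<otimes> inv t \<in> U" if x: "x \<in> A" for x
  proof -
    have "U #> x \<in> (\<lambda>x. U #> x) ` T" unfolding T(3) using x by (auto simp: cosets_meeting_def)
    then obtain t where t: "t \<in> T" "U #> x = U #> t" by blast
    hence "x \<in> carrier G" "t \<in> carrier G" using assms(2) TG x by auto
    thus ?thesis using rcos_eq_iff[OF assms(1)] t by blast
  qed
  moreover have "x = y" if xy: "x \<in> T" "y \<in> T" "x \<otimes> inv y \<in> U" for x y
  proof -
    have "x \<in> carrier G" "y \<in> carrier G" using TG xy by auto
    hence "U #> x = U #> y" using rcos_eq_iff[OF assms(1)] xy(3) by simp
    thus ?thesis using inj_onD[OF T(2)] xy by simp
  qed
  ultimately show ?thesis using T(1) by blast
qed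

lemma double_coset_self:
  assumes "subgroup U G" "subgroup H G" "g \<in> carrier G"
  shows "g \<in> double_coset G U H g"
  unfolding double_coset_def using assms subgroup.one_closed
  by (intro CollectI exI[of _ \<one>]) auto

lemma double_coset_subset:
  assumes "subgroup U G" "subgroup H G" "g \<in> carrier G" "g' \<in> double_coset G U H g"
  shows "double_coset G U H g' \<subseteq> double_coset G U H g"
proof
  interpret U: subgroup U G by fact
  interpret H: subgroup H G by fact
  fix x assume "x \<in> double_coset G U H g'"
  then obtain u h where x: "u \<in> U" "h \<in> H" "x = u \<otimes> g' \<otimes> h" by (auto simp: double_coset_def)
  obtain v k where g': "v \<in> U" "k \<in> H" "g' = v \<otimes> g \<otimes> k" using assms(4) by (auto simp: double_coset_def)
  have "x = (u \<otimes> v) \<otimes> g \<otimes> (k \<otimes> h)" using x g' assms by (simp add: m_assoc)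
  thus "x \<in> double_coset G U H g" unfolding double_coset_def using x g' by blast
qed

lemma double_coset_carrier:
  assumes "subgroup U G" "subgroup H G" "g \<in> carrier G"
  shows "double_coset G U H g \<subseteq> carrier G"
  using assms subgroup.mem_carrier by (fastforce simp: double_coset_def)

lemma double_coset_sym:
  assumes "subgroup U G" "subgroup H G" "g \<in> carrier G" "g' \<in> double_coset G U H g"
  shows "g \<in> double_coset G U H g'"
proof -
  interpret U: subgroup U G by fact
  interpret H: subgroup H G by fact
  obtain v k where g': "v \<in> U" "k \<in> H" "g' = v \<otimes> g \<otimes> k" using assms(4) by (auto simp: double_coset_def)
  have "inv v \<otimes> g' \<otimes> inv k = (inv v \<otimes> v) \<otimes> (g \<otimes> (k \<otimes> inv k))"
    unfolding g'(3) using g'(1,2) assms(3) by (simp only: m_assoc U.mem_carrier H.mem_carrier m_closed inv_closed)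
  hence "g = inv v \<otimes> g' \<otimes> inv k" using g'(1,2) assms(3) by simp
  thus ?thesis unfolding double_coset_def using g' by blast
qed

lemma double_coset_eqI:
  assumes "subgroup U G" "subgroup H G" "g \<in> carrier G" "g' \<in> double_coset G U H g"
  shows "double_coset G U H g' = double_coset G U H g"
proof -
  have "g' \<in> carrier G" using assms double_coset_carrier by blast
  with double_coset_subset double_coset_sym assms show ?thesis by (metis subset_antisym)
qed

lemma double_cosets_mono:
  assumes "subgroup U G" "subgroup H G" "subgroup U' G" "subgroup H' G" "U' \<subseteq> U" "H' \<subseteq> H"
    and fin: "finite (double_cosets G U' H')"
  shows "finite (double_cosets G U H)" "card (double_cosets G U H) \<le> card (double_cosets G U' H')"
proof -
  have "double_coset G U H x = double_coset G U H g"
    if "g \<in> carrier G" "x \<in> double_coset G U' H' g" for g x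
    using that double_coset_eqI[of U H g x] assms unfolding double_coset_def by blast
  hence *: "double_coset G U H (SOME x. x \<in> double_coset G U' H' g) = double_coset G U H g"
    if "g \<in> carrier G" for g
    using that double_coset_self[of U' H' g] assms by (metis someI_ex)
  have "double_cosets G U H \<subseteq> (\<lambda>D. double_coset G U H (SOME x. x \<in> D)) ` double_cosets G U' H'"
    unfolding double_cosets_def using * by (auto simp: image_image)
  thus "finite (double_cosets G U H)" "card (double_cosets G U H) \<le> card (double_cosets G U' H')"
    using fin by (auto intro: finite_subset surj_card_le)
qed

lemma card_double_cosets_le_index:
  assumes "subgroup U G" "subgroup H G" "finite (rcosets U)"
  shows "finite (double_cosets G U H)" "card (double_cosets G U H) \<le> card (rcosets U)"
proof -
  have "double_cosets G U {\<one>} = rcosets U"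
  proof -
    have "double_coset G U {\<one>} g = U #> g" if "g \<in> carrier G" for g
      using that subgroup.mem_carrier[OF assms(1)] by (force simp: double_coset_def r_coset_def)
    thus ?thesis by (auto simp: double_cosets_def RCOSETS_def)
  qed
  thus "finite (double_cosets G U H)" "card (double_cosets G U H) \<le> card (rcosets U)"
    using double_cosets_mono[of U H U "{\<one>}"] assms triv_subgroup subgroup.one_closed[OF assms(2)] by auto
qed

text \<open>
  If \<open>H\<close> is covered by the left cosets \<open>r H'\<close>, then \<open>U g H\<close> is covered by the \<open>U g r H'\<close>, one for each coset.
  This is the step that costs the factor \<open>p\<close> when the index is \<open>p\<close>.
\<close>

lemma card_double_cosets_refine:
  assumes U: "subgroup U G" and H: "subgroup H G" and H': "subgroup H' G"
    and idx: "finite (cosets_meeting G H' H)"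
    and fin: "finite (double_cosets G U H)"
  shows "card (double_cosets G U H') \<le> card (cosets_meeting G H' H) * card (double_cosets G U H)"
proof -
  interpret U: subgroup U G by fact
  interpret H: subgroup H G by fact
  interpret H': subgroup H' G by fact
  obtain T where T: "T \<subseteq> H" "finite T" "card T = card (cosets_meeting G H' H)"
    "\<And>x. x \<in> H \<Longrightarrow> \<exists>t\<in>T. x \<otimes> inv t \<in> H'"
    using transversal_exists[OF H' H.subset idx] by metis
  define R where "R = m_inv G ` T"
  have R: "finite R" "R \<subseteq> H" unfolding R_def using T(1,2) by auto
  have dec: "\<exists>r\<in>R. \<exists>h'\<in>H'. h = r \<otimes> h'" if h: "h \<in> H" for h
  proof -
    obtain t where t: "t \<in> T" "inv h \<otimes> inv t \<in> H'" using T(4)[of "inv h"] h by auto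
    have tH: "t \<in> H" using t T(1) by auto
    have "t \<otimes> h \<in> H'" using H'.m_inv_closed[OF t(2)] h tH by (simp add: inv_mult_group)
    moreover have "h = inv t \<otimes> (t \<otimes> h)" using h tH by (simp add: m_assoc[symmetric])
    ultimately show ?thesis using t(1) unfolding R_def by blast
  qed
  define rep where "rep D = (SOME g. g \<in> carrier G \<and> D = double_coset G U H g)" for D
  have "double_cosets G U H' \<subseteq>
      (\<lambda>(r, D). double_coset G U H' (rep D \<otimes> r)) ` (R \<times> double_cosets G U H)"
  proof
    fix Y assume "Y \<in> double_cosets G U H'"
    then obtain g where g: "g \<in> carrier G" "Y = double_coset G U H' g" by (auto simp: double_cosets_def)
    let ?D = "double_coset G U H g"
    have "rep ?D \<in> carrier G \<and> ?D = double_coset G U H (rep ?D)"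
      unfolding rep_def by (rule someI[of _ g]) (use g in blast)
    hence rep: "rep ?D \<in> carrier G" "double_coset G U H (rep ?D) = ?D" by auto
    have "g \<in> double_coset G U H (rep ?D)" using double_coset_self[OF U H g(1)] rep(2) by simp
    then obtain u h where uh: "u \<in> U" "h \<in> H" "g = u \<otimes> rep ?D \<otimes> h"
      by (rule double_cosetE)
    obtain r h' where r: "r \<in> R" "h' \<in> H'" "h = r \<otimes> h'" using dec uh(2) by blast
    have rG: "r \<in> carrier G" using r R(2) by auto
    have "g = u \<otimes> (rep ?D \<otimes> r) \<otimes> h'" using uh(1,3) r(2,3) rep(1) rG by (simp add: m_assoc)
    hence "g \<in> double_coset G U H' (rep ?D \<otimes> r)"
      using uh(1) r(2) unfolding double_coset_def[of G U H'] by blast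
    hence "Y = double_coset G U H' (rep ?D \<otimes> r)"
      unfolding g(2) by (rule double_coset_eqI[OF U H' m_closed[OF rep(1) rG]])
    thus "Y \<in> (\<lambda>(r, D). double_coset G U H' (rep D \<otimes> r)) ` (R \<times> double_cosets G U H)"
      using r(1) g(1) by (intro rev_image_eqI[of "(r, ?D)"]) (auto simp: double_cosets_def)
  qed
  hence "card (double_cosets G U H') \<le> card (R \<times> double_cosets G U H)"
    using R(1) fin by (intro surj_card_le) auto
  hence "card (double_cosets G U H') \<le> card R * card (double_cosets G U H)"
    by (simp add: card_cartesian_product)
  moreover have "card R \<le> card T" unfolding R_def by (rule card_image_le[OF T(2)])
  ultimately show ?thesis unfolding T(3)[symmetric] by (meson le_trans mult_le_mono1)
qed

text \<open>
  Since \<open>N\<close> is normal and lies in \<open>U\<close>, it can be moved past \<open>g\<close> and absorbed: \<open>U g N H' = U g H'\<close>. Hence only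
  the image of \<open>H\<close> in the quotient by \<open>N\<close> matters.
\<close>

lemma double_cosets_cong:
  assumes U: "subgroup U G" and H: "subgroup H G" and H': "subgroup H' G" "H' \<subseteq> H"
    and N: "N \<lhd> G" "N \<subseteq> U" "\<And>h. h \<in> H \<Longrightarrow> \<exists>n\<in>N. \<exists>h'\<in>H'. h = n \<otimes> h'"
  shows "double_cosets G U H = double_cosets G U H'"
proof -
  interpret U: subgroup U G by fact
  interpret H: subgroup H G by fact
  interpret H': subgroup H' G by fact
  interpret N: normal N G by fact
  have "double_coset G U H g = double_coset G U H' g" if g: "g \<in> carrier G" for g
  proof
    show "double_coset G U H' g \<subseteq> double_coset G U H g" using H'(2) by (auto simp: double_coset_def)
    show "double_coset G U H g \<subseteq> double_coset G U H' g"
    proof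
      fix x assume "x \<in> double_coset G U H g"
      then obtain u h where x: "u \<in> U" "h \<in> H" "x = u \<otimes> g \<otimes> h" by (auto simp: double_coset_def)
      obtain n h' where n: "n \<in> N" "h' \<in> H'" "h = n \<otimes> h'" using N(3) x(2) by blast
      have conj: "g \<otimes> n \<otimes> inv g \<in> N" using n g N.inv_op_closed2 by blast
      have "x = (u \<otimes> (g \<otimes> n \<otimes> inv g)) \<otimes> g \<otimes> h'"
        using x(1,3) n g by (simp add: m_assoc inv_solve_left)
      thus "x \<in> double_coset G U H' g" using conj N(2) x(1) n(2) unfolding double_coset_def by blast
    qed
  qed
  thus ?thesis by (simp add: double_cosets_def)
qed

end

section \<open>The action on left cosets\<close>

definition left_cosets :: "('a, 'b) monoid_scheme \<Rightarrow> 'a set \<Rightarrow> 'a set set" where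
  "left_cosets G H = (\<lambda>g. g <#\<^bsub>G\<^esub> H) ` carrier G"

definition left_translation :: "('a, 'b) monoid_scheme \<Rightarrow> 'a set \<Rightarrow> 'a \<Rightarrow> 'a set \<Rightarrow> 'a set" where
  "left_translation G H g = (\<lambda>C\<in>left_cosets G H. g <#\<^bsub>G\<^esub> C)"

context group
begin

lemma left_translation_closed:
  assumes "subgroup H G" "g \<in> carrier G" "C \<in> left_cosets G H"
  shows "g <# C \<in> left_cosets G H"
  using assms lcos_m_assoc[of H g] subgroup.subset[OF assms(1)] by (auto simp: left_cosets_def)

lemma transitive_action_left_cosets:
  assumes H: "subgroup H G"
  shows "transitive_action G (left_cosets G H) (left_translation G H)"
proof -
  let ?\<Omega> = "left_cosets G H" and ?\<phi> = "left_translation G H"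
  interpret H: subgroup H G by fact
  have sub: "C \<subseteq> carrier G" if "C \<in> ?\<Omega>" for C
    using that l_coset_subset_G[OF H.subset] unfolding left_cosets_def by blast
  have one: "\<one> <# C = C" if "C \<in> ?\<Omega>" for C using sub[OF that] lcos_mult_one by simp
  have assoc: "x <# (y <# C) = (x \<otimes> y) <# C" if "C \<in> ?\<Omega>" "x \<in> carrier G" "y \<in> carrier G" for x y C
    using that sub lcos_m_assoc by simp
  have bij: "?\<phi> g \<in> Bij ?\<Omega>" if g: "g \<in> carrier G" for g
  proof -
    have "bij_betw (?\<phi> g) ?\<Omega> ?\<Omega>"
      by (rule bij_betwI[where g = "?\<phi> (inv g)"])
        (use g left_translation_closed[OF H] assoc one in \<open>auto simp: left_translation_def\<close>)
    thus ?thesis by (simp add: Bij_def left_translation_def)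
  qed
  have "?\<phi> (x \<otimes> y) = ?\<phi> x \<otimes>\<^bsub>BijGroup ?\<Omega>\<^esub> ?\<phi> y" if "x \<in> carrier G" "y \<in> carrier G" for x y
    using that bij assoc left_translation_closed[OF H]
    by (auto simp: BijGroup_def left_translation_def compose_def fun_eq_iff)
  hence hom: "?\<phi> \<in> hom G (BijGroup ?\<Omega>)" using bij by (auto simp: hom_def BijGroup_def)
  have "\<exists>g\<in>carrier G. ?\<phi> g x = y" if xy: "x \<in> ?\<Omega>" "y \<in> ?\<Omega>" for x y
  proof -
    obtain a b where ab: "a \<in> carrier G" "b \<in> carrier G" "x = a <# H" "y = b <# H"
      using xy by (auto simp: left_cosets_def)
    have "?\<phi> (b \<otimes> inv a) x = y"
      using ab xy by (simp add: left_translation_def lcos_m_assoc H.subset m_assoc)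
    thus ?thesis using ab by blast
  qed
  thus ?thesis
    using hom group_BijGroup is_group
    by (simp add: transitive_action_def group_action_def group_hom_def group_hom_axioms_def
        transitive_action_axioms_def)
qed

text \<open>
  The union of the left cosets in the orbit of \<open>g H\<close> is \<open>U g H\<close>, and an orbit is recovered from this union
  as the set of the left cosets that it contains.
\<close>

lemma card_orbits_left_cosets:
  assumes U: "subgroup U G" and H: "subgroup H G"
  shows "card (orbits (G\<lparr>carrier := U\<rparr>) (left_cosets G H) (left_translation G H)) =
    card (double_cosets G U H)"
proof -
  interpret U: subgroup U G by fact
  interpret H: subgroup H G by fact
  let ?O = "\<lambda>g. orbit (G\<lparr>carrier := U\<rparr>) (left_translation G H) (g <# H)"
  have orb: "?O g = (\<lambda>u. (u \<otimes> g) <# H) ` U" if "g \<in> carrier G" for g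
  proof -
    have "left_translation G H u (g <# H) = (u \<otimes> g) <# H" if "u \<in> U" for u
      using that \<open>g \<in> carrier G\<close> lcos_m_assoc[OF H.subset, of u g]
      by (auto simp: left_translation_def left_cosets_def)
    thus ?thesis by (auto simp: orbit_def)
  qed
  have un: "\<Union> (?O g) = double_coset G U H g" if "g \<in> carrier G" for g
    unfolding orb[OF that] by (auto simp: double_coset_def l_coset_def)
  have rec: "?O g = (\<lambda>x. x <# H) ` \<Union> (?O g)" if g: "g \<in> carrier G" for g
  proof -
    have "(u \<otimes> g \<otimes> h) <# H = (u \<otimes> g) <# H" if "u \<in> U" "h \<in> H" for u h
    proof -
      have "u \<otimes> g \<otimes> h \<in> (u \<otimes> g) <# H" using that by (auto simp: l_coset_def)
      from l_repr_independence[OF this _ H] show ?thesis using that g by simp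
    qed
    moreover have "(\<lambda>u. (u \<otimes> g) <# H) ` U \<subseteq> (\<lambda>x. x <# H) ` double_coset G U H g"
    proof (rule subsetI)
      fix C assume "C \<in> (\<lambda>u. (u \<otimes> g) <# H) ` U"
      then obtain u where u: "u \<in> U" "C = (u \<otimes> g) <# H" by blast
      have "u \<otimes> g \<otimes> \<one> = u \<otimes> g" using u g by simp
      moreover have "u \<otimes> g \<otimes> \<one> \<in> double_coset G U H g"
        unfolding double_coset_def using u(1) H.one_closed by blast
      ultimately show "C \<in> (\<lambda>x. x <# H) ` double_coset G U H g" using u(2) by auto
    qed
    ultimately show ?thesis unfolding un[OF g] unfolding orb[OF g] by (auto simp: double_coset_def)
  qed
  have O: "orbits (G\<lparr>carrier := U\<rparr>) (left_cosets G H) (left_translation G H) = ?O ` carrier G"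
    by (auto simp: orbits_def left_cosets_def)
  have "bij_betw Union (?O ` carrier G) (double_cosets G U H)"
    unfolding bij_betw_def double_cosets_def
  proof
    show "inj_on Union (?O ` carrier G)"
      by (rule inj_on_inverseI[where g = "\<lambda>A. (\<lambda>x. x <# H) ` A"]) (use rec in auto)
    show "\<Union> ` ?O ` carrier G = double_coset G U H ` carrier G"
      using un by (auto simp: image_image)
  qed
  thus ?thesis unfolding O by (rule bij_betw_same_card)
qed

end

section \<open>Subgroups of bounded index in a finitely generated group\<close>

definition bounded_index :: "('a, 'b) monoid_scheme \<Rightarrow> nat \<Rightarrow> 'a set set" where
  "bounded_index G n = {U. subgroup U G \<and> finite (rcosets\<^bsub>G\<^esub> U) \<and> card (rcosets\<^bsub>G\<^esub> U) \<le> n}"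

text \<open>
  The kernel of the action on all the cosets of all the subgroups of index at most \<open>n\<close>; equivalently, the
  intersection of these subgroups. In this form normality and finite index are immediate.
\<close>

definition index_core :: "('a, 'b) monoid_scheme \<Rightarrow> nat \<Rightarrow> 'a set" where
  "index_core G n = {x \<in> carrier G. \<forall>U\<in>bounded_index G n. \<forall>C\<in>rcosets\<^bsub>G\<^esub> U. C #>\<^bsub>G\<^esub> x = C}"

context group
begin

lemma rcoset_translate:
  assumes "subgroup U G" "C \<in> rcosets U" "x \<in> carrier G"
  shows "C #> x \<in> rcosets U"
  using assms coset_mult_assoc[OF subgroup.subset[OF assms(1)]] by (auto simp: RCOSETS_def)

lemma rcoset_translate_mult:
  assumes "subgroup U G" "C \<in> rcosets U" "x \<in> carrier G" "y \<in> carrier G"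
  shows "(C #> x) #> y = C #> (x \<otimes> y)"
  using assms coset_mult_assoc subgroup.rcosets_carrier[OF assms(1) is_group assms(2)] by simp

text \<open>
  Number the cosets of \<open>U\<close>. The table of how the generators permute the numbers determines where every element
  sends the coset \<open>U\<close>, and hence \<open>U\<close> itself as the stabiliser of that coset; there are only finitely many tables.
\<close>

theorem finite_bounded_index:
  assumes S: "finite S" "S \<subseteq> carrier G" "carrier G = generate G S"
  shows "finite (bounded_index G n)"
proof -
  have "\<forall>U\<in>bounded_index G n. \<exists>b. inj_on b (rcosets U) \<and> b ` (rcosets U) \<subseteq> {..<n}"
  proof
    fix U assume "U \<in> bounded_index G n"
    hence fin: "finite (rcosets U)" "card (rcosets U) \<le> n" by (auto simp: bounded_index_def)
    obtain b where "bij_betw b (rcosets U) {0..<card (rcosets U)}"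
      using ex_bij_betw_finite_nat[OF fin(1)] by blast
    thus "\<exists>b. inj_on b (rcosets U) \<and> b ` (rcosets U) \<subseteq> {..<n}"
      using fin(2) by (intro exI[of _ b]) (auto simp: bij_betw_def)
  qed
  then obtain b where b: "\<And>U. U \<in> bounded_index G n \<Longrightarrow> inj_on (b U) (rcosets U)"
    "\<And>U. U \<in> bounded_index G n \<Longrightarrow> b U ` (rcosets U) \<subseteq> {..<n}" by metis
  define S' where "S' = S \<union> m_inv G ` S"
  define tab where "tab U = {(s, b U C, b U (C #> s)) | s C. s \<in> S' \<and> C \<in> rcosets U}" for U
  have S': "finite S'" "S' \<subseteq> carrier G" using S(1,2) by (auto simp: S'_def)
  have tab_range: "(tab U, b U U) \<in> Pow (S' \<times> {..<n} \<times> {..<n}) \<times> {..<n}"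
    if U: "U \<in> bounded_index G n" for U
  proof -
    have sub: "subgroup U G" using U by (simp add: bounded_index_def)
    have "U \<in> rcosets U" using subgroup.subgroup_in_rcosets[OF sub is_group] .
    thus ?thesis using b(2)[OF U] rcoset_translate[OF sub] S'(2) unfolding tab_def by blast
  qed
  have "inj_on (\<lambda>U. (tab U, b U U)) (bounded_index G n)"
  proof (rule inj_onI)
    fix U V assume UV: "U \<in> bounded_index G n" "V \<in> bounded_index G n" "(tab U, b U U) = (tab V, b V V)"
    have U: "subgroup U G" and V: "subgroup V G" using UV by (auto simp: bounded_index_def)
    have step: "b U (U #> (x \<otimes> s)) = b V (V #> (x \<otimes> s))"
      if s: "s \<in> S'" and x: "x \<in> carrier G" "b U (U #> x) = b V (V #> x)" for s x
    proof -
      have "U #> x \<in> rcosets U" "V #> x \<in> rcosets V"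
        using rcosetsI[OF subgroup.subset[OF U] x(1)] rcosetsI[OF subgroup.subset[OF V] x(1)] by auto
      moreover have "(s, b U (U #> x), b U ((U #> x) #> s)) \<in> tab V"
        using UV(3) s calculation(1) unfolding tab_def by blast
      then obtain C where C: "C \<in> rcosets V" "b V C = b U (U #> x)" "b V (C #> s) = b U ((U #> x) #> s)"
        unfolding tab_def by auto
      ultimately have "C = V #> x" using inj_onD[OF b(1)[OF UV(2)]] x(2) by simp
      thus ?thesis using C(3) coset_mult_assoc subgroup.subset[OF U] subgroup.subset[OF V] s S'(2) x(1) by auto
    qed
    have gen: "b U (U #> (x \<otimes> g)) = b V (V #> (x \<otimes> g))"
      if "g \<in> generate G S" "x \<in> carrier G" "b U (U #> x) = b V (V #> x)" for g x
      using that
    proof (induction g arbitrary: x rule: generate.induct)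
      case (eng h1 h2)
      have "h1 \<in> carrier G" "h2 \<in> carrier G" using eng.hyps S(3) by auto
      with eng.IH(2)[of "x \<otimes> h1"] eng.IH(1)[of x] eng.prems show ?case by (simp add: m_assoc)
    qed (auto simp: S'_def intro: step)
    have eq: "b U (U #> g) = b V (V #> g)" if "g \<in> carrier G" for g
    proof -
      have "g \<in> generate G S" using that S(3) by simp
      moreover have "b U (U #> \<one>) = b V (V #> \<one>)"
        using UV(3) subgroup.subset[OF U] subgroup.subset[OF V] by simp
      ultimately have "b U (U #> (\<one> \<otimes> g)) = b V (V #> (\<one> \<otimes> g))" by (intro gen) simp_all
      thus ?thesis using that by simp
    qed
    have mem: "g \<in> W \<longleftrightarrow> b W (W #> g) = b W W" if "W \<in> bounded_index G n" "g \<in> carrier G" for W g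
    proof -
      have W: "subgroup W G" using that by (simp add: bounded_index_def)
      have "W #> g \<in> rcosets W" "W \<in> rcosets W"
        using subgroup.subgroup_in_rcosets[OF W is_group] rcosetsI[OF subgroup.subset[OF W] that(2)] by auto
      hence "b W (W #> g) = b W W \<longleftrightarrow> W #> g = W" using b(1)[OF that(1)] by (auto dest: inj_onD)
      thus ?thesis using coset_join1[OF _ that(2) W] coset_join2[OF that(2) W] by blast
    qed
    have "g \<in> U \<longleftrightarrow> g \<in> V" if "g \<in> carrier G" for g
      using mem[OF UV(1) that] mem[OF UV(2) that] eq[OF that] UV(3) by simp
    thus "U = V" using subgroup.subset[OF U] subgroup.subset[OF V] by blast
  qed
  moreover have "(\<lambda>U. (tab U, b U U)) ` bounded_index G n \<subseteq> Pow (S' \<times> {..<n} \<times> {..<n}) \<times> {..<n}"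
    using tab_range by (rule image_subsetI)
  ultimately show ?thesis by (rule inj_on_finite) (use S'(1) in auto)
qed

lemma index_core_normal: "index_core G n \<lhd> G"
proof -
  have U: "subgroup U G" if "U \<in> bounded_index G n" for U using that by (simp add: bounded_index_def)
  have sub: "subgroup (index_core G n) G"
  proof (rule subgroupI)
    show "index_core G n \<subseteq> carrier G" by (auto simp: index_core_def)
    have "C #> \<one> = C" if "V \<in> bounded_index G n" "C \<in> rcosets V" for V C
      using subgroup.rcosets_carrier[OF U[OF that(1)] is_group that(2)] by simp
    hence "\<one> \<in> index_core G n" by (simp add: index_core_def)
    thus "index_core G n \<noteq> {}" by blast
  next
    fix x assume x: "x \<in> index_core G n"
    hence xG: "x \<in> carrier G" by (simp add: index_core_def)
    have "C #> inv x = C" if "V \<in> bounded_index G n" "C \<in> rcosets V" for V C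
    proof -
      have "C #> x = C" using x that by (auto simp: index_core_def)
      thus ?thesis using rcoset_translate_mult[OF U[OF that(1)] that(2) xG, of "inv x"] xG
        subgroup.rcosets_carrier[OF U[OF that(1)] is_group that(2)] by simp
    qed
    thus "inv x \<in> index_core G n" using xG by (simp add: index_core_def)
  next
    fix x y assume xy: "x \<in> index_core G n" "y \<in> index_core G n"
    hence G: "x \<in> carrier G" "y \<in> carrier G" by (auto simp: index_core_def)
    have "C #> (x \<otimes> y) = C" if "V \<in> bounded_index G n" "C \<in> rcosets V" for V C
      using xy that rcoset_translate_mult[OF U[OF that(1)] that(2) G] by (auto simp: index_core_def)
    thus "x \<otimes> y \<in> index_core G n" using G by (simp add: index_core_def)
  qed
  show ?thesis
  proof (rule normal_invI[OF sub])
    fix g x assume g: "g \<in> carrier G" and x: "x \<in> index_core G n"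
    hence xG: "x \<in> carrier G" by (simp add: index_core_def)
    have "C #> (g \<otimes> x \<otimes> inv g) = C" if V: "V \<in> bounded_index G n" "C \<in> rcosets V" for V C
    proof -
      have Cg: "C #> g \<in> rcosets V" using rcoset_translate U V g by blast
      have "C #> (g \<otimes> x \<otimes> inv g) = ((C #> g) #> x) #> inv g"
        using rcoset_translate_mult[OF U[OF V(1)] V(2)] rcoset_translate_mult[OF U[OF V(1)] Cg] g xG
        by (simp add: m_assoc)
      also have "\<dots> = (C #> g) #> inv g" using x V(1) Cg by (auto simp: index_core_def)
      also have "\<dots> = C" using rcoset_translate_mult[OF U[OF V(1)] V(2) g, of "inv g"] g
        subgroup.rcosets_carrier[OF U[OF V(1)] is_group V(2)] by simp
      finally show ?thesis .
    qed
    thus "g \<otimes> x \<otimes> inv g \<in> index_core G n" using g xG by (simp add: index_core_def)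
  qed
qed

lemma index_core_subset:
  assumes "U \<in> bounded_index G n" shows "index_core G n \<subseteq> U"
proof
  fix x assume x: "x \<in> index_core G n"
  have U: "subgroup U G" using assms by (simp add: bounded_index_def)
  have "U #> x = U" using x assms subgroup.subgroup_in_rcosets[OF U is_group] by (auto simp: index_core_def)
  thus "x \<in> U" using x coset_join1[OF _ _ U] by (auto simp: index_core_def)
qed

lemma finite_index_core:
  assumes "finite (bounded_index G n)"
  shows "finite (rcosets (index_core G n))"
proof -
  let ?P = "Sigma (bounded_index G n) (\<lambda>U. rcosets U)"
  define f where "f x = (\<lambda>(U, C)\<in>?P. C #> x)" for x
  have finP: "finite ?P" using assms by (auto simp: bounded_index_def)
  have fin: "finite (?P \<rightarrow>\<^sub>E snd ` ?P)" using finP by (intro finite_PiE) auto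
  have range: "f ` carrier G \<subseteq> ?P \<rightarrow>\<^sub>E snd ` ?P"
  proof (rule image_subsetI)
    fix x assume x: "x \<in> carrier G"
    have "C #> x \<in> snd ` ?P" if "U \<in> bounded_index G n" "C \<in> rcosets U" for U C
      using rcoset_translate[OF _ that(2) x] that(1) by (force simp: bounded_index_def)
    thus "f x \<in> ?P \<rightarrow>\<^sub>E snd ` ?P" by (auto simp: f_def)
  qed
  have core: "x \<otimes> inv y \<in> index_core G n" if xy: "x \<in> carrier G" "y \<in> carrier G" "f x = f y" for x y
  proof -
    have "C #> (x \<otimes> inv y) = C" if V: "V \<in> bounded_index G n" "C \<in> rcosets V" for V C
    proof -
      have sV: "subgroup V G" using V by (simp add: bounded_index_def)
      have "C #> x = C #> y" using fun_cong[OF xy(3), of "(V, C)"] V by (simp add: f_def)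
      hence "C #> (x \<otimes> inv y) = C #> (y \<otimes> inv y)"
        using rcoset_translate_mult[OF sV V(2)] xy by (metis inv_closed)
      thus ?thesis using xy subgroup.rcosets_carrier[OF sV is_group V(2)] by simp
    qed
    thus ?thesis using xy by (simp add: index_core_def)
  qed
  show ?thesis unfolding rcosets_eq_cosets_meeting
    by (rule card_cosets_meeting_le(1)[OF normal_imp_subgroup[OF index_core_normal] subset_refl fin range core])
qed

end

section \<open>Subgroups of finite \<open>p\<close>-groups\<close>

lemma (in group) conj_pow_mem:
  assumes "subgroup L G" "x \<in> carrier G" "\<And>l. l \<in> L \<Longrightarrow> x \<otimes> l \<otimes> inv x \<in> L" "l \<in> L"
  shows "x [^] (n::nat) \<otimes> l \<otimes> inv (x [^] n) \<in> L"
proof (induction n)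
  case 0
  show ?case using assms(4) subgroup.mem_carrier[OF assms(1)] by simp
next
  case (Suc n)
  have l: "l \<in> carrier G" using assms(1,4) by (rule subgroup.mem_carrier)
  have "x [^] Suc n \<otimes> l \<otimes> inv (x [^] Suc n) = x \<otimes> (x [^] n \<otimes> l \<otimes> inv (x [^] n)) \<otimes> inv x"
    unfolding nat_pow_Suc2[OF assms(2)] using assms(2) l by (simp add: m_assoc inv_mult_group)
  thus ?case using assms(3) Suc.IH by simp
qed

text \<open>
  Another prime factor \<open>q\<close> of the order would give a subgroup of order \<open>q\<close> by Sylow's theorem.
\<close>

lemma (in group) order_prime_power:
  assumes p: "Factorial_Ring.prime p" and fin: "finite (carrier G)"
    and pow: "\<And>x. x \<in> carrier G \<Longrightarrow> \<exists>i. x [^] (p ^ i :: nat) = \<one>"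
  shows "\<exists>e. order G = p ^ e"
proof -
  have pos: "order G \<noteq> 0" using fin order_gt_0_iff_finite by simp
  have "\<not> is_unit p" using p by (metis not_prime_unit)
  then obtain k where k: "order G = p ^ multiplicity p (order G) * k" "\<not> p dvd k"
    using multiplicity_decompose'[OF pos] by metis
  have "k = 1"
  proof (rule ccontr)
    assume "k \<noteq> 1"
    then obtain q where q: "Factorial_Ring.prime q" "q dvd k" using prime_factor_nat by blast
    have "order G = q ^ 1 * (order G div q)"
      using q(2) k(1) by (metis dvd_mult dvd_mult_div_cancel power_one_right)
    from sylow_thm[OF q(1) is_group this fin] obtain H where H: "subgroup H G" "card H = q"
      by auto
    have "q > 1" using q(1) prime_gt_1_nat by blast
    hence "H \<noteq> {\<one>}" using H(2) by auto
    then obtain x where x: "x \<in> H" "x \<noteq> \<one>" using subgroup.one_closed[OF H(1)] by blast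
    have xG: "x \<in> carrier G" using subgroup.mem_carrier[OF H(1) x(1)] .
    have "x [^]\<^bsub>G\<lparr>carrier := H\<rparr>\<^esub> order (G\<lparr>carrier := H\<rparr>) = \<one>\<^bsub>G\<lparr>carrier := H\<rparr>\<^esub>"
      using x(1) by (intro group.pow_order_eq_1[OF subgroup.subgroup_is_group[OF H(1) is_group]]) simp
    hence "x [^] q = \<one>" using H(2) by (simp add: order_def nat_pow_consistent[symmetric])
    hence "ord x dvd q" using pow_eq_id[OF xG] by blast
    moreover obtain i where "x [^] (p ^ i) = \<one>" using pow[OF xG] by blast
    hence "ord x dvd p ^ i" using pow_eq_id[OF xG] by blast
    moreover have "coprime q (p ^ i)"
    proof -
      have "q \<noteq> p" using q(2) k(2) by blast
      thus ?thesis using primes_coprime[OF q(1) p] by simp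
    qed
    ultimately have "ord x = 1" by (metis coprime_common_divisor nat_dvd_1_iff_1)
    thus False using x(2) ord_eq_1[OF xG] by simp
  qed
  thus ?thesis using k(1) by auto
qed

text \<open>
  Let \<open>L\<close> act on its left cosets. All orbits have \<open>p\<close>-power size and their sizes add up to a multiple of \<open>p\<close>,
  so besides \<open>L\<close> itself another coset \<open>y L\<close> is fixed, which means that \<open>y\<close> normalises \<open>L\<close>.
\<close>

lemma (in group) p_group_normalizer_grows:
  assumes p: "Factorial_Ring.prime p" and ord: "order G = p ^ e"
    and L: "subgroup L G" "L \<noteq> carrier G"
  obtains x where "x \<in> carrier G" "x \<notin> L" "\<And>l. l \<in> L \<Longrightarrow> x \<otimes> l \<otimes> inv x \<in> L"
proof -
  interpret L: subgroup L G by fact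
  let ?\<Omega> = "left_cosets G L" and ?\<phi> = "left_translation G L" and ?L = "G\<lparr>carrier := L\<rparr>"
  have pp: "p > 1" using p prime_gt_1_nat by blast
  have finG: "finite (carrier G)" using ord pp unfolding order_def by (intro card_ge_0_finite) simp
  have p_dvd: "k = 1 \<or> p dvd k" if "k dvd p ^ e" for k
  proof -
    have "\<exists>i\<le>e. k = p ^ i" using divides_primepow_nat[OF p, of k e] that by simp
    then obtain i where "k = p ^ i" by blast
    thus ?thesis by (cases i) auto
  qed
  interpret A: transitive_action G ?\<Omega> ?\<phi> by (rule transitive_action_left_cosets[OF L(1)])
  have hom: "?\<phi> \<in> hom G (BijGroup ?\<Omega>)"
    using A.group_hom by (simp add: group_hom_def group_hom_axioms_def)
  have B: "group_action ?L ?\<Omega> ?\<phi>"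
  proof -
    have "?\<phi> \<in> hom ?L (BijGroup ?\<Omega>)" using hom L.subset unfolding hom_def by fastforce
    thus ?thesis unfolding group_action_def group_hom_def group_hom_axioms_def
      using L.subgroup_is_group[OF is_group] group_BijGroup by blast
  qed
  interpret B: group_action ?L ?\<Omega> ?\<phi> by (rule B)
  have fin: "finite ?\<Omega>" unfolding left_cosets_def by (rule finite_imageI[OF finG])
  have "order ?L = card L" by (simp add: order_def)
  hence ordL: "order ?L dvd p ^ e" unfolding ord[symmetric] lagrange[OF L(1), symmetric] by simp
  have LO: "L \<in> ?\<Omega>"
    unfolding left_cosets_def using lcos_mult_one[OF L.subset] by (metis imageI one_closed)
  have tL: "?\<phi> g L = g <# L" for g using LO by (simp add: left_translation_def)
  have memL: "g <# L = L \<longleftrightarrow> g \<in> L" if "g \<in> carrier G" for g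
  proof
    assume "g <# L = L"
    moreover have "g \<otimes> \<one> \<in> g <# L" unfolding l_coset_def using L.one_closed by blast
    ultimately show "g \<in> L" using that by simp
  qed (rule coset_join3[OF that L(1)])
  have "orbit G ?\<phi> L = ?\<Omega>" by (auto simp: orbit_def tL left_cosets_def)
  moreover have "stabilizer G ?\<phi> L = L" unfolding stabilizer_def tL using memL L.subset by blast
  ultimately have cardO: "card ?\<Omega> * card L = p ^ e"
    using A.orbit_stabilizer_theorem[OF LO] ord by simp
  have "card ?\<Omega> \<noteq> 1"
  proof
    assume "card ?\<Omega> = 1"
    hence "card L = card (carrier G)" using cardO ord by (simp add: order_def)
    thus False using L(2) L.subset finG by (simp add: card_subset_eq)
  qed
  hence pO: "p dvd card ?\<Omega>"
    using p_dvd cardO by (metis dvd_triv_left)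
  have orb: "card Z = 1 \<or> p dvd card Z" if Z: "Z \<in> orbits ?L ?\<Omega> ?\<phi>" for Z
  proof -
    obtain x where x: "x \<in> ?\<Omega>" "Z = orbit ?L ?\<phi> x" using Z by (auto simp: orbits_def)
    have "card Z dvd p ^ e"
      using B.orbit_stabilizer_theorem[OF x(1)] ordL x(2) by (metis dvd_mult_left)
    thus ?thesis using p_dvd by blast
  qed
  let ?O = "orbits ?L ?\<Omega> ?\<phi>"
  have part: "partition ?\<Omega> ?O" by (rule B.orbit_partition)
  have finO: "finite ?O" using fin by (auto simp: orbits_def)
  have un: "\<Union> ?O = ?\<Omega>" using part by (metis partition.partition_coverture)
  have dis: "disjoint ?O"
  proof (rule pairwiseI)
    fix Z Y assume XY: "Z \<in> ?O" "Y \<in> ?O" "Z \<noteq> Y"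
    have "False" if "x \<in> Z" "x \<in> Y" for x
    proof -
      have "x \<in> ?\<Omega>" using un XY(1) that(1) by blast
      from partition.unique_class[OF part this] show False using XY that by blast
    qed
    thus "disjnt Z Y" by (auto simp: disjnt_def)
  qed
  have sum: "card ?\<Omega> = (\<Sum>Z\<in>?O. card Z)"
    using card_Union_disjoint[of ?O] dis fin un by (metis Sup_upper finite_subset)
  have LL: "{L} \<in> ?O"
  proof -
    have "l <# L = L" if "l \<in> L" for l using memL[OF L.mem_carrier[OF that]] that by simp
    hence "{l <# L | l. l \<in> L} = {L}" using L.one_closed by blast
    hence "orbit ?L ?\<phi> L = {L}" by (simp add: orbit_def tL)
    thus ?thesis using LO unfolding orbits_def by (metis (mono_tags, lifting) mem_Collect_eq)
  qed
  have "\<exists>Z\<in>?O. Z \<noteq> {L} \<and> card Z = 1"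
  proof (rule ccontr)
    assume "\<not> ?thesis"
    hence "p dvd (\<Sum>Z\<in>?O - {{L}}. card Z)" using orb by (intro dvd_sum) blast
    moreover have "card ?\<Omega> = 1 + (\<Sum>Z\<in>?O - {{L}}. card Z)"
      using sum sum.remove[OF finO LL, of card] by simp
    ultimately have "p dvd 1" using pO by (metis dvd_add_left_iff)
    thus False using pp by simp
  qed
  then obtain Z where Z: "Z \<in> ?O" "Z \<noteq> {L}" "card Z = 1" by blast
  then obtain y where y: "y \<in> carrier G" "Z = orbit ?L ?\<phi> (y <# L)"
    by (auto simp: orbits_def left_cosets_def)
  have yO: "y <# L \<in> ?\<Omega>" using y by (auto simp: left_cosets_def)
  have yX: "y <# L \<in> Z" using B.orbit_refl[OF yO] y(2) by simp
  hence Xy: "Z = {y <# L}" using Z(3) by (metis card_1_singletonE singletonD)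
  hence ynL: "y \<notin> L" using Z(2) memL[OF y(1)] by auto
  have fix_y: "inv y \<otimes> l \<otimes> y \<in> L" if l: "l \<in> L" for l
  proof -
    have "?\<phi> l (y <# L) \<in> Z" using l y(2) by (auto simp: orbit_def)
    hence "l <# (y <# L) = y <# L" using Xy yO by (simp add: left_translation_def)
    hence "inv y <# (l <# (y <# L)) = inv y <# (y <# L)" by simp
    hence "(inv y \<otimes> l \<otimes> y) <# L = L"
      using l y(1) L.subset by (simp add: lcos_m_assoc lcos_mult_one m_assoc)
    thus ?thesis using memL l y(1) by simp
  qed
  show thesis
  proof
    show "inv y \<in> carrier G" using y by simp
    show "inv y \<notin> L" using ynL y(1) L.m_inv_closed[of "inv y"] by auto
    show "inv y \<otimes> l \<otimes> inv (inv y) \<in> L" if "l \<in> L" for l using fix_y[OF that] y(1) by simp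
  qed
qed

text \<open>
  Replace an element that normalises \<open>L\<close> by its last \<open>p\<close>-power outside \<open>L\<close>.
\<close>

lemma (in group) p_group_cyclic_extension:
  assumes p: "Factorial_Ring.prime p" and ord: "order G = p ^ e"
    and L: "subgroup L G" "L \<noteq> carrier G"
  obtains x where "x \<in> carrier G" "x \<notin> L" "\<And>l. l \<in> L \<Longrightarrow> x \<otimes> l \<otimes> inv x \<in> L" "x [^] p \<in> L"
proof -
  interpret L: subgroup L G by fact
  obtain y where y: "y \<in> carrier G" "y \<notin> L" "\<And>l. l \<in> L \<Longrightarrow> y \<otimes> l \<otimes> inv y \<in> L"
    using p_group_normalizer_grows[OF assms] by blast
  have "y [^] (p ^ e) = \<one>" using pow_order_eq_1[OF y(1)] ord by simp
  hence ex: "\<exists>i. y [^] (p ^ i) \<in> L" by (metis L.one_closed)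
  define i where "i = (LEAST i. y [^] (p ^ i) \<in> L)"
  have i: "y [^] (p ^ i) \<in> L" "\<And>j. j < i \<Longrightarrow> y [^] (p ^ j) \<notin> L"
    unfolding i_def using LeastI_ex[OF ex] not_less_Least by auto
  have "i \<noteq> 0" using i(1) y by (metis nat_pow_eone power_0)
  then obtain j where j: "i = Suc j" by (cases i) auto
  show thesis
  proof
    show "y [^] (p ^ j) \<in> carrier G" using y by simp
    show "y [^] (p ^ j) \<notin> L" using i(2) j by simp
    show "y [^] (p ^ j) \<otimes> l \<otimes> inv (y [^] (p ^ j)) \<in> L" if "l \<in> L" for l
      by (rule conj_pow_mem[OF L(1) y(1) y(3) that])
    show "(y [^] (p ^ j)) [^] p \<in> L"
      using i(1) y(1) j by (simp add: nat_pow_pow mult.commute)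
  qed
qed


text \<open>
  The extension is \<open>L\<close> together with the powers of one element \<open>x\<close> that normalises \<open>L\<close> with \<open>x ^ p\<close> in \<open>L\<close>; such an
  \<open>x\<close> is found in the finite \<open>p\<close>-group \<open>M / N\<close>.
\<close>

lemma (in group) index_p_extension:
  assumes p: "Factorial_Ring.prime p" and N: "N \<lhd> G" "card (rcosets N) = p ^ e"
    and L: "subgroup L G" "N \<subseteq> L" and M: "subgroup M G" "L \<subset> M"
  obtains K where "subgroup K G" "L \<subset> K" "K \<subseteq> M"
    "finite (cosets_meeting G L K)" "card (cosets_meeting G L K) \<le> p"
proof -
  interpret N: normal N G by fact
  interpret L: subgroup L G by fact
  interpret M: subgroup M G by fact
  let ?Q = "G Mod N"
  let ?P = "?Q\<lparr>carrier := (\<lambda>x. N #> x) ` M\<rparr>" and ?L = "(\<lambda>x. N #> x) ` L"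
  have pp: "p > 0" using p prime_gt_0_nat by blast
  interpret Q: group ?Q by (rule N.factorgroup_is_group)
  interpret h: group_hom G ?Q "\<lambda>x. N #> x"
    by (intro group_hom.intro group_hom_axioms.intro is_group Q.is_group N.r_coset_hom_Mod)
  have subM: "subgroup ((\<lambda>x. N #> x) ` M) ?Q" by (rule h.subgroup_img_is_subgroup[OF M(1)])
  have subL: "subgroup ?L ?Q" by (rule h.subgroup_img_is_subgroup[OF L(1)])
  interpret P: group ?P by (rule Q.subgroup_imp_group[OF subM])
  have subLP: "subgroup ?L ?P"
    using Q.subgroup_incl[OF subL subM] M(2) by blast
  have mem: "g \<in> L" if g: "g \<in> carrier G" "N #> g \<in> ?L" for g
  proof -
    obtain l where l: "l \<in> L" "N #> g = N #> l" using g(2) by blast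
    hence "g \<otimes> inv l \<in> L" using rcos_eq_iff[OF N.subgroup_axioms g(1)] L(2) by auto
    hence "(g \<otimes> inv l) \<otimes> l \<in> L" using l(1) by (rule L.m_closed)
    thus ?thesis using g(1) l(1) by (simp add: m_assoc)
  qed
  have "order ?Q = p ^ e" using N(2) by (simp add: order_def FactGroup_def)
  hence "order ?P dvd p ^ e"
    using Q.lagrange[OF subM] by (simp add: order_def) (metis dvd_triv_right)
  then obtain e' where ord: "order ?P = p ^ e'" using divides_primepow_nat[OF p, of _ e] by auto
  have ne: "?L \<noteq> carrier ?P"
  proof
    assume "?L = carrier ?P"
    hence "M \<subseteq> L" using mem M.mem_carrier by auto
    thus False using M(2) by blast
  qed
  obtain c where c: "c \<in> carrier ?P" "c \<notin> ?L" "\<And>l. l \<in> ?L \<Longrightarrow> c \<otimes>\<^bsub>?P\<^esub> l \<otimes>\<^bsub>?P\<^esub> inv\<^bsub>?P\<^esub> c \<in> ?L"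
    "c [^]\<^bsub>?P\<^esub> p \<in> ?L"
    using P.p_group_cyclic_extension[OF p ord subLP ne] by blast
  obtain x where x: "x \<in> M" "c = N #> x" using c(1) by auto
  have xG: "x \<in> carrier G" using x by simp
  have xL: "x \<notin> L" using c(2) x by blast
  have conj: "x \<otimes> l \<otimes> inv x \<in> L" if l: "l \<in> L" for l
  proof (rule mem)
    have "inv\<^bsub>?P\<^esub> c = N #> inv x"
      using Q.m_inv_consistent[OF subM, of c] c(1) x h.hom_inv[OF xG] by simp
    hence "N #> (x \<otimes> l \<otimes> inv x) = c \<otimes>\<^bsub>?P\<^esub> (N #> l) \<otimes>\<^bsub>?P\<^esub> inv\<^bsub>?P\<^esub> c"
      using x xG l h.hom_mult by (simp del: mult_FactGroup)
    thus "N #> (x \<otimes> l \<otimes> inv x) \<in> ?L" using c(3) l by simp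
  qed (use xG l in simp)
  have xp: "x [^] p \<in> L"
  proof (rule mem)
    have "c [^]\<^bsub>?P\<^esub> p = N #> (x [^] p)"
      using h.hom_nat_pow[OF xG, of p] x by (simp add: Q.nat_pow_consistent[symmetric])
    thus "N #> (x [^] p) \<in> ?L" using c(4) by simp
  qed (use xG in simp)
  define K where "K = {l \<otimes> x [^] (i::nat) | l i. l \<in> L}"
  have Kmem: "l \<otimes> x [^] (i::nat) \<in> K" if "l \<in> L" for l i using that by (auto simp: K_def)
  have KE: "\<exists>l i. l \<in> L \<and> k = l \<otimes> x [^] (i::nat)" if "k \<in> K" for k using that by (auto simp: K_def)
  have cpow: "x [^] i \<otimes> l \<otimes> inv (x [^] i) \<in> L" if "l \<in> L" for l and i :: nat
    by (rule conj_pow_mem[OF L(1) xG conj that])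
  have subK: "subgroup K G"
  proof (rule subgroupI)
    show "K \<subseteq> carrier G" using xG by (auto simp: K_def)
    show "K \<noteq> {}" using Kmem[OF L.one_closed] by blast
  next
    fix k assume "k \<in> K"
    then obtain l and i :: nat where k: "l \<in> L" "k = l \<otimes> x [^] i" using KE by blast
    obtain q where q: "p = Suc q" using pp by (cases p) auto
    \<comment> \<open>Only conjugation by positive powers of \<open>x\<close> is known to preserve \<open>L\<close>, so the inverse of \<open>x ^ i\<close>
      is rewritten as \<open>x ^ (q * i)\<close> times a power of the inverse of \<open>x ^ p\<close>, which lies in \<open>L\<close>.\<close>
    have pw: "(x [^] p) [^] i = x [^] (q * i) \<otimes> x [^] i"
    proof -
      have "(x [^] p) [^] i = x [^] (q * i + i)" unfolding nat_pow_pow[OF xG] q by (simp add: add.commute)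
      thus ?thesis using nat_pow_mult[OF xG] by simp
    qed
    have "inv k = inv ((x [^] p) [^] i) \<otimes> (x [^] (q * i) \<otimes> inv l \<otimes> inv (x [^] (q * i))) \<otimes> x [^] (q * i)"
      unfolding pw k(2) using k(1) xG by (simp add: inv_mult_group m_assoc inv_mult_cancel)
    moreover have "(x [^] p) [^] i \<in> L" using xp by (induction i) auto
    ultimately show "inv k \<in> K" using cpow[of "inv l" "q * i"] k(1) Kmem by auto
  next
    fix k k' assume kk: "k \<in> K" "k' \<in> K"
    obtain l and i :: nat where "l \<in> L" "k = l \<otimes> x [^] i" using KE[OF kk(1)] by blast
    moreover obtain l' and i' :: nat where "l' \<in> L" "k' = l' \<otimes> x [^] i'" using KE[OF kk(2)] by blast
    ultimately have k: "l \<in> L" "k = l \<otimes> x [^] i" "l' \<in> L" "k' = l' \<otimes> x [^] i'" by auto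
    have "k \<otimes> k' = (l \<otimes> (x [^] i \<otimes> l' \<otimes> inv (x [^] i))) \<otimes> x [^] (i + i')"
      unfolding nat_pow_mult[OF xG, symmetric] k(2,4) using k(1,3) xG
      by (simp add: m_assoc inv_mult_cancel)
    thus "k \<otimes> k' \<in> K" using cpow[OF k(3), of i] k(1) Kmem by auto
  qed
  have "L \<subseteq> K" using Kmem[where i = 0] L.subset by fastforce
  moreover have "x \<in> K" using Kmem[OF L.one_closed, of 1] xG by simp
  ultimately have LK: "L \<subset> K" using xL by blast
  have KM: "K \<subseteq> M"
  proof
    fix k assume "k \<in> K"
    then obtain l and i :: nat where k: "l \<in> L" "k = l \<otimes> x [^] i" using KE by blast
    have "x [^] i \<in> M" using x(1) by (induction i) auto
    thus "k \<in> M" using k M(2) by auto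
  qed
  have "cosets_meeting G L K \<subseteq> (\<lambda>i. L #> (x [^] i)) ` {..<p}"
  proof
    fix C assume "C \<in> cosets_meeting G L K"
    then obtain l and i :: nat where C: "l \<in> L" "C = L #> (l \<otimes> x [^] i)"
      unfolding cosets_meeting_def using KE by blast
    have "(x [^] p) [^] j \<in> L" for j :: nat using xp by (induction j) auto
    hence "(x [^] p) [^] (i div p) \<in> L" by blast
    moreover have "x [^] i = (x [^] p) [^] (i div p) \<otimes> x [^] (i mod p)"
      using xG by (simp add: nat_pow_pow nat_pow_mult)
    ultimately have "l \<otimes> x [^] i \<otimes> inv (x [^] (i mod p)) \<in> L"
      using C(1) xG by (simp add: m_assoc)
    hence "C = L #> (x [^] (i mod p))" using rcos_eq_iff[OF L(1)] C xG by simp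
    thus "C \<in> (\<lambda>i. L #> (x [^] i)) ` {..<p}" using pp by auto
  qed
  hence "finite (cosets_meeting G L K)" "card (cosets_meeting G L K) \<le> p"
    using surj_card_le[of "{..<p}" "cosets_meeting G L K"] by (auto intro: finite_subset)
  thus thesis using that subK LK KM by blast
qed

section \<open>Prescribing the growth of the number of double cosets\<close>

lemma bounded_index_mono: "m \<le> n \<Longrightarrow> bounded_index G m \<subseteq> bounded_index G n"
  by (auto simp: bounded_index_def)

lemma (in group) finite_subgroups_above:
  assumes N: "subgroup N G" "finite (rcosets N)"
  shows "finite {L. subgroup L G \<and> N \<subseteq> L}"
proof -
  have "L = \<Union> {C \<in> rcosets N. C \<subseteq> L}" if L: "subgroup L G" "N \<subseteq> L" for L
  proof
    show "L \<subseteq> \<Union> {C \<in> rcosets N. C \<subseteq> L}"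
    proof
      fix x assume x: "x \<in> L"
      hence xG: "x \<in> carrier G" using L(1) subgroup.mem_carrier by metis
      have "N #> x \<subseteq> L" using L x subgroup.m_closed[OF L(1)] unfolding r_coset_def by blast
      moreover have "N #> x \<in> rcosets N" using rcosetsI[OF subgroup.subset[OF N(1)] xG] .
      ultimately show "x \<in> \<Union> {C \<in> rcosets N. C \<subseteq> L}" using rcos_self[OF xG N(1)] by blast
    qed
  qed blast
  hence "{L. subgroup L G \<and> N \<subseteq> L} \<subseteq> Union ` Pow (rcosets N)" by blast
  thus ?thesis using N(2) by (meson finite_Pow_iff finite_imageI finite_subset)
qed

lemma (in group) subgroup_chain_Union:
  fixes F :: "nat \<Rightarrow> 'a set"
  assumes F: "\<And>i. subgroup (F i) G" and mono: "\<And>i j. i \<le> j \<Longrightarrow> F i \<subseteq> F j"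
  shows "subgroup (\<Union>i. F i) G"
proof (rule subgroupI)
  show "(\<Union>i. F i) \<subseteq> carrier G" using F subgroup.subset by blast
  show "(\<Union>i. F i) \<noteq> {}" using subgroup.one_closed[OF F] by blast
  show "inv x \<in> (\<Union>i. F i)" if "x \<in> (\<Union>i. F i)" for x
    using that subgroup.m_inv_closed[OF F] by blast
  show "x \<otimes> y \<in> (\<Union>i. F i)" if xy: "x \<in> (\<Union>i. F i)" "y \<in> (\<Union>i. F i)" for x y
  proof -
    obtain i j where "x \<in> F i" "y \<in> F j" using xy by blast
    hence "x \<in> F (max i j)" "y \<in> F (max i j)" using mono[of i "max i j"] mono[of j "max i j"] by auto
    thus ?thesis using subgroup.m_closed[OF F] by blast
  qed
qed

text \<open>
  The setting of the interpolation: \<open>Q\<close> is an ascending chain of subgroups, each of which exceeds \<open>f\<close> at some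
  subgroup that contains a member of a family \<open>N\<close> of normal subgroups with \<open>p\<close>-groups as quotients.
\<close>

locale growth_data = group G for G (structure) +
  fixes p :: nat and f :: "nat \<Rightarrow> nat" and n0 :: nat and N :: "nat \<Rightarrow> 'a set" and Q :: "nat \<Rightarrow> 'a set"
  assumes prime_p: "Factorial_Ring.prime p"
    and finite_bounded: "\<And>n. finite (bounded_index G n)"
    and N_normal: "\<And>i. N i \<lhd> G" and N_index: "\<And>i. \<exists>e. card (rcosets (N i)) = p ^ e"
    and Q_subgroup: "\<And>k. subgroup (Q k) G" and Q_mono: "\<And>k l. k \<le> l \<Longrightarrow> Q k \<subseteq> Q l"
    and Q_large: "\<And>k. \<exists>n\<ge>n0. \<exists>U\<in>bounded_index G (p ^ n). (\<exists>i. N i \<subseteq> U) \<and>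
      f n < card (double_cosets G U (Q k))"
begin

definition slow :: "'a set \<Rightarrow> bool" where
  "slow H \<longleftrightarrow> (\<forall>n\<ge>n0. \<forall>U\<in>bounded_index G (p ^ n). card (double_cosets G U H) \<le> f n)"

lemma p_pos: "p > 0" using prime_p prime_gt_0_nat by blast

lemma bounded_indexD:
  assumes "U \<in> bounded_index G n"
  shows "subgroup U G" "finite (rcosets U)"
  using assms by (auto simp: bounded_index_def)

lemma bounded_index_power_mono:
  assumes "U \<in> bounded_index G (p ^ m)" "m \<le> n"
  shows "U \<in> bounded_index G (p ^ n)"
  using assms bounded_index_mono[of "p ^ m" "p ^ n" G] p_pos by (auto simp: power_increasing)

lemma double_cosets_index_core:
  assumes "U \<in> bounded_index G (p ^ n)" "subgroup H G" "subgroup H' G" "H' \<subseteq> H"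
    and "\<And>h. h \<in> H \<Longrightarrow> \<exists>c\<in>index_core G (p ^ n). \<exists>h'\<in>H'. h = c \<otimes> h'"
  shows "double_cosets G U H = double_cosets G U H'"
  by (rule double_cosets_cong[OF bounded_indexD(1)[OF assms(1)] assms(2-4) index_core_normal
      index_core_subset[OF assms(1)] assms(5)])

text \<open>
  \<open>H\<close> has a finite image modulo the core, and finitely many representatives in an ascending union lie in one
  of its members.
\<close>

lemma cover_by_union_stage:
  assumes H: "subgroup H G" "H \<subseteq> (\<Union>k. Q k)"
  obtains k where "j \<le> k"
    "\<And>h. h \<in> H \<Longrightarrow> \<exists>c\<in>index_core G n. \<exists>h'\<in>H \<inter> Q k. h = c \<otimes> h'"
proof -
  let ?C = "index_core G n"
  have C: "subgroup ?C G" using index_core_normal normal_imp_subgroup by blast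
  have "cosets_meeting G ?C H \<subseteq> rcosets ?C"
    using subgroup.subset[OF H(1)] by (auto simp: rcosets_eq_cosets_meeting cosets_meeting_def)
  hence "finite (cosets_meeting G ?C H)"
    using finite_index_core[OF finite_bounded] finite_subset by blast
  then obtain T where T: "T \<subseteq> H" "finite T" "\<And>x. x \<in> H \<Longrightarrow> \<exists>t\<in>T. x \<otimes> inv t \<in> ?C"
    using transversal_exists[OF C subgroup.subset[OF H(1)]] by metis
  have "\<exists>k. j \<le> k \<and> T \<subseteq> Q k" using T(2,1)
  proof (induction T rule: finite_induct)
    case (insert t T)
    then obtain k where k: "j \<le> k" "T \<subseteq> Q k" by blast
    obtain l where "t \<in> Q l" using insert.prems H(2) by blast
    hence "insert t T \<subseteq> Q (max k l)" using k Q_mono[of k "max k l"] Q_mono[of l "max k l"] by auto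
    thus ?case using k(1) by (intro exI[of _ "max k l"]) auto
  qed auto
  then obtain k where k: "j \<le> k" "T \<subseteq> Q k" by blast
  show thesis
  proof
    fix h assume h: "h \<in> H"
    obtain t where t: "t \<in> T" "h \<otimes> inv t \<in> ?C" using T(3)[OF h] by blast
    have "h \<in> carrier G" "t \<in> carrier G" using h t T(1) subgroup.subset[OF H(1)] by auto
    hence "h = (h \<otimes> inv t) \<otimes> t" by (simp add: m_assoc)
    thus "\<exists>c\<in>?C. \<exists>h'\<in>H \<inter> Q k. h = c \<otimes> h'" using t T(1) k(2) by blast
  qed (rule k)
qed

text \<open>
  \<open>L\<close> is chosen maximal among the subgroups between \<open>N i F\<close> and \<open>N i H\<close> for which \<open>H \<inter> L\<close> is not slow. It has
  index \<open>p\<close> in some larger \<open>K\<close> between them, \<open>H \<inter> K\<close> is slow by maximality, and it is the new subgroup. The place where \<open>H \<inter> L\<close>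
  exceeds \<open>f\<close> lies beyond \<open>j\<close>, as up to \<open>j\<close> it has the same double cosets as the slow subgroup \<open>H\<close>.
\<close>

lemma slow_step:
  assumes H: "subgroup H G" "H \<subseteq> (\<Union>k. Q k)" "slow H"
  obtains H' k m where "subgroup H' G" "H' \<subseteq> H" "slow H'" "j \<le> k" "H \<inter> Q k \<subseteq> H'"
    "\<And>h. h \<in> H \<Longrightarrow> \<exists>c\<in>index_core G (p ^ j). \<exists>h'\<in>H \<inter> Q k. h = c \<otimes> h'"
    "j < m" "\<exists>U\<in>bounded_index G (p ^ m). f m < p * card (double_cosets G U H')"
proof -
  obtain k where k: "j \<le> k"
    "\<And>h. h \<in> H \<Longrightarrow> \<exists>c\<in>index_core G (p ^ j). \<exists>h'\<in>H \<inter> Q k. h = c \<otimes> h'"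
    using cover_by_union_stage[OF H(1,2), of j "p ^ j"] by blast
  define F where "F = H \<inter> Q k"
  have F: "subgroup F G" unfolding F_def by (rule subgroups_Inter_pair[OF H(1) Q_subgroup])
  have FH: "F \<subseteq> H" by (simp add: F_def)
  obtain n U i where U: "n \<ge> n0" "U \<in> bounded_index G (p ^ n)" "N i \<subseteq> U"
    "f n < card (double_cosets G U (Q k))"
    using Q_large[of k] by blast
  obtain e where e: "card (rcosets (N i)) = p ^ e" using N_index by blast
  have fin: "finite (rcosets (N i))" using e p_pos by (intro card_ge_0_finite) simp
  have Ni: "subgroup (N i) G" using N_normal normal_imp_subgroup by blast
  have oneN: "\<one> \<in> N i" using subgroup.one_closed[OF Ni] .
  let ?F = "N i <#> F" and ?H = "N i <#> H"
  have subF: "subgroup ?F G" and subH: "subgroup ?H G"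
    using mult_norm_subgroup[OF N_normal] F H(1) by auto
  have inN: "N i \<subseteq> N i <#> K" and inK: "K \<subseteq> N i <#> K" if K: "subgroup K G" for K
  proof -
    show "N i \<subseteq> N i <#> K"
    proof
      fix x assume x: "x \<in> N i"
      hence "x = x \<otimes> \<one>" using subgroup.mem_carrier[OF Ni] by simp
      thus "x \<in> N i <#> K" using x subgroup.one_closed[OF K] unfolding set_mult_def by blast
    qed
    show "K \<subseteq> N i <#> K"
    proof
      fix x assume x: "x \<in> K"
      hence "x = \<one> \<otimes> x" using subgroup.mem_carrier[OF K] by simp
      thus "x \<in> N i <#> K" using x oneN unfolding set_mult_def by blast
    qed
  qed
  \<comment> \<open>The chain from \<open>F\<close> to \<open>H\<close> is not written down; a maximal non-slow member is enough.\<close>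
  define S where "S = {L. subgroup L G \<and> ?F \<subseteq> L \<and> L \<subseteq> ?H \<and> \<not> slow (H \<inter> L)}"
  have "S \<subseteq> {L. subgroup L G \<and> N i \<subseteq> L}" unfolding S_def using inN[OF F] by blast
  hence finS: "finite S" using finite_subgroups_above[OF Ni fin] finite_subset by blast
  have "?F \<in> S"
  proof -
    have sub: "subgroup (H \<inter> ?F) G" by (rule subgroups_Inter_pair[OF H(1) subF])
    have "double_cosets G U (H \<inter> ?F) = double_cosets G U F"
    proof (rule double_cosets_cong[OF bounded_indexD(1)[OF U(2)] sub F _ N_normal U(3)])
      show "F \<subseteq> H \<inter> ?F" using FH inK[OF F] by blast
      show "\<exists>n\<in>N i. \<exists>h'\<in>F. h = n \<otimes> h'" if "h \<in> H \<inter> ?F" for h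
        using that unfolding set_mult_def by blast
    qed
    moreover have "card (double_cosets G U (Q k)) \<le> card (double_cosets G U F)"
      using bounded_indexD[OF U(2)] Q_subgroup F card_double_cosets_le_index(1)
      by (intro double_cosets_mono(2)) (auto simp: F_def)
    ultimately have "f n < card (double_cosets G U (H \<inter> ?F))" using U(4) by simp
    hence "\<not> slow (H \<inter> ?F)" unfolding slow_def using U(1,2) by (meson not_le)
    moreover have "?F \<subseteq> ?H" using FH by (rule mono_set_mult[OF subset_refl])
    ultimately show ?thesis using subF by (simp add: S_def)
  qed
  then obtain L where L: "L \<in> S" "\<And>K. K \<in> S \<Longrightarrow> L \<subseteq> K \<Longrightarrow> K = L"
    using finite_has_maximal2[OF finS] by metis
  have LG: "subgroup L G" "?F \<subseteq> L" "L \<subseteq> ?H" "\<not> slow (H \<inter> L)" using L(1) by (auto simp: S_def)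
  have "L \<noteq> ?H"
  proof
    assume "L = ?H"
    hence "H \<inter> L = H" using inK[OF H(1)] by blast
    thus False using LG(4) H(3) by simp
  qed
  hence "L \<subset> ?H" using LG(3) by blast
  moreover have "N i \<subseteq> L" using inN[OF F] LG(2) by blast
  ultimately obtain K where K: "subgroup K G" "L \<subset> K" "K \<subseteq> ?H"
    "finite (cosets_meeting G L K)" "card (cosets_meeting G L K) \<le> p"
    using index_p_extension[OF prime_p N_normal e LG(1) _ subH] by blast
  have HL: "subgroup (H \<inter> L) G" and HK: "subgroup (H \<inter> K) G"
    using subgroups_Inter_pair[OF H(1)] LG(1) K(1) by auto
  have slowK: "slow (H \<inter> K)"
  proof (rule ccontr)
    assume "\<not> slow (H \<inter> K)"
    hence "K \<in> S" using K LG(2) by (auto simp: S_def)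
    thus False using L(2) K(2) by blast
  qed
  have idx: "finite (cosets_meeting G (H \<inter> L) (H \<inter> K))" "card (cosets_meeting G (H \<inter> L) (H \<inter> K)) \<le> p"
  proof -
    have sub: "H \<inter> K \<subseteq> carrier G" using subgroup.subset[OF HK] .
    have im: "(\<lambda>x. L #> x) ` (H \<inter> K) \<subseteq> cosets_meeting G L K" by (auto simp: cosets_meeting_def)
    have eq: "x \<otimes> inv y \<in> H \<inter> L" if "x \<in> H \<inter> K" "y \<in> H \<inter> K" "L #> x = L #> y" for x y
    proof -
      have "x \<in> carrier G" "y \<in> carrier G" using that sub by auto
      hence "x \<otimes> inv y \<in> L" using rcos_eq_iff[OF LG(1)] that(3) by simp
      thus ?thesis using that subgroup.m_closed[OF H(1)] subgroup.m_inv_closed[OF H(1)] by simp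
    qed
    show "finite (cosets_meeting G (H \<inter> L) (H \<inter> K))"
      by (rule card_cosets_meeting_le(1)[OF HL sub K(4) im eq])
    have "card (cosets_meeting G (H \<inter> L) (H \<inter> K)) \<le> card (cosets_meeting G L K)"
      by (rule card_cosets_meeting_le(2)[OF HL sub K(4) im eq])
    thus "card (cosets_meeting G (H \<inter> L) (H \<inter> K)) \<le> p" using K(5) by simp
  qed
  obtain m V where V: "m \<ge> n0" "V \<in> bounded_index G (p ^ m)" "f m < card (double_cosets G V (H \<inter> L))"
    using LG(4) unfolding slow_def by (meson not_le)
  have "card (double_cosets G V (H \<inter> L)) \<le> card (cosets_meeting G (H \<inter> L) (H \<inter> K)) * card (double_cosets G V (H \<inter> K))"
    using bounded_indexD[OF V(2)] HK HL idx(1) card_double_cosets_le_index(1)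
    by (intro card_double_cosets_refine) auto
  also have "\<dots> \<le> p * card (double_cosets G V (H \<inter> K))" using idx(2) by simp
  finally have "f m < p * card (double_cosets G V (H \<inter> K))" using V(3) by simp
  moreover have "j < m"
  proof (rule ccontr)
    assume "\<not> j < m"
    hence Vj: "V \<in> bounded_index G (p ^ j)" using V(2) bounded_index_power_mono by simp
    have "F \<subseteq> L" using inK[OF F] LG(2) by blast
    hence "double_cosets G V H = double_cosets G V (H \<inter> L)"
      using k(2) FH unfolding F_def by (intro double_cosets_index_core[OF Vj H(1) HL]) blast+
    thus False using H(3) V unfolding slow_def by (metis not_le)
  qed
  moreover have "H \<inter> Q k \<subseteq> H \<inter> K" using inK[OF F] LG(2) K(2) unfolding F_def by blast
  ultimately show thesis using that[of "H \<inter> K" k m] HK slowK k V(2) by blast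
qed

text \<open>
  The bound \<open>j i\<close> attached to \<open>H i\<close> is kept above all the indices used before, so that everything achieved
  so far is decided modulo the \<open>i\<close>-th core. The limit is the union of the \<open>F i\<close> and not the intersection of the
  \<open>H i\<close>: the intersection might have a smaller image in some finite quotient.
\<close>

theorem prescribed_growth:
  assumes "slow (\<Union>k. Q k)"
  shows "\<exists>H. subgroup H G \<and> slow H \<and>
    (\<forall>m. \<exists>n>m. \<exists>U\<in>bounded_index G (p ^ n). f n \<le> p * card (double_cosets G U H))"
proof -
  define good where "good = (\<lambda>(H, j :: nat). subgroup H G \<and> H \<subseteq> (\<Union>k. Q k) \<and> slow H)"
  define step where "step = (\<lambda>(H, j) (H', j'). \<exists>k m. H' \<subseteq> H \<and> j \<le> k \<and> k \<le> j' \<and> H \<inter> Q k \<subseteq> H' \<and>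
    (\<forall>h\<in>H. \<exists>c\<in>index_core G (p ^ j). \<exists>h'\<in>H \<inter> Q k. h = c \<otimes> h') \<and> j < m \<and> m \<le> j' \<and>
    (\<exists>U\<in>bounded_index G (p ^ m). f m < p * card (double_cosets G U H')))"
  have "\<exists>s. \<forall>i. good (s i) \<and> step (s i) (s (Suc i))"
  proof (rule dependent_nat_choice)
    have "subgroup (\<Union>k. Q k) G" by (rule subgroup_chain_Union[OF Q_subgroup Q_mono])
    hence "good (\<Union>k. Q k, 0)" using assms by (simp add: good_def)
    thus "\<exists>s. good s" by blast
  next
    fix s i assume "good s"
    obtain H j where s: "s = (H, j)" by (cases s)
    hence H: "subgroup H G" "H \<subseteq> (\<Union>k. Q k)" "slow H" using \<open>good s\<close> by (auto simp: good_def)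
    obtain H' k m where st: "subgroup H' G" "H' \<subseteq> H" "slow H'" "j \<le> k" "H \<inter> Q k \<subseteq> H'"
      "\<And>h. h \<in> H \<Longrightarrow> \<exists>c\<in>index_core G (p ^ j). \<exists>h'\<in>H \<inter> Q k. h = c \<otimes> h'"
      "j < m" "\<exists>U\<in>bounded_index G (p ^ m). f m < p * card (double_cosets G U H')"
      by (rule slow_step[OF H, of j]) (rule that; blast)
    have "good (H', max k m)" using st H(2) by (auto simp: good_def)
    moreover have "step s (H', max k m)"
      unfolding s step_def prod.case using st by (intro exI[of _ k] exI[of _ m]) auto
    ultimately show "\<exists>t. good t \<and> step s t" by blast
  qed
  then obtain s where s: "\<And>i. good (s i)" "\<And>i. step (s i) (s (Suc i))" by blast
  define H where "H i = fst (s i)" for i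
  define j where "j i = snd (s i)" for i
  have H: "subgroup (H i) G" "slow (H i)" for i
    using s(1)[of i] by (auto simp: good_def H_def split: prod.splits)
  have "\<forall>i. \<exists>k m. H (Suc i) \<subseteq> H i \<and> j i \<le> k \<and> k \<le> j (Suc i) \<and> H i \<inter> Q k \<subseteq> H (Suc i) \<and>
    (\<forall>h\<in>H i. \<exists>c\<in>index_core G (p ^ j i). \<exists>h'\<in>H i \<inter> Q k. h = c \<otimes> h') \<and> j i < m \<and> m \<le> j (Suc i) \<and>
    (\<exists>U\<in>bounded_index G (p ^ m). f m < p * card (double_cosets G U (H (Suc i))))"
    using s(2) unfolding step_def H_def j_def by (simp add: case_prod_beta)
  then obtain k m where st: "\<And>i. H (Suc i) \<subseteq> H i" "\<And>i. j i \<le> k i" "\<And>i. k i \<le> j (Suc i)"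
    "\<And>i. H i \<inter> Q (k i) \<subseteq> H (Suc i)"
    "\<And>i h. h \<in> H i \<Longrightarrow> \<exists>c\<in>index_core G (p ^ j i). \<exists>h'\<in>H i \<inter> Q (k i). h = c \<otimes> h'"
    "\<And>i. j i < m i" "\<And>i. m i \<le> j (Suc i)"
    "\<And>i. \<exists>U\<in>bounded_index G (p ^ m i). f (m i) < p * card (double_cosets G U (H (Suc i)))"
    by metis
  \<comment> \<open>Hence every subgroup of finite index is eventually controlled by some core.\<close>
  have j_ge: "i \<le> j i" for i
  proof (induction i)
    case (Suc i)
    thus ?case using st(6,7)[of i] by linarith
  qed simp
  define F where "F i = H i \<inter> Q (k i)" for i
  have F: "subgroup (F i) G" for i unfolding F_def by (rule subgroups_Inter_pair[OF H(1) Q_subgroup])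
  have "F i \<subseteq> F (Suc i)" for i
    using st(4)[of i] Q_mono[OF order_trans[OF st(3)[of i] st(2)[of "Suc i"]]] unfolding F_def by blast
  hence F_mono: "F a \<subseteq> F b" if "a \<le> b" for a b using that by (rule lift_Suc_mono_le)
  have H_anti: "H b \<subseteq> H a" if "a \<le> b" for a b using st(1) that by (rule lift_Suc_antimono_le)
  define E where "E = (\<Union>i. F i)"
  have E: "subgroup E G" unfolding E_def by (rule subgroup_chain_Union[OF F F_mono])
  have EH: "E \<subseteq> H i" for i
  proof -
    have "F a \<subseteq> H i" for a
      using F_mono[of a i] H_anti[of i a] unfolding F_def by (cases "a \<le> i") auto
    thus ?thesis by (auto simp: E_def)
  qed
  have same: "double_cosets G U (H i) = double_cosets G U E" if "U \<in> bounded_index G (p ^ j i)" for U i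
  proof (rule double_cosets_index_core[OF that H(1) E EH])
    fix h assume "h \<in> H i"
    thus "\<exists>c\<in>index_core G (p ^ j i). \<exists>h'\<in>E. h = c \<otimes> h'" using st(5) by (fastforce simp: E_def F_def)
  qed
  show ?thesis
  proof (intro exI[of _ E] conjI allI)
    show "subgroup E G" by (rule E)
    show "slow E" unfolding slow_def
    proof (intro allI impI ballI)
      fix n U assume n: "n0 \<le> n" and U: "U \<in> bounded_index G (p ^ n)"
      have "U \<in> bounded_index G (p ^ j n)" using bounded_index_power_mono[OF U j_ge] .
      thus "card (double_cosets G U E) \<le> f n" using H(2)[of n] n U same unfolding slow_def by metis
    qed
    fix i
    obtain U where U: "U \<in> bounded_index G (p ^ m i)" "f (m i) < p * card (double_cosets G U (H (Suc i)))"
      using st(8) by blast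
    have "U \<in> bounded_index G (p ^ j (Suc i))" using bounded_index_power_mono[OF U(1) st(7)] .
    hence "f (m i) \<le> p * card (double_cosets G U E)" using U(2) same by simp
    moreover have "i < m i" using j_ge[of i] st(6)[of i] by simp
    ultimately show "\<exists>n>i. \<exists>U\<in>bounded_index G (p ^ n). f n \<le> p * card (double_cosets G U E)"
      using U(1) by blast
  qed
qed

end

section \<open>Groups of tree automorphisms\<close>

text \<open>
  The section of \<open>g\<close> at \<open>v\<close>: how \<open>g\<close> maps the subtree below \<open>v\<close> to the subtree below \<open>g v\<close>, both of them identified with
  the whole tree.
\<close>

definition sec :: "nat \<Rightarrow> (nat list \<Rightarrow> nat list) \<Rightarrow> nat list \<Rightarrow> nat list \<Rightarrow> nat list" where
  "sec p g v = (\<lambda>w\<in>tree p. drop (length v) (g (v @ w)))"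

text \<open>
  The automorphism that acts as \<open>x\<close> below \<open>v\<close> and fixes everything else.
\<close>

definition graft :: "nat \<Rightarrow> nat list \<Rightarrow> (nat list \<Rightarrow> nat list) \<Rightarrow> nat list \<Rightarrow> nat list" where
  "graft p v x = (\<lambda>w\<in>tree p. if take (length v) w = v then v @ x (drop (length v) w) else w)"

definition level :: "nat \<Rightarrow> nat \<Rightarrow> nat list set" where
  "level p n = {w \<in> tree p. length w = n}"

lemma card_level: "finite (level p n)" "card (level p n) = p ^ n"
proof -
  have "level p n = {w. set w \<subseteq> {..<p} \<and> length w = n}" by (auto simp: level_def tree_def)
  thus "finite (level p n)" "card (level p n) = p ^ n"
    using finite_lists_length_eq[of "{..<p}" n] card_lists_length_eq[of "{..<p}" n] by auto
qed

lemma tree_take: "w \<in> tree p \<Longrightarrow> take n w \<in> tree p"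
  and tree_drop: "w \<in> tree p \<Longrightarrow> drop n w \<in> tree p"
  by (auto simp: tree_def in_set_takeD in_set_dropD dest: in_set_takeD in_set_dropD)

lemma replicate_in_tree [simp]: "p > 0 \<Longrightarrow> replicate k 0 \<in> tree p"
  by (auto simp: tree_def)

text \<open>
  Groups of tree automorphisms that permute the children of every vertex by a power of the cyclic rotation. The
  multiplication is described through the action on the tree. The last axiom implies that levels and prefixes
  are preserved.
\<close>

locale rotation_tree_group = group G for G :: "(nat list \<Rightarrow> nat list) monoid" (structure) +
  fixes p :: nat
  assumes prime_p: "Factorial_Ring.prime p"
    and extensional: "g \<in> carrier G \<Longrightarrow> g \<in> extensional (tree p)"
    and mult_apply: "g \<in> carrier G \<Longrightarrow> h \<in> carrier G \<Longrightarrow> w \<in> tree p \<Longrightarrow> (g \<otimes> h) w = g (h w)"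
    and one_apply: "w \<in> tree p \<Longrightarrow> \<one> w = w"
    and Nil_apply: "g \<in> carrier G \<Longrightarrow> g [] = []"
    and rotates: "g \<in> carrier G \<Longrightarrow> w \<in> tree p \<Longrightarrow> \<exists>r. \<forall>x<p. g (w @ [x]) = g w @ [(x + r) mod p]"
begin

lemma p_gt_1: "p > 1" using prime_p prime_gt_1_nat by blast

lemma apply_level:
  assumes "g \<in> carrier G" "w \<in> tree p"
  shows "g w \<in> tree p \<and> length (g w) = length w"
  using assms(2)
proof (induction w rule: rev_induct)
  case Nil
  thus ?case using Nil_apply[OF assms(1)] by simp
next
  case (snoc x w)
  hence w: "w \<in> tree p" "x < p" by auto
  obtain r where "\<forall>x<p. g (w @ [x]) = g w @ [(x + r) mod p]" using rotates[OF assms(1) w(1)] by blast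
  thus ?case using snoc.IH[OF w(1)] w(2) p_gt_1 by simp
qed

lemmas apply_in_tree = apply_level[THEN conjunct1]
  and length_apply = apply_level[THEN conjunct2]

lemma apply_append:
  assumes "g \<in> carrier G" "v \<in> tree p" "w \<in> tree p"
  shows "\<exists>u. g (v @ w) = g v @ u"
  using assms(3)
proof (induction w rule: rev_induct)
  case (snoc x w)
  hence w: "v @ w \<in> tree p" "x < p" using assms(2) by auto
  obtain r where "\<forall>x<p. g ((v @ w) @ [x]) = g (v @ w) @ [(x + r) mod p]"
    using rotates[OF assms(1) w(1)] by blast
  thus ?case using snoc w(2) by auto
qed simp

lemma apply_append_sec:
  assumes "g \<in> carrier G" "v \<in> tree p" "w \<in> tree p"
  shows "g (v @ w) = g v @ sec p g v w"
proof -
  obtain u where "g (v @ w) = g v @ u" using apply_append[OF assms] by blast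
  thus ?thesis using assms length_apply[OF assms(1,2)] by (simp add: sec_def)
qed

lemma group_elem_eqI:
  assumes "g \<in> carrier G" "h \<in> carrier G" "\<And>w. w \<in> tree p \<Longrightarrow> g w = h w"
  shows "g = h"
  using extensionalityI[OF extensional[OF assms(1)] extensional[OF assms(2)]] assms(3) by blast

lemma inv_apply:
  assumes "g \<in> carrier G" "w \<in> tree p"
  shows "(inv g) (g w) = w" "g ((inv g) w) = w"
  using mult_apply[of "inv g" g w] mult_apply[of g "inv g" w] assms one_apply by auto

lemma apply_inj:
  assumes "g \<in> carrier G" "v \<in> tree p" "w \<in> tree p" "g v = g w"
  shows "v = w"
proof -
  have "v = (inv g) (g v)" by (rule inv_apply(1)[OF assms(1,2), symmetric])
  also have "\<dots> = w" unfolding assms(4) by (rule inv_apply(1)[OF assms(1,3)])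
  finally show ?thesis .
qed

lemma inv_apply_in_level:
  assumes "g \<in> carrier G" "w \<in> level p n"
  shows "(inv g) w \<in> level p n" "g w \<in> level p n"
  using assms apply_level[of "inv g" w] apply_level[of g w] by (auto simp: level_def)

subsection \<open>Level stabilisers\<close>

definition level_stab :: "nat \<Rightarrow> (nat list \<Rightarrow> nat list) set" where
  "level_stab n = {g \<in> carrier G. \<forall>w\<in>level p n. g w = w}"

lemma level_stab_normal: "level_stab n \<lhd> G"
proof (rule normal_invI)
  have lev: "w \<in> tree p" if "w \<in> level p n" for w using that by (simp add: level_def)
  show "subgroup (level_stab n) G"
  proof (rule subgroupI)
    show "level_stab n \<subseteq> carrier G" by (auto simp: level_stab_def)
    have "\<one> \<in> level_stab n" using one_apply lev by (auto simp: level_stab_def)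
    thus "level_stab n \<noteq> {}" by blast
  next
    fix g assume g: "g \<in> level_stab n"
    hence gG: "g \<in> carrier G" by (simp add: level_stab_def)
    have "(inv g) w = w" if "w \<in> level p n" for w
    proof -
      have "g w = w" using g that by (simp add: level_stab_def)
      thus ?thesis using inv_apply(1)[OF gG lev[OF that]] by simp
    qed
    thus "inv g \<in> level_stab n" using gG by (simp add: level_stab_def)
  next
    fix g h assume "g \<in> level_stab n" "h \<in> level_stab n"
    thus "g \<otimes> h \<in> level_stab n" using mult_apply lev by (simp add: level_stab_def)
  qed
  fix g h assume g: "g \<in> carrier G" and h: "h \<in> level_stab n"
  hence hG: "h \<in> carrier G" by (simp add: level_stab_def)
  have "(g \<otimes> h \<otimes> inv g) w = w" if w: "w \<in> level p n" for w
  proof -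
    have i: "(inv g) w \<in> level p n" using inv_apply_in_level(1)[OF g w] .
    have "(g \<otimes> h \<otimes> inv g) w = g (h ((inv g) w))"
      using mult_apply g hG lev[OF w] lev[OF i] by simp
    also have "\<dots> = w" using h i inv_apply(2)[OF g lev[OF w]] by (simp add: level_stab_def)
    finally show ?thesis .
  qed
  thus "g \<otimes> h \<otimes> inv g \<in> level_stab n" using g hG by (simp add: level_stab_def)
qed

text \<open>
  Below a fixed vertex \<open>w\<close> of level \<open>n\<close>, the children are rotated by some \<open>r\<close>, and the \<open>p\<close>-th power rotates them by \<open>p r\<close>.
\<close>

lemma level_stab_Suc:
  assumes h: "h \<in> level_stab n"
  shows "h [^] p \<in> level_stab (Suc n)"
proof -
  have hG: "h \<in> carrier G" using h by (simp add: level_stab_def)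
  have "(h [^] p) u = u" if u: "u \<in> level p (Suc n)" for u
  proof -
    define w where "w = butlast u"
    define x where "x = last u"
    have "u \<noteq> []" using u by (auto simp: level_def)
    hence ux: "u = w @ [x]" by (simp add: w_def x_def)
    have w: "w \<in> tree p" "x < p" "h w = w" using u ux h by (auto simp: level_def level_stab_def)
    obtain r where r: "\<forall>x<p. h (w @ [x]) = h w @ [(x + r) mod p]" using rotates[OF hG w(1)] by blast
    have "(h [^] j) u = w @ [(x + j * r) mod p]" for j :: nat
    proof (induction j)
      case 0
      show ?case using one_apply[of u] u w(2) by (simp add: ux level_def)
    next
      case (Suc j)
      have "(h [^] Suc j) u = h ((h [^] j) u)"
        unfolding nat_pow_Suc2[OF hG] using mult_apply[OF hG] hG u by (simp add: level_def)
      also have "\<dots> = w @ [((x + j * r) mod p + r) mod p]" using Suc.IH r w(3) p_gt_1 by simp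
      also have "\<dots> = w @ [(x + Suc j * r) mod p]" by (simp add: mod_simps algebra_simps)
      finally show ?case .
    qed
    from this[of p] show ?thesis using w(2) ux by simp
  qed
  thus ?thesis using hG by (simp add: level_stab_def)
qed

lemma power_in_level_stab: "g \<in> carrier G \<Longrightarrow> g [^] (p ^ n) \<in> level_stab n"
proof (induction n)
  case 0
  have "w = []" if "w \<in> level p 0" for w using that by (simp add: level_def)
  thus ?case using 0 Nil_apply by (auto simp: level_stab_def)
next
  case (Suc n)
  have "g [^] (p ^ Suc n) = (g [^] (p ^ n)) [^] p" using Suc.prems by (simp add: nat_pow_pow mult.commute)
  thus ?case using level_stab_Suc[OF Suc.IH[OF Suc.prems]] by simp
qed

text \<open>
  The quotient has exponent \<open>p ^ n\<close> because each level costs one \<open>p\<close>-th power.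
\<close>

lemma level_stab_index: "\<exists>e. card (rcosets (level_stab n)) = p ^ e"
proof -
  let ?N = "level_stab n"
  interpret N: normal ?N G by (rule level_stab_normal)
  interpret Q: group "G Mod ?N" by (rule N.factorgroup_is_group)
  have carr: "carrier (G Mod ?N) = rcosets ?N" by (simp add: FactGroup_def)
  have "finite (rcosets ?N)" unfolding rcosets_eq_cosets_meeting
  proof (rule card_cosets_meeting_le(1)[OF N.subgroup_axioms subset_refl])
    show "finite (level p n \<rightarrow>\<^sub>E level p n)" using card_level by (intro finite_PiE) auto
    show "(\<lambda>g. restrict g (level p n)) ` carrier G \<subseteq> level p n \<rightarrow>\<^sub>E level p n"
      using inv_apply_in_level(2) by auto
    fix x y assume xy: "x \<in> carrier G" "y \<in> carrier G" "restrict x (level p n) = restrict y (level p n)"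
    have "(x \<otimes> inv y) w = w" if w: "w \<in> level p n" for w
    proof -
      have i: "(inv y) w \<in> level p n" using inv_apply_in_level(1)[OF xy(2) w] .
      have "x ((inv y) w) = y ((inv y) w)" using fun_cong[OF xy(3), of "(inv y) w"] i by simp
      also have "\<dots> = w" using inv_apply(2)[OF xy(2)] w by (simp add: level_def)
      finally have "x ((inv y) w) = w" .
      thus ?thesis using mult_apply[of x "inv y" w] xy(1,2) w by (simp add: level_def)
    qed
    moreover have "x \<otimes> inv y \<in> carrier G" by (rule m_closed[OF xy(1) inv_closed[OF xy(2)]])
    ultimately show "x \<otimes> inv y \<in> ?N" unfolding level_stab_def by blast
  qed
  moreover have "\<exists>i. c [^]\<^bsub>G Mod ?N\<^esub> (p ^ i :: nat) = \<one>\<^bsub>G Mod ?N\<^esub>" if c: "c \<in> carrier (G Mod ?N)" for c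
  proof -
    obtain g where g: "g \<in> carrier G" "c = ?N #> g" using c by (auto simp: carr RCOSETS_def)
    have "c [^]\<^bsub>G Mod ?N\<^esub> (p ^ n :: nat) = ?N #> (g [^] (p ^ n))" using N.FactGroup_pow[OF g(1)] g(2) by simp
    also have "\<dots> = ?N" using coset_join2[OF _ N.subgroup_axioms power_in_level_stab[OF g(1)]] g(1) by simp
    finally show ?thesis by auto
  qed
  ultimately show ?thesis using Q.order_prime_power[OF prime_p] by (simp add: order_def carr)
qed

subsection \<open>Vertex stabilisers and the stabilisers of germs\<close>

definition vertex_stab :: "nat list \<Rightarrow> (nat list \<Rightarrow> nat list) set" where
  "vertex_stab v = {g \<in> carrier G. g v = v}"

text \<open>
  These are the \<open>Q k\<close> of the introduction. Their union consists of the elements with trivial germ at the ray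
  \<open>000...\<close>.
\<close>

definition cone_fix :: "nat \<Rightarrow> (nat list \<Rightarrow> nat list) set" where
  "cone_fix k = {g \<in> carrier G. \<forall>w\<in>tree p. g (replicate k 0 @ w) = replicate k 0 @ w}"

lemma pointwise_stab_subgroup:
  assumes "A \<subseteq> tree p"
  shows "subgroup {g \<in> carrier G. \<forall>w\<in>A. g w = w} G"
proof (rule subgroupI)
  show "{g \<in> carrier G. \<forall>w\<in>A. g w = w} \<noteq> {}" using one_apply assms by blast
  fix g assume g: "g \<in> {g \<in> carrier G. \<forall>w\<in>A. g w = w}"
  have "(inv g) w = w" if "w \<in> A" for w
    using inv_apply(1)[of g w] g that assms by auto
  thus "inv g \<in> {g \<in> carrier G. \<forall>w\<in>A. g w = w}" using g by simp
next
  fix g h assume gh: "g \<in> {g \<in> carrier G. \<forall>w\<in>A. g w = w}" "h \<in> {g \<in> carrier G. \<forall>w\<in>A. g w = w}"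
  have "(g \<otimes> h) w = w" if "w \<in> A" for w using mult_apply[of g h w] gh that assms by auto
  thus "g \<otimes> h \<in> {g \<in> carrier G. \<forall>w\<in>A. g w = w}" using gh by simp
qed auto

lemma vertex_stab_subgroup: "v \<in> tree p \<Longrightarrow> subgroup (vertex_stab v) G"
  using pointwise_stab_subgroup[of "{v}"] by (simp add: vertex_stab_def)

lemma cone_fix_subgroup: "subgroup (cone_fix k) G"
proof -
  have eq: "cone_fix k = {g \<in> carrier G. \<forall>w\<in>(\<lambda>w. replicate k 0 @ w) ` tree p. g w = w}"
    by (auto simp: cone_fix_def)
  show ?thesis unfolding eq using p_gt_1 by (intro pointwise_stab_subgroup) auto
qed

lemma cone_fix_mono: "k \<le> l \<Longrightarrow> cone_fix k \<subseteq> cone_fix l"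
proof
  fix g assume kl: "k \<le> l" and g: "g \<in> cone_fix k"
  have "g (replicate l 0 @ w) = replicate l 0 @ w" if "w \<in> tree p" for w
  proof -
    have "replicate l 0 @ w = replicate k 0 @ (replicate (l - k) 0 @ w)"
      using kl by (metis append_assoc le_add_diff_inverse replicate_add)
    moreover have "replicate (l - k) 0 @ w \<in> tree p" using that p_gt_1 by simp
    ultimately show ?thesis using g by (simp add: cone_fix_def)
  qed
  thus "g \<in> cone_fix l" using g by (simp add: cone_fix_def)
qed

lemma subgroup_cone_fix_Union: "subgroup (\<Union>k. cone_fix k) G"
  by (rule subgroup_chain_Union[OF cone_fix_subgroup cone_fix_mono])

lemma vertex_stab_bounded_index:
  assumes "v \<in> level p n"
  shows "vertex_stab v \<in> bounded_index G (p ^ n)"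
proof -
  have v: "v \<in> tree p" using assms by (simp add: level_def)
  have im: "(\<lambda>g. (inv g) v) ` carrier G \<subseteq> level p n" using inv_apply_in_level(1) assms by blast
  have eq: "x \<otimes> inv y \<in> vertex_stab v" if "x \<in> carrier G" "y \<in> carrier G" "(inv x) v = (inv y) v" for x y
  proof -
    have "(x \<otimes> inv y) v = x ((inv y) v)" using mult_apply[of x "inv y" v] that(1,2) v by simp
    also have "\<dots> = v" unfolding that(3)[symmetric] by (rule inv_apply(2)[OF that(1) v])
    finally show ?thesis using that(1,2) by (simp add: vertex_stab_def)
  qed
  have "finite (rcosets (vertex_stab v)) \<and> card (rcosets (vertex_stab v)) \<le> card (level p n)"
    unfolding rcosets_eq_cosets_meeting
    using card_cosets_meeting_le[OF vertex_stab_subgroup[OF v] subset_refl card_level(1) im eq] by blast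
  thus ?thesis using vertex_stab_subgroup[OF v] card_level(2) by (simp add: bounded_index_def)
qed

lemma level_stab_subset_vertex_stab: "v \<in> level p n \<Longrightarrow> level_stab n \<subseteq> vertex_stab v"
  by (auto simp: level_stab_def vertex_stab_def)

text \<open>
  Sending \<open>g\<close> to the vertex that it maps to \<open>v\<close> turns the double cosets into the orbits of \<open>cone_fix k\<close> on
  level \<open>n\<close>, and the vertices below \<open>0 ^ k\<close> are fixed points.
\<close>

lemma card_double_cosets_cone_fix:
  assumes trans: "\<And>u v. u \<in> level p n \<Longrightarrow> v \<in> level p n \<Longrightarrow> \<exists>g\<in>carrier G. g u = v"
    and v: "v \<in> level p n" and kn: "k \<le> n"
  shows "p ^ (n - k) \<le> card (double_cosets G (vertex_stab v) (cone_fix k))"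
proof -
  have vt: "v \<in> tree p" using v by (simp add: level_def)
  let ?o = "\<lambda>u. replicate k 0 @ u"
  have o: "?o u \<in> level p n" "?o u \<in> tree p" if "u \<in> level p (n - k)" for u
    using that kn p_gt_1 by (auto simp: level_def)
  have "\<forall>u\<in>level p (n - k). \<exists>g\<in>carrier G. g (?o u) = v" using trans v o by blast
  then obtain g where g: "\<And>u. u \<in> level p (n - k) \<Longrightarrow> g u \<in> carrier G \<and> g u (?o u) = v" by metis
  let ?D = "\<lambda>u. double_coset G (vertex_stab v) (cone_fix k) (g u)"
  have "inj_on ?D (level p (n - k))"
  proof (rule inj_onI)
    fix u u' assume u: "u \<in> level p (n - k)" "u' \<in> level p (n - k)" "?D u = ?D u'"
    have gG: "g u \<in> carrier G" "g u' \<in> carrier G" using g u by auto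
    have "g u' \<in> ?D u"
      using double_coset_self[OF vertex_stab_subgroup[OF vt] cone_fix_subgroup gG(2)] u(3) by simp
    then obtain a b where ab: "a \<in> vertex_stab v" "b \<in> cone_fix k" "g u' = a \<otimes> g u \<otimes> b"
      by (rule double_cosetE)
    have aG: "a \<in> carrier G" and bG: "b \<in> carrier G" using ab by (auto simp: vertex_stab_def cone_fix_def)
    have "b (?o u') = ?o u'" using ab(2) u(2) by (auto simp: cone_fix_def level_def)
    hence "v = a (g u (?o u'))"
      using g[OF u(2)] unfolding ab(3)
      using mult_apply[of "a \<otimes> g u" b "?o u'"] mult_apply[OF aG gG(1) o(2)[OF u(2)]] aG bG gG o(2)[OF u(2)] by simp
    hence "a v = a (g u (?o u'))" using ab(1) by (simp add: vertex_stab_def)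
    hence "v = g u (?o u')" using apply_inj[OF aG vt apply_in_tree[OF gG(1) o(2)[OF u(2)]]] by simp
    hence "g u (?o u) = g u (?o u')" using g[OF u(1)] by simp
    thus "u = u'" using apply_inj[OF gG(1) o(2)[OF u(1)] o(2)[OF u(2)]] by simp
  qed
  moreover have "?D ` level p (n - k) \<subseteq> double_cosets G (vertex_stab v) (cone_fix k)"
    using g by (auto simp: double_cosets_def)
  moreover have "finite (double_cosets G (vertex_stab v) (cone_fix k))"
    using vertex_stab_bounded_index[OF v] cone_fix_subgroup
    by (intro card_double_cosets_le_index(1)) (auto simp: bounded_index_def)
  ultimately have "card (level p (n - k)) \<le> card (double_cosets G (vertex_stab v) (cone_fix k))"
    by (rule card_inj_on_le)
  thus ?thesis using card_level(2) by simp
qed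

end

section \<open>Regular branch groups\<close>

text \<open>
  The bound for the number of double cosets of a subgroup of index \<open>s\<close>, where \<open>c\<close> bounds the case of index \<open>1\<close> and \<open>q\<close>
  is the number of subtrees. The negative term for \<open>s > 1\<close> lets two nontrivial summands pay for the up to \<open>q\<close>
  trivial ones.
\<close>

definition log_bound :: "real \<Rightarrow> real \<Rightarrow> nat \<Rightarrow> real" where
  "log_bound q c s = (if s = 1 then c else 2 * q * c * log 2 s - q * c)"

text \<open>
  The logarithmic terms add up to \<open>2 q c\<close> times the logarithm of the product. The constants \<open>c\<close> contribute at most \<open>q c\<close>, each nontrivial one saves \<open>q c\<close>, and halving the product saves \<open>2 q c\<close>; so one halving, or two
  nontrivial summands, suffice to keep the constant at \<open>- q c\<close>.
\<close>

lemma sum_log_bound_le: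
  fixes s :: "'v \<Rightarrow> nat" and c :: real
  assumes V: "finite V" "V \<noteq> {}" and s: "\<And>v. v \<in> V \<Longrightarrow> 1 \<le> s v" and c: "c \<ge> 0" and N: "2 \<le> N"
    and "2 * (\<Prod>v\<in>V. s v) \<le> N \<or> (\<Prod>v\<in>V. s v) \<le> N \<and> card {v \<in> V. s v \<noteq> 1} \<noteq> 1"
  shows "(\<Sum>v\<in>V. log_bound (card V) c (s v)) \<le> log_bound (card V) c N"
proof -
  define q where "q = real (card V)"
  define J where "J = {v \<in> V. s v \<noteq> 1}"
  have q: "q \<ge> 1" using V unfolding q_def by (simp add: Suc_leI card_gt_0_iff)
  have qc: "q * c \<ge> 0" using q c by simp
  have JV: "J \<subseteq> V" "finite J" using V by (auto simp: J_def)
  have logprod: "log 2 (\<Prod>v\<in>V. s v) = (\<Sum>v\<in>V. log 2 (s v))"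
  proof -
    have "ln (\<Prod>v\<in>V. real (s v)) = (\<Sum>v\<in>V. ln (real (s v)))"
      using s by (intro ln_prod[OF V(1)]) (auto simp: Suc_le_eq)
    thus ?thesis by (simp add: log_def sum_divide_distrib)
  qed
  have "(\<Sum>v\<in>V. log_bound q c (s v)) \<le> (\<Sum>v\<in>V. 2 * q * c * log 2 (s v) + c - (if v \<in> J then q * c else 0))"
    by (rule sum_mono) (use c in \<open>auto simp: log_bound_def J_def\<close>)
  also have "\<dots> = 2 * q * c * (\<Sum>v\<in>V. log 2 (s v)) + q * c - card J * (q * c)"
    using JV V by (simp add: sum.distrib sum_subtractf sum_distrib_left q_def sum.If_cases Int_absorb1)
  finally have le: "(\<Sum>v\<in>V. log_bound q c (s v)) \<le> 2 * (q * c) * log 2 (\<Prod>v\<in>V. s v) + q * c - card J * (q * c)"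
    unfolding logprod by (simp add: mult.assoc)
  have prod_pos: "0 < (\<Prod>v\<in>V. s v)" using s by (intro prod_pos) (auto simp: Suc_le_eq)
  have logN: "log 2 N \<ge> 1" using N by (simp add: le_log_iff)
  have rhs: "log_bound q c N = 2 * (q * c) * log 2 N - q * c" using N by (simp add: log_bound_def)
  have mult_mono': "2 * (q * c) * x \<le> 2 * (q * c) * y" if "x \<le> y" for x y
    using qc that by (intro mult_left_mono) auto
  consider "2 * (\<Prod>v\<in>V. s v) \<le> N" | "(\<Prod>v\<in>V. s v) \<le> N" "card J \<ge> 2" | "card J = 0"
    using assms(6) unfolding J_def[symmetric] by linarith
  thus ?thesis unfolding q_def[symmetric]
  proof cases
    case 1
    have "log 2 (\<Prod>v\<in>V. s v) + 1 = log 2 (2 * (\<Prod>v\<in>V. s v))"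
      using prod_pos by (simp add: log_mult del: of_nat_prod)
    also have "\<dots> \<le> log 2 N" using 1 prod_pos by (subst log_le_cancel_iff) (auto simp flip: of_nat_prod)
    finally have "2 * (q * c) * (log 2 (\<Prod>v\<in>V. s v) + 1) \<le> 2 * (q * c) * log 2 N" by (rule mult_mono')
    moreover have "card J * (q * c) \<ge> 0" using qc by simp
    ultimately show "(\<Sum>v\<in>V. log_bound q c (s v)) \<le> log_bound q c N"
      using le unfolding rhs by (simp add: algebra_simps)
  next
    case 2
    have "log 2 (\<Prod>v\<in>V. s v) \<le> log 2 N" using 2 prod_pos by (subst log_le_cancel_iff) (auto simp flip: of_nat_prod)
    hence "2 * (q * c) * log 2 (\<Prod>v\<in>V. s v) \<le> 2 * (q * c) * log 2 N" by (rule mult_mono')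
    moreover have "2 * (q * c) \<le> card J * (q * c)" using qc 2 by (intro mult_right_mono) auto
    ultimately show "(\<Sum>v\<in>V. log_bound q c (s v)) \<le> log_bound q c N"
      using le unfolding rhs by simp
  next
    case 3
    hence "J = {}" using JV by simp
    hence "(\<Prod>v\<in>V. s v) = 1" by (intro prod.neutral) (auto simp: J_def)
    hence "(\<Sum>v\<in>V. log_bound q c (s v)) \<le> q * c" using le 3 by simp
    moreover have "2 * (q * c) * 1 \<le> 2 * (q * c) * log 2 N" using logN by (rule mult_mono')
    ultimately show "(\<Sum>v\<in>V. log_bound q c (s v)) \<le> log_bound q c N" unfolding rhs by simp
  qed
qed

context rotation_tree_group
begin

lemma sec_mult:
  assumes "g \<in> carrier G" "h \<in> carrier G" "v \<in> tree p" "sec p g (h v) \<in> carrier G" "sec p h v \<in> carrier G"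
  shows "sec p (g \<otimes> h) v = sec p g (h v) \<otimes> sec p h v"
proof (rule extensionalityI[of _ "tree p"])
  show "sec p (g \<otimes> h) v \<in> extensional (tree p)" by (simp add: sec_def)
  show "sec p g (h v) \<otimes> sec p h v \<in> extensional (tree p)" using assms by (intro extensional) simp
  fix w assume w: "w \<in> tree p"
  have hw: "sec p h v w \<in> tree p" using apply_in_tree[OF assms(5) w] .
  have hv: "h v \<in> tree p" using apply_in_tree assms by blast
  have "(g \<otimes> h) (v @ w) = g (h (v @ w))" using mult_apply[OF assms(1,2)] assms(3) w by simp
  also have "\<dots> = g (h v @ sec p h v w)" using apply_append_sec[OF assms(2,3) w] by simp
  also have "\<dots> = g (h v) @ sec p g (h v) (sec p h v w)" by (rule apply_append_sec[OF assms(1) hv hw])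
  finally have "sec p (g \<otimes> h) v w = drop (length v) (g (h v) @ sec p g (h v) (sec p h v w))"
    using w by (simp add: sec_def)
  also have "length v = length (g (h v))" using length_apply[OF assms(1) hv] length_apply[OF assms(2,3)] by simp
  finally show "sec p (g \<otimes> h) v w = (sec p g (h v) \<otimes> sec p h v) w" using mult_apply[OF assms(4,5) w] by simp
qed

lemma sec_inv:
  assumes "g \<in> carrier G" "v \<in> tree p" "sec p g ((inv g) v) \<in> carrier G"
  shows "sec p (inv g) v = inv (sec p g ((inv g) v))"
proof (rule extensionalityI[of _ "tree p"])
  let ?u = "(inv g) v" and ?s = "sec p g ((inv g) v)"
  have u: "?u \<in> tree p" "length ?u = length v" using apply_level[of "inv g" v] assms by auto
  show "sec p (inv g) v \<in> extensional (tree p)" by (simp add: sec_def)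
  show "inv ?s \<in> extensional (tree p)" using assms(3) by (intro extensional) simp
  fix w assume w: "w \<in> tree p"
  have sw: "(inv ?s) w \<in> tree p" using apply_in_tree[of "inv ?s" w] assms(3) w by simp
  have "g (?u @ (inv ?s) w) = v @ w"
    using apply_append_sec[OF assms(1) u(1) sw] inv_apply(2)[OF assms(1,2)] inv_apply(2)[OF assms(3) w] by simp
  hence "(inv g) (v @ w) = ?u @ (inv ?s) w"
    using inv_apply(1)[OF assms(1), of "?u @ (inv ?s) w"] u(1) sw by simp
  thus "sec p (inv g) v w = (inv ?s) w" using w u(2) by (simp add: sec_def)
qed

lemma sec_one: "v \<in> tree p \<Longrightarrow> sec p \<one> v = \<one>"
  using one_apply by (intro extensionalityI[OF _ extensional]) (auto simp: sec_def)

end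

text \<open>
  Level-transitive self-similar groups that branch over a normal subgroup \<open>L\<close> of finite index: \<open>L\<close> contains its own
  copies below the vertices of level 1.
\<close>

locale regular_branch_group = rotation_tree_group +
  fixes L :: "(nat list \<Rightarrow> nat list) set"
  assumes finitely_generated: "\<exists>S. finite S \<and> S \<subseteq> carrier G \<and> carrier G = generate G S"
    and sec_closed: "g \<in> carrier G \<Longrightarrow> v \<in> tree p \<Longrightarrow> sec p g v \<in> carrier G"
    and level_transitive: "u \<in> level p n \<Longrightarrow> v \<in> level p n \<Longrightarrow> \<exists>g\<in>carrier G. g u = v"
    and L_normal: "L \<lhd> G" and L_index: "finite (rcosets L)"
    and L_nontrivial: "\<exists>x\<in>L. \<exists>w\<in>tree p. x w \<noteq> w"
    and L_branch: "x \<in> L \<Longrightarrow> i < p \<Longrightarrow> graft p [i] x \<in> L"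
begin

lemma L_subgroup: "subgroup L G" using L_normal normal_imp_subgroup by blast

lemma L_carrier: "x \<in> L \<Longrightarrow> x \<in> carrier G" using L_subgroup subgroup.mem_carrier by metis

lemma graft_mem_L:
  assumes "x \<in> L" "v \<in> tree p"
  shows "graft p v x \<in> L"
  using assms(2)
proof (induction v)
  case Nil
  have "graft p [] x = x"
    using extensional[OF L_carrier[OF assms(1)]] by (auto simp: graft_def restrict_def extensional_def)
  thus ?case using assms(1) by simp
next
  case (Cons i v)
  have "graft p (i # v) x = graft p [i] (graft p v x)"
  proof
    fix w show "graft p (i # v) x w = graft p [i] (graft p v x) w"
      by (cases w) (auto simp: graft_def)
  qed
  thus ?case using L_branch[of "graft p v x" i] Cons by simp
qed

lemma level_tree: "v \<in> level p n \<Longrightarrow> v \<in> tree p"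
  by (simp add: level_def)

text \<open>
  \<open>L\<close> moves some vertex, and it is normal in a group that is transitive on the level of that vertex.
\<close>

lemma L_moves_level: "\<exists>m. \<forall>v\<in>level p m. \<exists>l\<in>L. l v \<noteq> v"
proof -
  obtain x w where x: "x \<in> L" "w \<in> tree p" "x w \<noteq> w" using L_nontrivial by blast
  have "\<exists>l\<in>L. l v \<noteq> v" if v: "v \<in> level p (length w)" for v
  proof -
    obtain g where g: "g \<in> carrier G" "g w = v" using level_transitive[of w "length w" v] v x(2) by (auto simp: level_def)
    have xG: "x \<in> carrier G" using L_carrier x(1) .
    have "(g \<otimes> x \<otimes> inv g) v = g (x ((inv g) v))"
      using mult_apply[of "g \<otimes> x" "inv g" v] mult_apply[of g x "(inv g) v"] g xG v
        inv_apply_in_level(1)[OF g(1) v] by (auto simp: level_def)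
    also have "(inv g) v = w" unfolding g(2)[symmetric] by (rule inv_apply(1)[OF g(1) x(2)])
    finally have "(g \<otimes> x \<otimes> inv g) v \<noteq> v"
      using apply_inj[OF g(1) apply_in_tree[OF xG x(2)] x(2)] g(2) x(3) by auto
    moreover have "g \<otimes> x \<otimes> inv g \<in> L" using normal.inv_op_closed2[OF L_normal g(1) x(1)] .
    ultimately show ?thesis by blast
  qed
  thus ?thesis by blast
qed

text \<open>
  The direct product of the copies of \<open>L\<close> below the vertices of level \<open>m\<close>.
\<close>

definition branch_stab :: "nat \<Rightarrow> (nat list \<Rightarrow> nat list) set" where
  "branch_stab m = {x \<in> carrier G. \<forall>v\<in>level p m. x v = v \<and> sec p x v \<in> L}"

definition level_tuple :: "nat \<Rightarrow> (nat list \<Rightarrow> nat list \<Rightarrow> nat list) \<Rightarrow> nat list \<Rightarrow> nat list" where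
  "level_tuple m y = (\<lambda>w\<in>tree p. if length w < m then w else take m w @ y (take m w) (drop m w))"

text \<open>
  A tuple is the product of the grafts of its components, adjoined one vertex at a time.
\<close>

lemma level_tuple_mem_L:
  assumes "\<And>v. v \<in> level p m \<Longrightarrow> y v \<in> L"
  shows "level_tuple m y \<in> L"
proof -
  have "level_tuple m (\<lambda>v. if v \<in> W then y v else \<one>) \<in> L" if "finite W" "W \<subseteq> level p m" for W
    using that
  proof (induction W rule: finite_induct)
    case empty
    have "level_tuple m (\<lambda>v. if v \<in> {} then y v else \<one>) = \<one>"
      by (rule extensionalityI[OF _ extensional[OF one_closed]])
        (auto simp: level_tuple_def one_apply tree_drop)
    thus ?case using subgroup.one_closed[OF L_subgroup] by simp
  next
    case (insert v W)
    let ?y = "\<lambda>W v. if v \<in> W then y v else \<one>"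
    have v: "v \<in> tree p" "length v = m" "y v \<in> L" using insert.prems assms by (auto simp: level_def)
    have gr: "graft p v (y v) \<in> L" using graft_mem_L v by blast
    have IH: "level_tuple m (?y W) \<in> L" using insert by simp
    have carr: "graft p v (y v) \<in> carrier G" "level_tuple m (?y W) \<in> carrier G" using gr IH L_carrier by auto
    have "level_tuple m (?y (insert v W)) = graft p v (y v) \<otimes> level_tuple m (?y W)"
    proof (rule extensionalityI[OF _ extensional[OF m_closed[OF carr]]])
      show "level_tuple m (?y (insert v W)) \<in> extensional (tree p)" by (simp add: level_tuple_def)
      fix w assume w: "w \<in> tree p"
      have tw: "level_tuple m (?y W) w \<in> tree p" using apply_in_tree[OF carr(2) w] .
      have eq: "(graft p v (y v) \<otimes> level_tuple m (?y W)) w = graft p v (y v) (level_tuple m (?y W) w)"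
        by (rule mult_apply[OF carr w])
      show "level_tuple m (?y (insert v W)) w = (graft p v (y v) \<otimes> level_tuple m (?y W)) w"
      proof (cases "length w < m")
        case True
        hence "take (length v) w \<noteq> v" using v(2) by auto
        thus ?thesis unfolding eq using True w by (simp add: level_tuple_def graft_def)
      next
        case False
        hence tm: "length (take m w) = m" by simp
        have st: "level_tuple m (?y W) w = take m w @ ?y W (take m w) (drop m w)"
          using False w by (simp add: level_tuple_def)
        have "graft p v (y v) (level_tuple m (?y W) w) =
            (if take m w = v then v @ y v (?y W (take m w) (drop m w)) else take m w @ ?y W (take m w) (drop m w))"
          using tw tm v(2) unfolding st graft_def by simp
        also have "\<dots> = take m w @ ?y (insert v W) (take m w) (drop m w)"
          using insert.hyps(2) one_apply[OF tree_drop[OF w]] by auto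
        finally show ?thesis unfolding eq using False w by (simp add: level_tuple_def)
      qed
    qed
    thus ?case using subgroup.m_closed[OF L_subgroup gr IH] by simp
  qed
  from this[OF card_level(1) subset_refl]
  have "level_tuple m (\<lambda>v. if v \<in> level p m then y v else \<one>) \<in> L" .
  moreover have "level_tuple m (\<lambda>v. if v \<in> level p m then y v else \<one>) = level_tuple m y"
  proof
    fix w show "level_tuple m (\<lambda>v. if v \<in> level p m then y v else \<one>) w = level_tuple m y w"
      by (auto simp: level_tuple_def level_def tree_take)
  qed
  ultimately show ?thesis by simp
qed

lemma level_tuple_apply:
  assumes "\<And>v. v \<in> level p m \<Longrightarrow> y v \<in> L" "v \<in> level p m"
  shows "level_tuple m y v = v" "sec p (level_tuple m y) v = y v"
proof -
  have v: "v \<in> tree p" "length v = m" using assms(2) by (auto simp: level_def)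
  have yG: "y v \<in> carrier G" using assms L_carrier by blast
  show "level_tuple m y v = v" using v Nil_apply[OF yG] by (simp add: level_tuple_def)
  show "sec p (level_tuple m y) v = y v"
    by (rule extensionalityI[OF _ extensional[OF yG]]) (use v in \<open>auto simp: level_tuple_def sec_def\<close>)
qed

lemma level_tuple_mem_branch_stab:
  assumes "\<And>v. v \<in> level p m \<Longrightarrow> y v \<in> L"
  shows "level_tuple m y \<in> branch_stab m"
  using level_tuple_apply[OF assms] assms L_carrier[OF level_tuple_mem_L[OF assms]] by (simp add: branch_stab_def)

lemma branch_stab_normal: "branch_stab m \<lhd> G"
proof (rule normal_invI)
  show "subgroup (branch_stab m) G"
  proof (rule subgroupI)
    show "branch_stab m \<subseteq> carrier G" by (auto simp: branch_stab_def)
    have "\<one> \<in> branch_stab m"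
      using one_apply sec_one subgroup.one_closed[OF L_subgroup] level_tree by (auto simp: branch_stab_def)
    thus "branch_stab m \<noteq> {}" by blast
  next
    fix g h assume g: "g \<in> branch_stab m" and h: "h \<in> branch_stab m"
    hence gh: "g \<in> carrier G" "h \<in> carrier G" by (auto simp: branch_stab_def)
    have "(g \<otimes> h) v = v \<and> sec p (g \<otimes> h) v \<in> L" if v: "v \<in> level p m" for v
    proof
      have hv: "h v = v" "g v = v" using g h v by (auto simp: branch_stab_def)
      show "(g \<otimes> h) v = v" using mult_apply[OF gh level_tree[OF v]] hv by simp
      have "sec p (g \<otimes> h) v = sec p g v \<otimes> sec p h v"
        using sec_mult[OF gh level_tree[OF v]] sec_closed gh level_tree[OF v] hv by simp
      thus "sec p (g \<otimes> h) v \<in> L" using g h v subgroup.m_closed[OF L_subgroup] by (simp add: branch_stab_def)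
    qed
    thus "g \<otimes> h \<in> branch_stab m" using gh by (simp add: branch_stab_def)
  next
    fix g assume g: "g \<in> branch_stab m"
    hence gG: "g \<in> carrier G" by (auto simp: branch_stab_def)
    have "(inv g) v = v \<and> sec p (inv g) v \<in> L" if v: "v \<in> level p m" for v
    proof
      have gv: "g v = v" "sec p g v \<in> L" using g v by (auto simp: branch_stab_def)
      show iv: "(inv g) v = v" using inv_apply(1)[OF gG level_tree[OF v]] gv by simp
      have "sec p (inv g) v = inv (sec p g v)"
        using sec_inv[OF gG level_tree[OF v]] L_carrier[OF gv(2)] iv by simp
      thus "sec p (inv g) v \<in> L" using subgroup.m_inv_closed[OF L_subgroup gv(2)] by simp
    qed
    thus "inv g \<in> branch_stab m" using gG by (simp add: branch_stab_def)
  qed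
  fix g x assume g: "g \<in> carrier G" and x: "x \<in> branch_stab m"
  hence xG: "x \<in> carrier G" by (auto simp: branch_stab_def)
  have "(g \<otimes> x \<otimes> inv g) v = v \<and> sec p (g \<otimes> x \<otimes> inv g) v \<in> L" if v: "v \<in> level p m" for v
  proof
    define u where "u = (inv g) v"
    have u: "u \<in> level p m" unfolding u_def using inv_apply_in_level(1)[OF g v] .
    have gu: "g u = v" unfolding u_def using inv_apply(2)[OF g level_tree[OF v]] .
    have xu: "x u = u" "sec p x u \<in> L" using x u by (auto simp: branch_stab_def)
    have gx: "(g \<otimes> x) u = v" using mult_apply[OF g xG level_tree[OF u]] xu gu by simp
    have gxG: "g \<otimes> x \<in> carrier G" using g xG by simp
    show "(g \<otimes> x \<otimes> inv g) v = v"
      using mult_apply[OF gxG inv_closed[OF g] level_tree[OF v]] gx by (simp add: u_def)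
    have s: "sec p g u \<in> carrier G" "sec p (inv g) v \<in> carrier G" "sec p (g \<otimes> x) u \<in> carrier G"
      using sec_closed g gxG level_tree[OF u] level_tree[OF v] by auto
    have iv: "sec p (inv g) v = inv (sec p g u)"
      using sec_inv[OF g level_tree[OF v]] s(1) by (simp add: u_def)
    have "sec p (g \<otimes> x \<otimes> inv g) v = sec p (g \<otimes> x) u \<otimes> sec p (inv g) v"
      using sec_mult[OF gxG inv_closed[OF g] level_tree[OF v]] s by (simp add: u_def)
    also have "sec p (g \<otimes> x) u = sec p g u \<otimes> sec p x u"
      using sec_mult[OF g xG level_tree[OF u]] s L_carrier[OF xu(2)] xu(1) by simp
    finally show "sec p (g \<otimes> x \<otimes> inv g) v \<in> L"
      unfolding iv using normal.inv_op_closed2[OF L_normal s(1) xu(2)] by simp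
  qed
  thus "g \<otimes> x \<otimes> inv g \<in> branch_stab m" using g xG by (simp add: branch_stab_def)
qed

end

section \<open>The recursive count of double cosets\<close>

context regular_branch_group
begin

lemma one_le_card_cosets_meeting:
  assumes "finite (cosets_meeting G U A)" "x \<in> A"
  shows "1 \<le> card (cosets_meeting G U A)"
  using assms by (auto simp: Suc_le_eq card_gt_0_iff cosets_meeting_def)

text \<open>
  This is a projection and not the intersection of \<open>U\<close> with the copy of \<open>L\<close> below \<open>v\<close>. For a diagonal subgroup \<open>U\<close> the
  intersections are too small, and the product of their indices may exceed the index of \<open>U\<close>.
\<close>

definition vertex_projection :: "nat \<Rightarrow> (nat list \<Rightarrow> nat list) set \<Rightarrow> nat list \<Rightarrow> (nat list \<Rightarrow> nat list) set" where
  "vertex_projection m U v = (\<lambda>u. sec p u v) ` (U \<inter> branch_stab m)"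

lemma branch_stabD:
  assumes "u \<in> branch_stab m" "v \<in> level p m"
  shows "u \<in> carrier G" "u v = v" "sec p u v \<in> L" "sec p u v \<in> carrier G"
  using assms L_carrier by (auto simp: branch_stab_def)

lemma branch_stab_sec_mult:
  assumes "x \<in> branch_stab m" "y \<in> branch_stab m" "v \<in> level p m"
  shows "sec p (x \<otimes> y) v = sec p x v \<otimes> sec p y v"
  using sec_mult[of x y v] branch_stabD[OF assms(1,3)] branch_stabD[OF assms(2,3)] level_tree[OF assms(3)]
  by simp

lemma branch_stab_subgroup: "subgroup (branch_stab m) G"
  using branch_stab_normal normal_imp_subgroup by blast

lemma branch_stab_sec_inv:
  assumes "x \<in> branch_stab m" "v \<in> level p m"
  shows "sec p (inv x) v = inv (sec p x v)"
proof -
  have "(inv x) v = v"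
    using inv_apply(1)[OF branch_stabD(1)[OF assms] level_tree[OF assms(2)]] branch_stabD(2)[OF assms] by simp
  thus ?thesis using sec_inv[OF branch_stabD(1)[OF assms] level_tree[OF assms(2)]] branch_stabD(4)[OF assms] by simp
qed

lemma vertex_projection_subgroup:
  assumes U: "subgroup U G" and v: "v \<in> level p m"
  shows "subgroup (vertex_projection m U v) G"
proof -
  let ?W = "U \<inter> branch_stab m"
  have W: "subgroup ?W G" by (rule subgroups_Inter_pair[OF U branch_stab_subgroup])
  show ?thesis
  proof (rule subgroupI)
    show "vertex_projection m U v \<subseteq> carrier G"
      unfolding vertex_projection_def using branch_stabD(4)[OF _ v] by blast
    show "vertex_projection m U v \<noteq> {}"
      unfolding vertex_projection_def using subgroup.one_closed[OF W] by blast
    fix a assume "a \<in> vertex_projection m U v"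
    then obtain x where x: "x \<in> ?W" "a = sec p x v" by (auto simp: vertex_projection_def)
    have "inv a = sec p (inv x) v" using branch_stab_sec_inv[OF _ v] x by simp
    thus "inv a \<in> vertex_projection m U v"
      unfolding vertex_projection_def using subgroup.m_inv_closed[OF W x(1)] by blast
  next
    fix a b assume "a \<in> vertex_projection m U v" "b \<in> vertex_projection m U v"
    then obtain x y where x: "x \<in> ?W" "a = sec p x v" and y: "y \<in> ?W" "b = sec p y v"
      unfolding vertex_projection_def by blast
    have "a \<otimes> b = sec p (x \<otimes> y) v" using branch_stab_sec_mult[OF _ _ v] x y by simp
    thus "a \<otimes> b \<in> vertex_projection m U v"
      unfolding vertex_projection_def using subgroup.m_closed[OF W x(1) y(1)] by blast
  qed
qed

lemma vertex_projection_subset: "v \<in> level p m \<Longrightarrow> vertex_projection m U v \<subseteq> L"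
  unfolding vertex_projection_def using branch_stabD(3) by blast

lemma vertex_projection_tuples:
  assumes U: "subgroup U G" and x: "\<And>v. v \<in> level p m \<Longrightarrow> x v \<in> L" and y: "\<And>v. v \<in> level p m \<Longrightarrow> y v \<in> L"
    and mem: "level_tuple m x \<otimes> inv (level_tuple m y) \<in> U" and v: "v \<in> level p m"
  shows "x v \<otimes> inv (y v) \<in> vertex_projection m U v"
proof -
  have A: "level_tuple m x \<in> branch_stab m" "level_tuple m y \<in> branch_stab m"
    using level_tuple_mem_branch_stab x y by blast+
  have iA: "inv (level_tuple m y) \<in> branch_stab m" using subgroup.m_inv_closed[OF branch_stab_subgroup A(2)] .
  have "sec p (level_tuple m x \<otimes> inv (level_tuple m y)) v = x v \<otimes> inv (y v)"
    using branch_stab_sec_mult[OF A(1) iA v] branch_stab_sec_inv[OF A(2) v]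
      level_tuple_apply(2)[of m x v, OF x v] level_tuple_apply(2)[of m y v, OF y v] by simp
  moreover have "level_tuple m x \<otimes> inv (level_tuple m y) \<in> U \<inter> branch_stab m"
    using mem subgroup.m_closed[OF branch_stab_subgroup A(1) iA] by blast
  ultimately show ?thesis unfolding vertex_projection_def by force
qed

lemma finite_vertex_projection_index:
  assumes U: "subgroup U G" "finite (cosets_meeting G U L)" and v: "v \<in> level p m"
  shows "finite (cosets_meeting G (vertex_projection m U v) L)"
proof -
  have LG: "L \<subseteq> carrier G" using L_carrier by blast
  let ?y = "\<lambda>x w. if w = v then x else \<one>"
  have yL: "?y x w \<in> L" if "x \<in> L" for x w using that subgroup.one_closed[OF L_subgroup] by simp
  have tL: "level_tuple m (?y x) \<in> L" if "x \<in> L" for x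
    by (rule level_tuple_mem_L) (rule yL[OF that])
  have im: "(\<lambda>x. U #> level_tuple m (?y x)) ` L \<subseteq> cosets_meeting G U L"
    unfolding cosets_meeting_def using tL by blast
  have eq: "x \<otimes> inv x' \<in> vertex_projection m U v"
    if "x \<in> L" "x' \<in> L" "U #> level_tuple m (?y x) = U #> level_tuple m (?y x')" for x x'
  proof -
    have "level_tuple m (?y x) \<in> carrier G" "level_tuple m (?y x') \<in> carrier G"
      using L_carrier[OF tL] that(1,2) by auto
    hence "level_tuple m (?y x) \<otimes> inv (level_tuple m (?y x')) \<in> U"
      using rcos_eq_iff[OF U(1)] that(3) by simp
    from vertex_projection_tuples[OF U(1) yL[OF that(1)] yL[OF that(2)] this v] show ?thesis by simp
  qed
  show ?thesis
    by (rule card_cosets_meeting_le(1)[OF vertex_projection_subgroup[OF U(1) v] LG U(2) im eq])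
qed

text \<open>
  Tuples of coset representatives of the projections lie in distinct cosets of \<open>U\<close>. An element \<open>y0\<close> of \<open>L\<close> outside
  \<open>U\<close> times \<open>branch_stab m\<close> gives as many further cosets, because \<open>branch_stab m\<close> is normal.
\<close>

lemma prod_projection_index_le:
  fixes m :: nat
  assumes U: "subgroup U G" "U \<subseteq> L" "finite (cosets_meeting G U L)"
  defines "s \<equiv> \<lambda>v. card (cosets_meeting G (vertex_projection m U v) L)"
  shows "(\<Prod>v\<in>level p m. s v) \<le> card (cosets_meeting G U L)"
    and "y0 \<in> L \<Longrightarrow> (\<And>u a. u \<in> U \<Longrightarrow> a \<in> branch_stab m \<Longrightarrow> y0 \<noteq> u \<otimes> a) \<Longrightarrow>
      2 * (\<Prod>v\<in>level p m. s v) \<le> card (cosets_meeting G U L)"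
proof -
  have LG: "L \<subseteq> carrier G" using L_carrier by blast
  have "\<forall>v\<in>level p m. \<exists>T\<subseteq>L. finite T \<and> card T = s v \<and>
    (\<forall>x\<in>L. \<exists>t\<in>T. x \<otimes> inv t \<in> vertex_projection m U v) \<and>
    (\<forall>x\<in>T. \<forall>y\<in>T. x \<otimes> inv y \<in> vertex_projection m U v \<longrightarrow> x = y)"
  proof
    fix v assume v: "v \<in> level p m"
    show "\<exists>T\<subseteq>L. finite T \<and> card T = s v \<and>
        (\<forall>x\<in>L. \<exists>t\<in>T. x \<otimes> inv t \<in> vertex_projection m U v) \<and>
        (\<forall>x\<in>T. \<forall>y\<in>T. x \<otimes> inv y \<in> vertex_projection m U v \<longrightarrow> x = y)"
      unfolding s_def by (rule transversal_exists[OF vertex_projection_subgroup[OF U(1) v] LG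
          finite_vertex_projection_index[OF U(1,3) v]])
  qed
  from bchoice[OF this] obtain T where T0: "\<forall>v\<in>level p m. T v \<subseteq> L \<and> finite (T v) \<and> card (T v) = s v \<and>
    (\<forall>x\<in>L. \<exists>t\<in>T v. x \<otimes> inv t \<in> vertex_projection m U v) \<and>
    (\<forall>x\<in>T v. \<forall>y\<in>T v. x \<otimes> inv y \<in> vertex_projection m U v \<longrightarrow> x = y)" ..
  have T: "T v \<subseteq> L" "card (T v) = s v"
    "\<And>x y. x \<in> T v \<Longrightarrow> y \<in> T v \<Longrightarrow> x \<otimes> inv y \<in> vertex_projection m U v \<Longrightarrow> x = y"
    if "v \<in> level p m" for v using T0 that by blast+
  define P where "P = (\<Pi>\<^sub>E v\<in>level p m. T v)"
  have cardP: "card P = (\<Prod>v\<in>level p m. s v)"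
    unfolding P_def using T(2) by (simp add: card_PiE card_level(1))
  have PL: "x v \<in> L" if "x \<in> P" "v \<in> level p m" for x v
    using that T(1)[OF that(2)] by (auto simp: P_def)
  have tL: "level_tuple m x \<in> L" if "x \<in> P" for x using level_tuple_mem_L PL that by blast
  have tG: "level_tuple m x \<in> carrier G" if "x \<in> P" for x using tL[OF that] L_carrier by blast
  have tA: "level_tuple m x \<in> branch_stab m" if "x \<in> P" for x
    using level_tuple_mem_branch_stab PL that by blast
  have inj: "x = y" if xy: "x \<in> P" "y \<in> P" and mem: "level_tuple m x \<otimes> inv (level_tuple m y) \<in> U" for x y
  proof (rule PiE_ext[OF xy[unfolded P_def]])
    fix v assume v: "v \<in> level p m"
    have "x v \<otimes> inv (y v) \<in> vertex_projection m U v"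
      by (rule vertex_projection_tuples[OF U(1) _ _ mem v]) (use PL xy in auto)
    thus "x v = y v" using T(3)[OF v] PiE_mem[OF xy(1)[unfolded P_def] v] PiE_mem[OF xy(2)[unfolded P_def] v] by blast
  qed
  have im: "level_tuple m ` P \<subseteq> L" using tL by blast
  show "(\<Prod>v\<in>level p m. s v) \<le> card (cosets_meeting G U L)"
    unfolding cardP[symmetric] by (rule card_le_cosets_meeting(2)[OF U(1) LG U(3) im inj])
  assume y0: "y0 \<in> L" and nUA: "\<And>u a. u \<in> U \<Longrightarrow> a \<in> branch_stab m \<Longrightarrow> y0 \<noteq> u \<otimes> a"
  have y0G: "y0 \<in> carrier G" using L_carrier[OF y0] .
  \<comment> \<open>The boolean tells whether the tuple is multiplied by \<open>y0\<close>.\<close>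
  define h where "h = (\<lambda>(x, b :: bool). if b then level_tuple m x \<otimes> y0 else level_tuple m x)"
  have no: "level_tuple m x \<otimes> y0 \<otimes> inv (level_tuple m y) \<notin> U" if xy: "x \<in> P" "y \<in> P" for x y
  proof
    let ?x = "level_tuple m x" and ?y = "level_tuple m y"
    assume mem: "?x \<otimes> y0 \<otimes> inv ?y \<in> U" (is "?u \<in> U")
    have uG: "?u \<in> carrier G" using tG xy y0G by simp
    have iu: "inv ?u \<otimes> inv ?x \<otimes> ?u \<in> branch_stab m"
      using normal.inv_op_closed1[OF branch_stab_normal uG]
        subgroup.m_inv_closed[OF branch_stab_subgroup tA[OF xy(1)]] by blast
    have "y0 = ?u \<otimes> ((inv ?u \<otimes> inv ?x \<otimes> ?u) \<otimes> ?y)"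
      using tG[OF xy(1)] tG[OF xy(2)] y0G by (simp add: m_assoc inv_mult_group inv_mult_cancel)
    thus False using nUA[OF mem subgroup.m_closed[OF branch_stab_subgroup iu tA[OF xy(2)]]] by blast
  qed
  have inj2: "a = b" if ab: "a \<in> P \<times> UNIV" "b \<in> P \<times> UNIV" and mem: "h a \<otimes> inv (h b) \<in> U" for a b
  proof -
    obtain x i y j where eq: "a = (x, i)" "b = (y, j)" by (cases a; cases b)
    have xy: "x \<in> P" "y \<in> P" using ab eq by auto
    have G: "level_tuple m x \<in> carrier G" "level_tuple m y \<in> carrier G" using tG xy by auto
    consider "i = j" | "i" "\<not> j" | "\<not> i" "j" by blast
    thus ?thesis
    proof cases
      case 1
      have "h a \<otimes> inv (h b) = level_tuple m x \<otimes> inv (level_tuple m y)"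
        using 1 G y0G by (cases j) (simp_all add: h_def eq inv_mult_group m_assoc inv_mult_cancel)
      hence "x = y" using inj[OF xy] mem by simp
      thus ?thesis using 1 eq by simp
    next
      case 2
      thus ?thesis using no[OF xy] mem by (simp add: h_def eq)
    next
      case 3
      have "inv (level_tuple m x \<otimes> inv (level_tuple m y \<otimes> y0)) \<in> U"
        using subgroup.m_inv_closed[OF U(1) mem] 3 by (simp add: h_def eq)
      moreover have "inv (level_tuple m x \<otimes> inv (level_tuple m y \<otimes> y0)) = level_tuple m y \<otimes> y0 \<otimes> inv (level_tuple m x)"
        using G y0G by (simp add: inv_mult_group m_assoc)
      ultimately show ?thesis using no[OF xy(2,1)] by simp
    qed
  qed
  have im2: "h ` (P \<times> UNIV) \<subseteq> L"
    using tL y0 subgroup.m_closed[OF L_subgroup] by (auto simp: h_def)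
  have "card (P \<times> (UNIV :: bool set)) \<le> card (cosets_meeting G U L)"
    by (rule card_le_cosets_meeting(2)[OF U(1) LG U(3) im2 inj2])
  thus "2 * (\<Prod>v\<in>level p m. s v) \<le> card (cosets_meeting G U L)"
    using cardP by (simp add: card_cartesian_product)
qed

lemma card_vertex_projection_eq_1:
  assumes U: "subgroup U G" and v: "v \<in> level p m"
  shows "card (cosets_meeting G (vertex_projection m U v) L) = 1 \<longleftrightarrow> vertex_projection m U v = L"
proof
  let ?W = "vertex_projection m U v"
  have W: "subgroup ?W G" "?W \<subseteq> L" using vertex_projection_subgroup[OF U v] vertex_projection_subset[OF v] by auto
  {
    assume "card (cosets_meeting G ?W L) = 1"
    then obtain C where C: "cosets_meeting G ?W L = {C}" by (meson card_1_singletonE)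
    have "x \<in> ?W" if x: "x \<in> L" for x
    proof -
      have "?W #> x = C" "?W #> \<one> = C"
        using C x subgroup.one_closed[OF L_subgroup] unfolding cosets_meeting_def by blast+
      hence "x \<otimes> inv \<one> \<in> ?W" using rcos_eq_iff[OF W(1) L_carrier[OF x] one_closed] by simp
      thus ?thesis using L_carrier[OF x] by simp
    qed
    thus "?W = L" using W(2) by blast
  next
    assume eq: "?W = L"
    have "cosets_meeting G L L = {L}"
      using coset_join2[OF L_carrier L_subgroup] subgroup.one_closed[OF L_subgroup] unfolding cosets_meeting_def by blast
    thus "card (cosets_meeting G ?W L) = 1" unfolding eq by simp
  }
qed

text \<open>
  An element of \<open>U\<close> that maps \<open>v\<close> to \<open>u v\<close> conjugates the projection at \<open>v\<close> into the projection at \<open>u v\<close> by its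
  section, which normalises \<open>L\<close>.
\<close>

lemma vertex_projection_conj:
  assumes U: "subgroup U G" and u: "u \<in> U" and v: "v \<in> level p m" and full: "vertex_projection m U (u v) = L"
  shows "vertex_projection m U v = L"
proof
  show "vertex_projection m U v \<subseteq> L" using vertex_projection_subset[OF v] .
  have uG: "u \<in> carrier G" using subgroup.mem_carrier[OF U u] .
  have uv: "u v \<in> level p m" using inv_apply_in_level(2)[OF uG v] .
  have vt: "v \<in> tree p" "u v \<in> tree p" using level_tree v uv by auto
  let ?g = "sec p u v"
  have g: "?g \<in> carrier G" using sec_closed[OF uG vt(1)] .
  show "L \<subseteq> vertex_projection m U v"
  proof
    fix x assume x: "x \<in> L"
    have xG: "x \<in> carrier G" using L_carrier[OF x] .
    have "?g \<otimes> x \<otimes> inv ?g \<in> vertex_projection m U (u v)"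
      unfolding full by (rule normal.inv_op_closed2[OF L_normal g x])
    then obtain y where y: "y \<in> U" "y \<in> branch_stab m" "?g \<otimes> x \<otimes> inv ?g = sec p y (u v)"
      unfolding vertex_projection_def by blast
    define z where "z = inv u \<otimes> y \<otimes> u"
    have yG: "y \<in> carrier G" using subgroup.mem_carrier[OF U y(1)] .
    have zU: "z \<in> U" unfolding z_def using subgroup.m_closed[OF U] subgroup.m_inv_closed[OF U u] u y(1) by blast
    have zA: "z \<in> branch_stab m" unfolding z_def by (rule normal.inv_op_closed1[OF branch_stab_normal uG y(2)])
    have zG: "z \<in> carrier G" using subgroup.mem_carrier[OF U zU] .
    have uz: "u \<otimes> z = y \<otimes> u" unfolding z_def using uG yG by (simp add: m_assoc inv_mult_cancel)
    have "?g \<otimes> sec p z v = sec p (u \<otimes> z) v"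
      using sec_mult[OF uG zG vt(1)] branch_stabD(2,4)[OF zA v] g by simp
    also have "\<dots> = sec p y (u v) \<otimes> ?g"
      unfolding uz using sec_mult[OF yG uG vt(1)] branch_stabD(4)[OF y(2) uv] g by simp
    also have "\<dots> = ?g \<otimes> x" unfolding y(3)[symmetric] using g xG by (simp add: m_assoc)
    finally have "sec p z v = x" using l_cancel[of ?g "sec p z v" x] g branch_stabD(4)[OF zA v] xG by blast
    thus "x \<in> vertex_projection m U v" unfolding vertex_projection_def using zU zA by blast
  qed
qed

definition same_germ :: "(nat list \<Rightarrow> nat list) \<Rightarrow> (nat list \<Rightarrow> nat list) \<Rightarrow> bool" where
  "same_germ g h \<longleftrightarrow> (\<exists>k. \<forall>w\<in>tree p. g (replicate k 0 @ w) = h (replicate k 0 @ w))"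

text \<open>
  The elements of \<open>Z\<close> represent distinct double cosets of \<open>U\<close> and the group of elements with trivial germ.
\<close>

definition germ_separated :: "(nat list \<Rightarrow> nat list) set \<Rightarrow> (nat list \<Rightarrow> nat list) set \<Rightarrow> bool" where
  "germ_separated U Z \<longleftrightarrow> (\<forall>z\<in>Z. \<forall>z'\<in>Z. \<forall>u\<in>U. same_germ (u \<otimes> z) z' \<longrightarrow> z = z')"

text \<open>
  Sections at a vertex of the ray \<open>000...\<close> live again at this ray, which makes the count recursive: a relation between the
  sections by an element of the projection lifts to a relation by an element of \<open>U\<close>.
\<close>

lemma germ_separated_projection:
  assumes U: "subgroup U G" and Z: "Z \<subseteq> carrier G" "germ_separated U Z" and v: "v \<in> level p m"
  defines "Zv \<equiv> {z \<in> Z. z (replicate m 0) = v}" and "\<sigma> \<equiv> \<lambda>z. sec p z (replicate m 0)"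
  shows "inj_on \<sigma> Zv" "\<sigma> ` Zv \<subseteq> carrier G" "germ_separated (vertex_projection m U v) (\<sigma> ` Zv)"
proof -
  let ?o = "replicate m 0"
  have o: "?o \<in> tree p" using p_gt_1 by simp
  have key: "z = z'" if z: "z \<in> Zv" "z' \<in> Zv" and u: "u \<in> U" "u \<in> branch_stab m"
    and germ: "same_germ (sec p u v \<otimes> \<sigma> z) (\<sigma> z')" for z z' u
  proof -
    have G: "z \<in> carrier G" "z' \<in> carrier G" "u \<in> carrier G" "z ?o = v" "z' ?o = v"
      using z Z(1) subgroup.mem_carrier[OF U u(1)] by (auto simp: Zv_def)
    have s: "\<sigma> z \<in> carrier G" "\<sigma> z' \<in> carrier G" unfolding \<sigma>_def using sec_closed G o by auto
    obtain k where k: "\<And>w. w \<in> tree p \<Longrightarrow>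
        (sec p u v \<otimes> \<sigma> z) (replicate k 0 @ w) = \<sigma> z' (replicate k 0 @ w)"
      using germ unfolding same_germ_def by blast
    have "(u \<otimes> z) (replicate (m + k) 0 @ w) = z' (replicate (m + k) 0 @ w)" if w: "w \<in> tree p" for w
    proof -
      let ?w = "replicate k 0 @ w"
      have wt: "?w \<in> tree p" using w p_gt_1 by simp
      have split: "replicate (m + k) 0 @ w = ?o @ ?w" by (simp add: replicate_add)
      have "(u \<otimes> z) (?o @ ?w) = u (z (?o @ ?w))"
        by (rule mult_apply[OF G(3,1) iffD2[OF tree_append conjI[OF o wt]]])
      also have "\<dots> = u (v @ \<sigma> z ?w)" unfolding \<sigma>_def using apply_append_sec[OF G(1) o wt] G(4) by simp
      also have "\<dots> = v @ sec p u v (\<sigma> z ?w)"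
        using apply_append_sec[OF G(3) level_tree[OF v] apply_in_tree[OF s(1) wt]] branch_stabD(2)[OF u(2) v] by simp
      also have "\<dots> = v @ \<sigma> z' ?w"
        using k[OF w] mult_apply[OF branch_stabD(4)[OF u(2) v] s(1) wt] by simp
      also have "\<dots> = z' (?o @ ?w)" unfolding \<sigma>_def using apply_append_sec[OF G(2) o wt] G(5) by simp
      finally show ?thesis unfolding split .
    qed
    hence "same_germ (u \<otimes> z) z'" unfolding same_germ_def by blast
    thus ?thesis using Z(2) z u(1) unfolding germ_separated_def Zv_def by blast
  qed
  have sG: "\<sigma> z \<in> carrier G" if "z \<in> Zv" for z
    unfolding \<sigma>_def using sec_closed[OF _ o] that Z(1) by (auto simp: Zv_def)
  thus "\<sigma> ` Zv \<subseteq> carrier G" by blast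
  show "inj_on \<sigma> Zv"
  proof (rule inj_onI)
    fix z z' assume z: "z \<in> Zv" "z' \<in> Zv" "\<sigma> z = \<sigma> z'"
    have "sec p \<one> v \<otimes> \<sigma> z = \<sigma> z'" using sec_one[OF level_tree[OF v]] sG[OF z(1)] z(3) by simp
    hence "same_germ (sec p \<one> v \<otimes> \<sigma> z) (\<sigma> z')" by (simp add: same_germ_def)
    thus "z = z'" using key[OF z(1,2) subgroup.one_closed[OF U] subgroup.one_closed[OF branch_stab_subgroup]] by blast
  qed
  show "germ_separated (vertex_projection m U v) (\<sigma> ` Zv)"
    unfolding germ_separated_def vertex_projection_def using key by blast
qed

lemma card_germ_separated_base:
  assumes Z: "finite Z" "Z \<subseteq> carrier G" "germ_separated L Z"
  shows "card Z \<le> card (rcosets L)"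
  unfolding rcosets_eq_cosets_meeting
proof (rule card_le_cosets_meeting(2)[OF L_subgroup subset_refl, where f = id])
  show "finite (cosets_meeting G L (carrier G))" using L_index rcosets_eq_cosets_meeting by metis
  show "id ` Z \<subseteq> carrier G" using Z(2) by simp
  fix x y assume xy: "x \<in> Z" "y \<in> Z" and mem: "id x \<otimes> inv (id y) \<in> L"
  have "x \<in> carrier G" "y \<in> carrier G" using xy Z(2) by auto
  hence "(x \<otimes> inv y) \<otimes> y = x" by (simp add: m_assoc)
  hence "same_germ ((x \<otimes> inv y) \<otimes> y) x" by (simp add: same_germ_def)
  thus "x = y" using Z(3) xy mem unfolding germ_separated_def id_apply by blast
qed

text \<open>
  Sort the representatives by the image \<open>v\<close> of the vertex \<open>0 ^ m\<close> and pass to the sections. If \<open>L\<close> is not the product of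
  \<open>U\<close> and \<open>branch_stab m\<close>, the product of the indices \<open>s v\<close> is at most half the index. Otherwise \<open>U\<close> moves
  the vertices of level \<open>m\<close> as \<open>L\<close> does, and with a proper projection at \<open>v\<close> there is another one at some \<open>u v \<noteq> v\<close>.
\<close>

theorem card_germ_separated_le:
  assumes m: "\<forall>v\<in>level p m. \<exists>l\<in>L. l v \<noteq> v"
    and U: "subgroup U G" "U \<subseteq> L" "finite (cosets_meeting G U L)"
    and Z: "finite Z" "Z \<subseteq> carrier G" "germ_separated U Z"
  shows "card Z \<le> log_bound (real (p ^ m)) (card (rcosets L)) (card (cosets_meeting G U L))"
  using U Z
proof (induction "card (cosets_meeting G U L)" arbitrary: U Z rule: less_induct)
  case less
  note U = less.prems(1-3) and Z = less.prems(4-6)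
  let ?N = "card (cosets_meeting G U L)"
  let ?V = "level p m"
  let ?c = "real (card (rcosets L))"
  define s where "s v = card (cosets_meeting G (vertex_projection m U v) L)" for v
  have oneL: "\<one> \<in> L" using subgroup.one_closed[OF L_subgroup] .
  have N0: "?N \<ge> 1"
    using one_le_card_cosets_meeting[OF U(3) oneL] .
  show ?case
  proof (cases "?N = 1")
    case True
    then obtain C where C: "cosets_meeting G U L = {C}" by (meson card_1_singletonE)
    have "x \<in> U" if x: "x \<in> L" for x
    proof -
      have "U #> x = C" "U #> \<one> = C" using C x oneL unfolding cosets_meeting_def by blast+
      hence "x \<otimes> inv \<one> \<in> U" using rcos_eq_iff[OF U(1) L_carrier[OF x] one_closed] by simp
      thus ?thesis using L_carrier[OF x] by simp
    qed
    hence "U = L" using U(2) by blast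
    thus ?thesis using card_germ_separated_base[OF Z(1,2)] Z(3) True by (simp add: log_bound_def)
  next
    case False
    hence N2: "?N \<ge> 2" using N0 by simp
    have V: "finite ?V" "card ?V = p ^ m" using card_level by auto
    have Vne: "?V \<noteq> {}" using V p_gt_1 by (metis card.empty power_eq_0_iff not_one_less_zero)
    have s1: "1 \<le> s v" if v: "v \<in> ?V" for v
      unfolding s_def by (rule one_le_card_cosets_meeting[OF finite_vertex_projection_index[OF U(1,3) v] oneL])
    have prod: "(\<Prod>v\<in>?V. s v) \<le> ?N" unfolding s_def by (rule prod_projection_index_le(1)[OF U])
    define J where "J = {v \<in> ?V. s v \<noteq> 1}"
    have dich: "2 * (\<Prod>v\<in>?V. s v) \<le> ?N \<or> (\<Prod>v\<in>?V. s v) \<le> ?N \<and> card J \<noteq> 1"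
    proof (cases "\<exists>y0\<in>L. \<forall>u\<in>U. \<forall>a\<in>branch_stab m. y0 \<noteq> u \<otimes> a")
      case True
      then obtain y0 where y0: "y0 \<in> L" "\<And>u a. u \<in> U \<Longrightarrow> a \<in> branch_stab m \<Longrightarrow> y0 \<noteq> u \<otimes> a" by blast
      show ?thesis unfolding s_def using prod_projection_index_le(2)[OF U y0] by blast
    next
      case False
      have "card J \<noteq> 1"
      proof
        assume "card J = 1"
        then obtain v where J: "J = {v}" by (meson card_1_singletonE)
        hence v: "v \<in> ?V" "s v \<noteq> 1" by (auto simp: J_def)
        obtain l where l: "l \<in> L" "l v \<noteq> v" using m v(1) by blast
        obtain u a where ua: "u \<in> U" "a \<in> branch_stab m" "l = u \<otimes> a" using False l(1) by blast
        have uG: "u \<in> carrier G" using subgroup.mem_carrier[OF U(1) ua(1)] .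
        have "l v = u v"
          using mult_apply[OF uG branch_stabD(1)[OF ua(2) v(1)] level_tree[OF v(1)]]
            branch_stabD(2)[OF ua(2) v(1)] ua(3) by simp
        hence uv: "u v \<noteq> v" "u v \<in> ?V" using l(2) inv_apply_in_level(2)[OF uG v(1)] by auto
        hence "u v \<notin> J" using J by blast
        hence "s (u v) = 1" using uv(2) by (simp add: J_def)
        hence "vertex_projection m U (u v) = L"
          using card_vertex_projection_eq_1[OF U(1) uv(2)] by (simp add: s_def)
        hence "vertex_projection m U v = L" by (rule vertex_projection_conj[OF U(1) ua(1) v(1)])
        hence "s v = 1" using card_vertex_projection_eq_1[OF U(1) v(1)] by (simp add: s_def)
        thus False using v(2) by simp
      qed
      thus ?thesis using prod by blast
    qed
    have less_N: "s v < ?N" if v: "v \<in> ?V" for v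
    proof (cases "s v = 1")
      case True
      thus ?thesis using N2 by simp
    next
      case False
      have rem: "(\<Prod>w\<in>?V. s w) = s v * (\<Prod>w\<in>?V - {v}. s w)" using prod.remove[OF V(1) v] .
      have pos: "1 \<le> (\<Prod>w\<in>?V - {v}. s w)" using s1 by (intro prod_ge_1) auto
      consider "2 * (\<Prod>v\<in>?V. s v) \<le> ?N" | "card J \<noteq> 1" using dich by blast
      thus ?thesis
      proof cases
        case 1
        have "s v \<le> (\<Prod>v\<in>?V. s v)" unfolding rem using pos by simp
        thus ?thesis using 1 s1[OF v] by linarith
      next
        case 2
        have "v \<in> J" using v False by (simp add: J_def)
        moreover have "J \<noteq> {v}" using 2 by auto
        ultimately obtain w where w: "w \<in> ?V" "s w \<noteq> 1" "w \<noteq> v" unfolding J_def by blast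
        have "(\<Prod>w\<in>?V - {v}. s w) = s w * (\<Prod>w\<in>?V - {v} - {w}. s w)"
          using w V(1) by (intro prod.remove) auto
        moreover have "1 \<le> (\<Prod>w\<in>?V - {v} - {w}. s w)" using s1 by (intro prod_ge_1) auto
        moreover have "2 \<le> s w" using s1[OF w(1)] w(2) by simp
        ultimately have "2 * 1 \<le> (\<Prod>w\<in>?V - {v}. s w)" by (metis mult_le_mono)
        hence "s v * 2 \<le> s v * (\<Prod>w\<in>?V - {v}. s w)" by simp
        hence "s v * 2 \<le> ?N" using prod unfolding rem by linarith
        thus ?thesis using s1[OF v] by linarith
      qed
    qed
    let ?o = "replicate m 0"
    let ?Z = "\<lambda>v. {z \<in> Z. z ?o = v}"
    have "Z = (\<Union>v\<in>?V. ?Z v)"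
    proof
      have o: "?o \<in> ?V" using p_gt_1 by (simp add: level_def)
      show "Z \<subseteq> (\<Union>v\<in>?V. ?Z v)" using inv_apply_in_level(2)[OF _ o] Z(2) by blast
    qed blast
    hence "card Z \<le> (\<Sum>v\<in>?V. card (?Z v))" using card_UN_le[OF V(1), of ?Z] by simp
    hence "real (card Z) \<le> (\<Sum>v\<in>?V. real (card (?Z v)))" by (simp flip: of_nat_sum)
    also have "\<dots> \<le> (\<Sum>v\<in>?V. log_bound (real (p ^ m)) ?c (s v))"
    proof (rule sum_mono)
      fix v assume v: "v \<in> ?V"
      let ?s = "\<lambda>z. sec p z ?o"
      note sep = germ_separated_projection[OF U(1) Z(2,3) v]
      have "real (card (?s ` ?Z v)) \<le> log_bound (real (p ^ m)) ?c (card (cosets_meeting G (vertex_projection m U v) L))"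
      proof (rule less.hyps)
        show "card (cosets_meeting G (vertex_projection m U v) L) < ?N" using less_N[OF v] by (simp add: s_def)
        show "subgroup (vertex_projection m U v) G" by (rule vertex_projection_subgroup[OF U(1) v])
        show "vertex_projection m U v \<subseteq> L" by (rule vertex_projection_subset[OF v])
        show "finite (cosets_meeting G (vertex_projection m U v) L)"
          by (rule finite_vertex_projection_index[OF U(1,3) v])
        show "finite (?s ` ?Z v)" using Z(1) by simp
      qed (rule sep)+
      thus "real (card (?Z v)) \<le> log_bound (real (p ^ m)) ?c (s v)" using card_image[OF sep(1)] by (simp add: s_def)
    qed
    also have "\<dots> \<le> log_bound (real (p ^ m)) ?c ?N"
      using sum_log_bound_le[OF V(1) Vne, of s ?c ?N] s1 N2 dich V(2) unfolding J_def by simp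
    finally show ?thesis .
  qed
qed

theorem card_double_cosets_linear:
  "\<exists>C. \<forall>n\<ge>1. \<forall>U\<in>bounded_index G (p ^ n). real (card (double_cosets G U (\<Union>k. cone_fix k))) \<le> C * real n"
proof -
  obtain m where m: "\<forall>v\<in>level p m. \<exists>l\<in>L. l v \<noteq> v" using L_moves_level by blast
  let ?Q = "\<Union>k. cone_fix k"
  define c where "c = real (card (rcosets L))"
  define q where "q = real (p ^ m)"
  have cq: "c \<ge> 0" "q \<ge> 0" by (auto simp: c_def q_def)
  have "real (card (double_cosets G U ?Q)) \<le> (2 * q * c * log 2 p + c) * real n"
    if n: "n \<ge> 1" and U: "U \<in> bounded_index G (p ^ n)" for n U
  proof -
    have UG: "subgroup U G" "finite (rcosets U)" "card (rcosets U) \<le> p ^ n" using U by (auto simp: bounded_index_def)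
    have UL: "subgroup (U \<inter> L) G" by (rule subgroups_Inter_pair[OF UG(1) L_subgroup])
    have LG: "L \<subseteq> carrier G" using L_carrier by blast
    let ?N = "card (cosets_meeting G (U \<inter> L) L)"
    have im: "(\<lambda>x. U #> x) ` L \<subseteq> rcosets U"
      unfolding rcosets_eq_cosets_meeting cosets_meeting_def using LG by blast
    have eq: "x \<otimes> inv y \<in> U \<inter> L" if "x \<in> L" "y \<in> L" "U #> x = U #> y" for x y
    proof -
      have "x \<otimes> inv y \<in> U" using rcos_eq_iff[OF UG(1) L_carrier[OF that(1)] L_carrier[OF that(2)]] that(3) by simp
      thus ?thesis using subgroup.m_closed[OF L_subgroup that(1) subgroup.m_inv_closed[OF L_subgroup that(2)]] by blast
    qed
    have idx1: "finite (cosets_meeting G (U \<inter> L) L)"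
      by (rule card_cosets_meeting_le(1)[OF UL LG UG(2) im eq])
    have idx2: "?N \<le> card (rcosets U)" by (rule card_cosets_meeting_le(2)[OF UL LG UG(2) im eq])
    have "double_cosets G U ?Q \<subseteq> double_coset G U ?Q ` carrier G" by (simp add: double_cosets_def)
    then obtain Z where Z: "Z \<subseteq> carrier G" "inj_on (double_coset G U ?Q) Z"
      "double_coset G U ?Q ` Z = double_cosets G U ?Q"
      unfolding subset_image_inj by metis
    have finZ: "finite Z"
    proof -
      have Qs: "subgroup ?Q G" by (rule subgroup_cone_fix_Union)
      have "finite (double_cosets G U ?Q)" by (rule card_double_cosets_le_index(1)[OF UG(1) Qs UG(2)])
      thus ?thesis using Z(2,3) by (metis finite_imageD)
    qed
    have "germ_separated (U \<inter> L) Z"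
      unfolding germ_separated_def
    proof (intro ballI impI)
      fix z z' u assume z: "z \<in> Z" "z' \<in> Z" and u: "u \<in> U \<inter> L" and germ: "same_germ (u \<otimes> z) z'"
      have G: "z \<in> carrier G" "z' \<in> carrier G" "u \<in> carrier G" using z u Z(1) L_carrier by auto
      obtain k where k: "\<And>w. w \<in> tree p \<Longrightarrow> (u \<otimes> z) (replicate k 0 @ w) = z' (replicate k 0 @ w)"
        using germ unfolding same_germ_def by blast
      define h where "h = inv (u \<otimes> z) \<otimes> z'"
      have hG: "h \<in> carrier G" unfolding h_def using G by simp
      have "h (replicate k 0 @ w) = replicate k 0 @ w" if w: "w \<in> tree p" for w
      proof -
        have t: "replicate k 0 @ w \<in> tree p" using w p_gt_1 by simp
        have uz: "u \<otimes> z \<in> carrier G" using G by simp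
        have "h (replicate k 0 @ w) = (inv (u \<otimes> z)) (z' (replicate k 0 @ w))"
          unfolding h_def by (rule mult_apply[OF inv_closed[OF uz] G(2) t])
        also have "\<dots> = replicate k 0 @ w" unfolding k[OF w, symmetric] by (rule inv_apply(1)[OF uz t])
        finally show ?thesis .
      qed
      hence "h \<in> ?Q" using hG by (auto simp: cone_fix_def)
      moreover have "z' = u \<otimes> z \<otimes> h" unfolding h_def using G by (simp add: inv_mult_cancel)
      ultimately have "z' \<in> double_coset G U ?Q z" unfolding double_coset_def using u by blast
      hence "double_coset G U ?Q z' = double_coset G U ?Q z"
        by (rule double_coset_eqI[OF UG(1) subgroup_cone_fix_Union G(1)])
      thus "z = z'" using inj_onD[OF Z(2) _ z(1,2)] by simp
    qed
    hence "real (card Z) \<le> log_bound q c ?N"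
      unfolding q_def c_def by (rule card_germ_separated_le[OF m UL Int_lower2 idx1 finZ Z(1)])
    also have "\<dots> \<le> 2 * q * c * log 2 ?N + c"
    proof (cases "?N = 1")
      case False
      have "0 \<le> q * c" using cq by simp
      thus ?thesis using False cq(1) by (simp add: log_bound_def)
    qed (simp add: log_bound_def)
    also have "\<dots> \<le> 2 * q * c * (n * log 2 p) + c"
    proof -
      have N1: "1 \<le> ?N" by (rule one_le_card_cosets_meeting[OF idx1 subgroup.one_closed[OF L_subgroup]])
      have Np: "?N \<le> p ^ n" using idx2 UG(3) by simp
      have "real ?N \<le> real p ^ n" using Np by (metis of_nat_le_iff of_nat_power)
      hence "log 2 ?N \<le> log 2 (real p ^ n)" using N1 p_gt_1 by (subst log_le_cancel_iff) auto
      also have "\<dots> = n * log 2 p" using p_gt_1 by (simp add: log_nat_power)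
      finally have "2 * q * c * log 2 ?N \<le> 2 * q * c * (n * log 2 p)" using cq by (intro mult_left_mono) auto
      thus ?thesis by simp
    qed
    also have "\<dots> \<le> 2 * q * c * (n * log 2 p) + c * n" using n cq by (simp add: mult_le_cancel_left1)
    also have "\<dots> = (2 * q * c * log 2 p + c) * real n" by (simp add: algebra_simps)
    finally show ?thesis using card_image[OF Z(2)] Z(3) by simp
  qed
  thus ?thesis by blast
qed

end

section \<open>Actions with prescribed orbit growth\<close>

context regular_branch_group
begin

theorem exists_action_with_orbit_growth:
  fixes f :: "nat \<Rightarrow> nat"
  assumes lower: "filterlim (\<lambda>n. real (f n) / real n) at_top sequentially"
    and upper: "(\<lambda>n. real (f n) / real (p ^ n)) \<longlonglongrightarrow> 0"
  shows "\<exists>(\<Omega> :: (nat list \<Rightarrow> nat list) set set) \<phi>.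
    transitive_action G \<Omega> \<phi> \<and>
    (\<forall>\<^sub>F n in sequentially. max_orbits (p ^ n) G \<Omega> \<phi> \<le> f n) \<and>
    (\<exists>\<^sub>\<infinity>n. real (max_orbits (p ^ n) G \<Omega> \<phi>) \<ge> 1 / real p * real (f n))"
proof -
  obtain C where C: "\<And>n U. n \<ge> 1 \<Longrightarrow> U \<in> bounded_index G (p ^ n) \<Longrightarrow>
      real (card (double_cosets G U (\<Union>k. cone_fix k))) \<le> C * real n"
    using card_double_cosets_linear by blast
  have "\<forall>\<^sub>F n in sequentially. C \<le> real (f n) / real n"
    using lower by (simp add: filterlim_at_top)
  then obtain n1 where n1: "\<And>n. n \<ge> n1 \<Longrightarrow> C \<le> real (f n) / real n"
    by (auto simp: eventually_sequentially)
  \<comment> \<open>The linear bound starts at \<open>n = 1\<close>, as \<open>C * 0 = 0\<close> is too small for \<open>n = 0\<close>.\<close>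
  define n0 where "n0 = max 1 n1"
  have slow_union: "card (double_cosets G U (\<Union>k. cone_fix k)) \<le> f n"
    if n: "n0 \<le> n" and U: "U \<in> bounded_index G (p ^ n)" for n U
  proof -
    have n': "n \<ge> 1" "n \<ge> n1" using n by (auto simp: n0_def)
    have "C * real n \<le> real (f n)" using n1[OF n'(2)] n'(1) by (simp add: pos_le_divide_eq)
    thus ?thesis using C[OF n'(1) U] by linarith
  qed
  have large: "\<exists>n\<ge>n0. \<exists>U\<in>bounded_index G (p ^ n). (\<exists>i. level_stab i \<subseteq> U) \<and>
      f n < card (double_cosets G U (cone_fix k))" for k
  proof -
    have "\<forall>\<^sub>F n in sequentially. real (f n) / real (p ^ n) < 1 / real (p ^ k)"
      using order_tendstoD(2)[OF upper, of "1 / real (p ^ k)"] p_gt_1 by simp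
    then obtain n2 where n2: "\<And>n. n \<ge> n2 \<Longrightarrow> real (f n) / real (p ^ n) < 1 / real (p ^ k)"
      by (auto simp: eventually_sequentially)
    define n where "n = max n0 (max n2 k)"
    have n: "n \<ge> n0" "n \<ge> n2" "k \<le> n" by (auto simp: n_def)
    define v where "v = replicate n (0::nat)"
    have v: "v \<in> level p n" using p_gt_1 by (simp add: v_def level_def)
    have "real (f n) * real (p ^ k) < real (p ^ n)"
      using n2[OF n(2)] p_gt_1 by (simp add: divide_simps)
    hence "f n * p ^ k < p ^ n" by (metis of_nat_less_iff of_nat_mult)
    also have "p ^ n = p ^ (n - k) * p ^ k" using n(3) by (simp flip: power_add)
    finally have "f n < p ^ (n - k)" by simp
    also have "\<dots> \<le> card (double_cosets G (vertex_stab v) (cone_fix k))"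
      by (rule card_double_cosets_cone_fix[OF level_transitive v n(3)])
    finally show ?thesis
      using n(1) vertex_stab_bounded_index[OF v] level_stab_subset_vertex_stab[OF v] by blast
  qed
  obtain S where S: "finite S" "S \<subseteq> carrier G" "carrier G = generate G S" using finitely_generated by blast
  interpret growth_data G p f n0 level_stab cone_fix
  proof (rule growth_data.intro[OF is_group growth_data_axioms.intro])
    show "Factorial_Ring.prime p" by (rule prime_p)
    show "finite (bounded_index G n)" for n by (rule finite_bounded_index[OF S])
    show "level_stab i \<lhd> G" for i by (rule level_stab_normal)
    show "\<exists>e. card (rcosets (level_stab i)) = p ^ e" for i by (rule level_stab_index)
    show "subgroup (cone_fix k) G" for k by (rule cone_fix_subgroup)
    show "cone_fix k \<subseteq> cone_fix l" if "k \<le> l" for k l by (rule cone_fix_mono[OF that])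
    show "\<exists>n\<ge>n0. \<exists>U\<in>bounded_index G (p ^ n). (\<exists>i. level_stab i \<subseteq> U) \<and>
      f n < card (double_cosets G U (cone_fix k))" for k by (rule large)
  qed
  have "slow (\<Union>k. cone_fix k)" unfolding slow_def using slow_union by blast
  from prescribed_growth[OF this] obtain H where H: "subgroup H G" "slow H"
    "\<forall>m. \<exists>n>m. \<exists>U\<in>bounded_index G (p ^ n). f n \<le> p * card (double_cosets G U H)"
    by (elim exE conjE)
  let ?\<Omega> = "left_cosets G H" and ?\<phi> = "left_translation G H"
  have act: "transitive_action G ?\<Omega> ?\<phi>" by (rule transitive_action_left_cosets[OF H(1)])
  define D where "D n = {card (orbits (G\<lparr>carrier := U\<rparr>) ?\<Omega> ?\<phi>) | U.
     subgroup U G \<and> finite (rcosets U) \<and> card (rcosets U) \<le> p ^ n}" for n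
  have D: "D n = (\<lambda>U. card (double_cosets G U H)) ` bounded_index G (p ^ n)" for n
  proof -
    have "D n = (\<lambda>U. card (orbits (G\<lparr>carrier := U\<rparr>) ?\<Omega> ?\<phi>)) ` bounded_index G (p ^ n)"
      by (auto simp: D_def bounded_index_def)
    also have "\<dots> = (\<lambda>U. card (double_cosets G U H)) ` bounded_index G (p ^ n)"
      by (rule image_cong[OF refl card_orbits_left_cosets[OF bounded_indexD(1) H(1)]])
    finally show ?thesis .
  qed
  have max: "max_orbits (p ^ n) G ?\<Omega> ?\<phi> = Max (D n)" for n
    by (simp add: max_orbits_def D_def)
  have finD: "finite (D n)" "D n \<noteq> {}" for n
    unfolding D_def using max_orbits_set[OF act, of "p ^ n"] p_gt_1 by simp_all
  have "max_orbits (p ^ n) G ?\<Omega> ?\<phi> \<le> f n" if "n \<ge> n0" for n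
    unfolding max using finD[of n] H(2) that by (auto simp: D slow_def)
  hence "\<forall>\<^sub>F n in sequentially. max_orbits (p ^ n) G ?\<Omega> ?\<phi> \<le> f n"
    by (auto simp: eventually_sequentially)
  moreover have "\<exists>\<^sub>\<infinity>n. real (max_orbits (p ^ n) G ?\<Omega> ?\<phi>) \<ge> 1 / real p * real (f n)"
    unfolding INFM_nat
  proof
    fix m
    obtain n U where n: "n > m" "U \<in> bounded_index G (p ^ n)" "f n \<le> p * card (double_cosets G U H)"
      using H(3) by blast
    have "card (double_cosets G U H) \<le> Max (D n)" using finD(1) n(2) by (intro Max_ge) (auto simp: D)
    hence "f n \<le> p * Max (D n)" using n(3) by (meson le_trans mult_le_mono2)
    hence "real (f n) \<le> real p * real (Max (D n))" by (metis of_nat_le_iff of_nat_mult)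
    hence "1 / real p * real (f n) \<le> real (max_orbits (p ^ n) G ?\<Omega> ?\<phi>)"
      using p_gt_1 unfolding max by (simp add: divide_simps mult.commute)
    thus "\<exists>n>m. 1 / real p * real (f n) \<le> real (max_orbits (p ^ n) G ?\<Omega> ?\<phi>)" using n(1) by blast
  qed
  ultimately show ?thesis using act by blast
qed

end

section \<open>Self-similar groups that branch over a normal closure\<close>

definition normal_closure :: "('a, 'b) monoid_scheme \<Rightarrow> 'a \<Rightarrow> 'a set" where
  "normal_closure G t = generate G {g \<otimes>\<^bsub>G\<^esub> t \<otimes>\<^bsub>G\<^esub> inv\<^bsub>G\<^esub> g | g. g \<in> carrier G}"

lemma (in group) normal_closure_normal:
  assumes "t \<in> carrier G"
  shows "normal_closure G t \<lhd> G"
  unfolding normal_closure_def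
proof (rule normal_generateI)
  show "{g \<otimes> t \<otimes> inv g | g. g \<in> carrier G} \<subseteq> carrier G" using assms by auto
  fix h g assume h: "h \<in> {g \<otimes> t \<otimes> inv g | g. g \<in> carrier G}" and g: "g \<in> carrier G"
  then obtain k where k: "k \<in> carrier G" "h = k \<otimes> t \<otimes> inv k" by blast
  have "g \<otimes> h \<otimes> inv g = (g \<otimes> k) \<otimes> t \<otimes> inv (g \<otimes> k)"
    unfolding k(2) using g k(1) assms by (simp add: m_assoc inv_mult_group)
  thus "g \<otimes> h \<otimes> inv g \<in> {g \<otimes> t \<otimes> inv g | g. g \<in> carrier G}" using g k(1) by blast
qed

lemma (in group) mem_normal_closure:
  assumes "t \<in> carrier G"
  shows "t \<in> normal_closure G t"
proof -
  have "t = \<one> \<otimes> t \<otimes> inv \<one>" using assms by simp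
  hence "t \<in> {g \<otimes> t \<otimes> inv g | g. g \<in> carrier G}" by blast
  thus ?thesis unfolding normal_closure_def by (rule generate.incl)
qed

text \<open>
  Right multiplication by a generator permutes the finite set \<open>F\<close>, hence so does multiplication by its inverse.
\<close>

lemma (in group) finite_if_closed_under_generators:
  assumes S: "S \<subseteq> carrier G" "carrier G = generate G S"
    and F: "finite F" "F \<subseteq> carrier G" "\<one> \<in> F" "\<And>x s. x \<in> F \<Longrightarrow> s \<in> S \<Longrightarrow> x \<otimes> s \<in> F"
  shows "finite (carrier G)"
proof -
  have inv: "x \<otimes> inv s \<in> F" if x: "x \<in> F" and s: "s \<in> S" for x s
  proof -
    have sG: "s \<in> carrier G" using s S(1) by blast
    have "inj_on (\<lambda>x. x \<otimes> s) F" using F(2) sG by (intro inj_onI) (metis r_cancel subsetD)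
    moreover have "(\<lambda>x. x \<otimes> s) ` F \<subseteq> F" using F(4)[OF _ s] by blast
    ultimately have "(\<lambda>x. x \<otimes> s) ` F = F" using endo_inj_surj[OF F(1)] by blast
    then obtain y where y: "y \<in> F" "x = y \<otimes> s" using x by blast
    thus ?thesis using F(2) sG by (simp add: m_assoc subsetD)
  qed
  have "x \<otimes> g \<in> F" if "g \<in> generate G S" "x \<in> F" for g x
    using that
  proof (induction g arbitrary: x rule: generate.induct)
    case (eng h1 h2)
    have "h1 \<in> carrier G" "h2 \<in> carrier G" "x \<in> carrier G" using eng.hyps eng.prems S(2) F(2) by auto
    thus ?case using eng.IH(2)[OF eng.IH(1)[OF eng.prems]] by (simp add: m_assoc)
  qed (use F inv in auto)
  from this[OF _ F(3)] have "carrier G \<subseteq> F" using S by force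
  thus ?thesis using F(1) finite_subset by blast
qed

context rotation_tree_group
begin

lemma conj_graft:
  assumes h: "h \<in> carrier G" "sec p h v \<in> carrier G" and v: "v \<in> tree p"
    and x: "x \<in> carrier G" "graft p v x \<in> carrier G"
  shows "h \<otimes> graft p v x \<otimes> inv h = graft p (h v) (sec p h v \<otimes> x \<otimes> inv (sec p h v))"
proof (rule extensionalityI[of _ "tree p"])
  let ?s = "sec p h v"
  show "h \<otimes> graft p v x \<otimes> inv h \<in> extensional (tree p)" using h x by (intro extensional) simp
  show "graft p (h v) (?s \<otimes> x \<otimes> inv ?s) \<in> extensional (tree p)" by (simp add: graft_def)
  fix w assume w: "w \<in> tree p"
  define u where "u = (inv h) w"
  have u: "u \<in> tree p" "h u = w"
    using apply_in_tree[of "inv h" w] inv_apply(2)[OF h(1) w] h(1) w by (auto simp: u_def)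
  have hv: "h v \<in> tree p" "length (h v) = length v" using apply_level[OF h(1) v] by auto
  have gu: "graft p v x u \<in> tree p" by (rule apply_in_tree[OF x(2) u(1)])
  have lhs: "(h \<otimes> graft p v x \<otimes> inv h) w = h (graft p v x u)"
    using mult_apply[of "h \<otimes> graft p v x" "inv h" w] mult_apply[OF h(1) x(2) u(1)] h(1) x(2) w by (simp add: u_def)
  show "(h \<otimes> graft p v x \<otimes> inv h) w = graft p (h v) (?s \<otimes> x \<otimes> inv ?s) w"
  proof (cases "take (length v) u = v")
    case True
    define u' where "u' = drop (length v) u"
    have u': "u = v @ u'" "u' \<in> tree p" using True u(1) tree_drop by (auto simp: u'_def) (metis append_take_drop_id)
    have su: "?s u' \<in> tree p" by (rule apply_in_tree[OF h(2) u'(2)])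
    have w': "w = h v @ ?s u'" using apply_append_sec[OF h(1) v u'(2)] u(2) u'(1) by simp
    have xu: "x u' \<in> tree p" by (rule apply_in_tree[OF x(1) u'(2)])
    have "graft p v x u = v @ x u'" using u(1) True by (simp add: graft_def u'_def)
    hence "h (graft p v x u) = h v @ ?s (x u')" using apply_append_sec[OF h(1) v xu] by simp
    also have "?s (x u') = (?s \<otimes> x \<otimes> inv ?s) (?s u')"
      using mult_apply[of "?s \<otimes> x" "inv ?s" "?s u'"] mult_apply[OF h(2) x(1) u'(2)] inv_apply(1)[OF h(2) u'(2)] h(2) x(1) su by simp
    also have "h v @ \<dots> = graft p (h v) (?s \<otimes> x \<otimes> inv ?s) w"
      using w hv(2) unfolding w' by (simp add: graft_def)
    finally show ?thesis unfolding lhs .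
  next
    case False
    hence gu: "graft p v x u = u" using u(1) by (simp add: graft_def)
    have "take (length (h v)) w \<noteq> h v"
    proof
      assume "take (length (h v)) w = h v"
      then obtain w' where w': "w = h v @ w'" by (metis append_take_drop_id)
      have "w' \<in> tree p" using w w' by simp
      hence "u = (inv h) (h v) @ sec p (inv h) (h v) w'"
        unfolding u_def w' using apply_append_sec[OF inv_closed[OF h(1)] hv(1)] by blast
      hence "take (length v) u = v" using inv_apply(1)[OF h(1) v] by simp
      thus False using False by blast
    qed
    thus ?thesis unfolding lhs gu u(2) using w by (simp add: graft_def)
  qed
qed

lemma graft_mult:
  assumes "x \<in> carrier G" "y \<in> carrier G" "graft p v x \<in> carrier G" "graft p v y \<in> carrier G" "v \<in> tree p"
  shows "graft p v (x \<otimes> y) = graft p v x \<otimes> graft p v y"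
proof (rule extensionalityI[of _ "tree p"])
  show "graft p v (x \<otimes> y) \<in> extensional (tree p)" by (simp add: graft_def)
  show "graft p v x \<otimes> graft p v y \<in> extensional (tree p)" using assms by (intro extensional) simp
  fix w assume w: "w \<in> tree p"
  have eq: "(graft p v x \<otimes> graft p v y) w = graft p v x (graft p v y w)" by (rule mult_apply[OF assms(3,4) w])
  have gy: "graft p v y w \<in> tree p" by (rule apply_in_tree[OF assms(4) w])
  show "graft p v (x \<otimes> y) w = (graft p v x \<otimes> graft p v y) w"
    unfolding eq using w gy mult_apply[OF assms(1,2) tree_drop[OF w]] by (auto simp: graft_def)
qed

lemma graft_one: "v \<in> tree p \<Longrightarrow> graft p v \<one> = \<one>"
proof (rule extensionalityI[of _ "tree p"])
  fix w assume "w \<in> tree p"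
  thus "graft p v \<one> w = \<one> w"
    using one_apply tree_drop[of w p] by (simp add: graft_def) (metis append_take_drop_id)
qed (auto simp: graft_def intro: extensional)

lemma graft_inv:
  assumes "x \<in> carrier G" "graft p v x \<in> carrier G" "v \<in> tree p"
  shows "graft p v (inv x) = inv (graft p v x)"
proof (rule extensionalityI[of _ "tree p"])
  show "graft p v (inv x) \<in> extensional (tree p)" by (simp add: graft_def)
  show "inv (graft p v x) \<in> extensional (tree p)" using assms by (intro extensional) simp
  fix w assume w: "w \<in> tree p"
  have d: "drop (length v) w \<in> tree p" by (rule tree_drop[OF w])
  have i: "(inv x) (drop (length v) w) \<in> tree p" using apply_in_tree[OF inv_closed[OF assms(1)] d] .
  have t: "graft p v (inv x) w \<in> tree p" using w i assms(3) by (simp add: graft_def)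
  have "graft p v x (graft p v (inv x) w) = w"
  proof (cases "take (length v) w = v")
    case True
    have "graft p v (inv x) w = v @ (inv x) (drop (length v) w)" using True w by (simp add: graft_def)
    hence "graft p v x (graft p v (inv x) w) = v @ x ((inv x) (drop (length v) w))"
      using assms(3) i by (simp add: graft_def)
    also have "\<dots> = w" using inv_apply(2)[OF assms(1) d] True by (metis append_take_drop_id)
    finally show ?thesis .
  next
    case False
    thus ?thesis using w by (simp add: graft_def)
  qed
  thus "graft p v (inv x) w = (inv (graft p v x)) w" using inv_apply(1)[OF assms(2) t] by simp
qed

end

text \<open>
  The conditions on sections are imposed on generators only. By \<open>fractal_generator\<close> the
  sections at \<open>[0]\<close> of the elements that fix \<open>[0]\<close> include the generators, and therefore all of \<open>G\<close>.
\<close>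

locale self_similar_group = rotation_tree_group +
  fixes S :: "(nat list \<Rightarrow> nat list) set"
  assumes S_finite: "finite S" and S_carrier: "S \<subseteq> carrier G" and S_generate: "carrier G = generate G S"
    and sec_generator: "s \<in> S \<Longrightarrow> i < p \<Longrightarrow> sec p s [i] \<in> carrier G"
    and fractal_generator: "s \<in> S \<Longrightarrow> \<exists>h\<in>carrier G. h [0] = [0] \<and> sec p h [0] = s"
    and rot_carrier: "rot p \<in> carrier G"
begin

lemma p_pos: "0 < p" using p_gt_1 by simp

lemma sec_letter_closed:
  assumes "g \<in> carrier G" "i < p"
  shows "sec p g [i] \<in> carrier G"
proof -
  have "\<forall>i<p. sec p g [i] \<in> carrier G" if "g \<in> generate G S" for g
    using that
  proof (induction g rule: generate.induct)
    case one
    thus ?case using sec_one by simp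
  next
    case (incl h)
    thus ?case using sec_generator by blast
  next
    case (inv h)
    show ?case
    proof (intro allI impI)
      fix i assume i: "i < p"
      have hG: "h \<in> carrier G" using inv S_carrier by blast
      have "(inv h) [i] \<in> level p 1" using inv_apply_in_level(1)[OF hG, of "[i]" 1] i by (simp add: level_def)
      then obtain j where "(inv h) [i] = [j]" "j < p" by (auto simp: level_def length_Suc_conv)
      thus "sec p (inv h) [i] \<in> carrier G" using sec_inv[OF hG, of "[i]"] sec_generator[OF inv] i by simp
    qed
  next
    case (eng h1 h2)
    have G: "h1 \<in> carrier G" "h2 \<in> carrier G" using eng.hyps S_generate by auto
    show ?case
    proof (intro allI impI)
      fix i assume i: "i < p"
      have "h2 [i] \<in> level p 1" using inv_apply_in_level(2)[OF G(2), of "[i]" 1] i by (simp add: level_def)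
      then obtain j where "h2 [i] = [j]" "j < p" by (auto simp: level_def length_Suc_conv)
      thus "sec p (h1 \<otimes> h2) [i] \<in> carrier G" using sec_mult[OF G, of "[i]"] eng.IH i by simp
    qed
  qed
  thus ?thesis using assms S_generate by blast
qed

lemma sec_word_closed:
  assumes "g \<in> carrier G" "v \<in> tree p"
  shows "sec p g v \<in> carrier G"
  using assms
proof (induction v arbitrary: g)
  case Nil
  have "sec p g [] = g"
    by (rule extensionalityI[OF _ extensional[OF Nil(1)]]) (auto simp: sec_def)
  thus ?case using Nil by simp
next
  case (Cons i v)
  have iv: "i < p" "v \<in> tree p" "[i] \<in> tree p" using Cons.prems by auto
  have "sec p g (i # v) = sec p (sec p g [i]) v"
  proof (rule extensionalityI[of _ "tree p"])
    fix w assume w: "w \<in> tree p"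
    show "sec p g (i # v) w = sec p (sec p g [i]) v w"
      using w iv by (simp add: sec_def)
  qed (auto simp: sec_def)
  thus ?case using Cons.IH[OF sec_letter_closed[OF Cons.prems(1) iv(1)] iv(2)] by simp
qed

lemma fractal:
  assumes "g \<in> carrier G"
  shows "\<exists>h\<in>carrier G. h [0] = [0] \<and> sec p h [0] = g"
proof -
  have z: "[0] \<in> tree p" using p_pos by simp
  have "\<exists>h\<in>carrier G. h [0] = [0] \<and> sec p h [0] = g" if "g \<in> generate G S" for g
    using that
  proof (induction g rule: generate.induct)
    case one
    show ?case using one_apply[OF z] sec_one[OF z] by blast
  next
    case (incl h)
    thus ?case by (rule fractal_generator)
  next
    case (inv s)
    obtain h where h: "h \<in> carrier G" "h [0] = [0]" "sec p h [0] = s" using fractal_generator[OF inv] by blast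
    have "(inv h) [0] = [0]" using inv_apply(1)[OF h(1) z] h(2) by simp
    moreover have "s \<in> carrier G" using inv S_carrier by blast
    ultimately have "sec p (inv h) [0] = inv s" using sec_inv[OF h(1) z] h(3) by simp
    thus ?case using h(1) \<open>(inv h) [0] = [0]\<close> by blast
  next
    case (eng g1 g2)
    have G: "g1 \<in> carrier G" "g2 \<in> carrier G" using eng.hyps S_generate by auto
    obtain h1 h2 where h: "h1 \<in> carrier G" "h1 [0] = [0]" "sec p h1 [0] = g1"
      "h2 \<in> carrier G" "h2 [0] = [0]" "sec p h2 [0] = g2" using eng.IH by blast
    have "sec p (h1 \<otimes> h2) [0] = g1 \<otimes> g2" using sec_mult[OF h(1,4) z] h G by simp
    moreover have "(h1 \<otimes> h2) [0] = [0]" using mult_apply[OF h(1,4) z] h by simp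
    ultimately show ?case using h(1,4) by blast
  qed
  thus ?thesis using assms S_generate by blast
qed

lemma rot_pow_apply:
  assumes "j < p" "w \<in> tree p"
  shows "(rot p [^] k) (j # w) = ((j + k) mod p) # w"
proof (induction k)
  case 0
  show ?case using one_apply[of "j # w"] assms by simp
next
  case (Suc k)
  have "(rot p [^] Suc k) (j # w) = rot p ((rot p [^] k) (j # w))"
    unfolding nat_pow_Suc2[OF rot_carrier] using assms by (intro mult_apply[OF rot_carrier]) (auto simp: rot_carrier)
  also have "\<dots> = ((j + Suc k) mod p) # w"
    unfolding Suc.IH using assms p_pos by (simp add: rot_def mod_Suc_eq)
  finally show ?case .
qed

lemma sec_rot_pow: "j < p \<Longrightarrow> sec p (rot p [^] (k :: nat)) [j] = \<one>"
  using rot_pow_apply[of j _ k] one_apply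
  by (intro extensionalityI[OF _ extensional[OF one_closed]]) (auto simp: sec_def)

text \<open>
  Level by level, the first letter is moved to \<open>0\<close> by a rotation, and the rest by an element that fixes \<open>[0]\<close> and
  has the section supplied by the induction.
\<close>

lemma level_transitive_to_zero: "u \<in> level p n \<Longrightarrow> \<exists>g\<in>carrier G. g u = replicate n 0"
proof (induction n arbitrary: u)
  case 0
  thus ?case using one_apply[of "[]"] by (intro bexI[of _ \<one>]) (auto simp: level_def)
next
  case (Suc n)
  then obtain i u' where u: "u = i # u'" "i < p" "u' \<in> level p n" by (auto simp: level_def length_Suc_conv)
  have ut: "u' \<in> tree p" using u(3) by (simp add: level_def)
  obtain g where g: "g \<in> carrier G" "g u' = replicate n 0" using Suc.IH[OF u(3)] by blast
  obtain h where h: "h \<in> carrier G" "h [0] = [0]" "sec p h [0] = g" using fractal[OF g(1)] by blast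
  have a: "rot p [^] (p - i) \<in> carrier G" using rot_carrier by simp
  have "(rot p [^] (p - i)) (i # u') = 0 # u'" using rot_pow_apply[OF u(2) ut, of "p - i"] u(2) by simp
  hence "(h \<otimes> rot p [^] (p - i)) u = h ([0] @ u')"
    using mult_apply[OF h(1) a, of u] u(1,2) ut by simp
  also have "\<dots> = replicate (Suc n) 0"
    using apply_append_sec[OF h(1), of "[0]" u'] h(2,3) g(2) ut p_pos by simp
  finally show ?case using h(1) a by blast
qed

lemma level_transitive_pair:
  assumes "u \<in> level p n" "v \<in> level p n"
  shows "\<exists>g\<in>carrier G. g u = v"
proof -
  obtain g where "g \<in> carrier G" "g u = replicate n 0" using level_transitive_to_zero[OF assms(1)] by blast
  moreover obtain h where "h \<in> carrier G" "h v = replicate n 0" using level_transitive_to_zero[OF assms(2)] by blast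
  ultimately have gh: "g \<in> carrier G" "h \<in> carrier G" "g u = replicate n 0" "h v = replicate n 0" by auto
  have uv: "u \<in> tree p" "v \<in> tree p" using assms by (auto simp: level_def)
  have "(inv h \<otimes> g) u = (inv h) (h v)" using mult_apply[OF inv_closed[OF gh(2)] gh(1) uv(1)] gh(3,4) by simp
  also have "\<dots> = v" by (rule inv_apply(1)[OF gh(2) uv(2)])
  finally show ?thesis using gh(1,2) by blast
qed

end

locale branching_self_similar_group = self_similar_group +
  fixes t :: "nat list \<Rightarrow> nat list"
  assumes t_carrier: "t \<in> carrier G" and t_nontrivial: "\<exists>w\<in>tree p. t w \<noteq> w"
    and t_branch: "graft p [0] t \<in> normal_closure G t"
    and t_index: "finite (rcosets (normal_closure G t))"
begin

text \<open>
  A conjugate of \<open>t\<close> is grafted by conjugating the graft of \<open>t\<close> with an element that has the conjugating element as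
  its section at \<open>[0]\<close>. It is therefore enough that the graft of the single element \<open>t\<close> lies in the normal closure.
\<close>

lemma graft_zero_mem:
  assumes "x \<in> normal_closure G t"
  shows "graft p [0] x \<in> normal_closure G t"
proof -
  let ?L = "normal_closure G t"
  interpret L: normal ?L G by (rule normal_closure_normal[OF t_carrier])
  have z: "[0] \<in> tree p" using p_pos by simp
  have conj: "graft p [0] (g \<otimes> t \<otimes> inv g) \<in> ?L" if g: "g \<in> carrier G" for g
  proof -
    obtain h where h: "h \<in> carrier G" "h [0] = [0]" "sec p h [0] = g" using fractal[OF g] by blast
    have "h \<otimes> graft p [0] t \<otimes> inv h = graft p [0] (g \<otimes> t \<otimes> inv g)"
      using conj_graft[OF h(1) _ z t_carrier L.mem_carrier[OF t_branch]] h g by simp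
    thus ?thesis using L.inv_op_closed2[OF h(1) t_branch] by simp
  qed
  let ?T = "{g \<otimes> t \<otimes> inv g | g. g \<in> carrier G}"
  have TL: "?T \<subseteq> ?L" using L.inv_op_closed2 mem_normal_closure[OF t_carrier] by blast
  have gen: "generate G ?T = ?L" by (simp add: normal_closure_def)
  from assms show ?thesis unfolding gen[symmetric]
  proof (induction x rule: generate.induct)
    case one
    show ?case unfolding gen using graft_one[OF z] by simp
  next
    case (incl h)
    thus ?case unfolding gen using conj by blast
  next
    case (inv h)
    have "graft p [0] h \<in> ?L" "h \<in> ?L" using inv conj TL by blast+
    thus ?case unfolding gen using graft_inv[OF _ _ z, of h] by simp
  next
    case (eng h1 h2)
    thus ?case unfolding gen using graft_mult[OF _ _ _ _ z, of h1 h2] by simp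
  qed
qed

lemma graft_letter_mem:
  assumes "x \<in> normal_closure G t" "i < p"
  shows "graft p [i] x \<in> normal_closure G t"
proof -
  let ?L = "normal_closure G t"
  interpret L: normal ?L G by (rule normal_closure_normal[OF t_carrier])
  have z: "[0] \<in> tree p" using p_pos by simp
  have a: "rot p [^] i \<in> carrier G" using rot_carrier by simp
  have s: "sec p (rot p [^] i) [0] = \<one>" by (rule sec_rot_pow[OF p_pos])
  have x: "x \<in> carrier G" "graft p [0] x \<in> ?L" using assms(1) graft_zero_mem by auto
  have "(rot p [^] i) [0] = [i]" using rot_pow_apply[of 0 "[]" i] p_pos assms(2) by simp
  hence "rot p [^] i \<otimes> graft p [0] x \<otimes> inv (rot p [^] i) = graft p [i] x"
    using conj_graft[OF a _ z x(1) L.mem_carrier[OF x(2)]] s x(1) by simp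
  thus ?thesis using L.inv_op_closed2[OF a x(2)] by simp
qed

sublocale regular_branch_group G p "normal_closure G t"
proof (rule regular_branch_group.intro[OF rotation_tree_group_axioms regular_branch_group_axioms.intro])
  show "\<exists>S. finite S \<and> S \<subseteq> carrier G \<and> carrier G = generate G S"
    using S_finite S_carrier S_generate by blast
  show "\<exists>x\<in>normal_closure G t. \<exists>w\<in>tree p. x w \<noteq> w"
    using mem_normal_closure[OF t_carrier] t_nontrivial by blast
  show "sec p g v \<in> carrier G" if "g \<in> carrier G" "v \<in> tree p" for g v
    using that by (rule sec_word_closed)
  show "\<exists>g\<in>carrier G. g u = v" if "u \<in> level p n" "v \<in> level p n" for u v n
    using that by (rule level_transitive_pair)
  show "normal_closure G t \<lhd> G" by (rule normal_closure_normal[OF t_carrier])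
  show "finite (rcosets (normal_closure G t))" by (rule t_index)
  show "graft p [i] x \<in> normal_closure G t" if "x \<in> normal_closure G t" "i < p" for x i
    using that by (rule graft_letter_mem)
qed

end

section \<open>Decompositions of elements fixing the first level\<close>

context rotation_tree_group
begin

text \<open>
  \<open>x = (\<sigma> 0, ..., \<sigma> (p - 1))\<close> in the notation for automorphisms that fix level 1, with components in the group.
\<close>

definition decomposes :: "(nat list \<Rightarrow> nat list) \<Rightarrow> (nat \<Rightarrow> nat list \<Rightarrow> nat list) \<Rightarrow> bool" where
  "decomposes x \<sigma> \<longleftrightarrow> x \<in> carrier G \<and> (\<forall>i<p. \<sigma> i \<in> carrier G \<and> (\<forall>w\<in>tree p. x (i # w) = i # \<sigma> i w))"

lemma decomposesD:
  assumes "decomposes x \<sigma>"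
  shows "x \<in> carrier G" "i < p \<Longrightarrow> \<sigma> i \<in> carrier G" "i < p \<Longrightarrow> w \<in> tree p \<Longrightarrow> x (i # w) = i # \<sigma> i w"
  using assms by (auto simp: decomposes_def)

lemma decomposes_cong:
  assumes "decomposes x \<sigma>" "\<And>i. i < p \<Longrightarrow> \<sigma> i = \<tau> i"
  shows "decomposes x \<tau>"
  using assms by (simp add: decomposes_def)

lemma decomposes_unique:
  assumes "decomposes x \<sigma>" "decomposes y \<tau>" "\<And>i. i < p \<Longrightarrow> \<sigma> i = \<tau> i"
  shows "x = y"
proof (rule group_elem_eqI)
  show G: "x \<in> carrier G" "y \<in> carrier G" using decomposesD(1) assms by auto
  fix w assume w: "w \<in> tree p"
  show "x w = y w"
  proof (cases w)
    case Nil
    thus ?thesis using Nil_apply[OF G(1)] Nil_apply[OF G(2)] by simp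
  next
    case (Cons i v)
    thus ?thesis using w decomposesD(3)[OF assms(1), of i v] decomposesD(3)[OF assms(2), of i v] assms(3) by simp
  qed
qed

lemma decomposes_one: "decomposes \<one> (\<lambda>_. \<one>)"
  by (simp add: decomposes_def one_apply)

lemma decomposes_mult:
  assumes "decomposes x \<sigma>" "decomposes y \<tau>"
  shows "decomposes (x \<otimes> y) (\<lambda>i. \<sigma> i \<otimes> \<tau> i)"
proof -
  note x = decomposesD[OF assms(1)] and y = decomposesD[OF assms(2)]
  have "(x \<otimes> y) (i # w) = i # (\<sigma> i \<otimes> \<tau> i) w" if i: "i < p" and w: "w \<in> tree p" for i w
  proof -
    have "\<tau> i w \<in> tree p" by (rule apply_in_tree[OF y(2)[OF i] w])
    thus ?thesis
      using mult_apply[OF x(1) y(1), of "i # w"] mult_apply[OF x(2)[OF i] y(2)[OF i] w] x(3) y(3) i w by simp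
  qed
  thus ?thesis using x y by (simp add: decomposes_def)
qed

lemma decomposes_inv:
  assumes "decomposes x \<sigma>"
  shows "decomposes (inv x) (\<lambda>i. inv (\<sigma> i))"
proof -
  note x = decomposesD[OF assms]
  have "(inv x) (i # w) = i # (inv (\<sigma> i)) w" if i: "i < p" and w: "w \<in> tree p" for i w
  proof -
    have t: "(inv (\<sigma> i)) w \<in> tree p" by (rule apply_in_tree[OF inv_closed[OF x(2)[OF i]] w])
    have "x (i # (inv (\<sigma> i)) w) = i # w" using x(3)[OF i t] inv_apply(2)[OF x(2)[OF i] w] by simp
    thus ?thesis using inv_apply(1)[OF x(1), of "i # (inv (\<sigma> i)) w"] i t by simp
  qed
  thus ?thesis using x by (simp add: decomposes_def)
qed

lemma decomposes_pow:
  assumes "decomposes x \<sigma>"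
  shows "decomposes (x [^] (n :: nat)) (\<lambda>i. \<sigma> i [^] n)"
proof (induction n)
  case 0
  show ?case using decomposes_one by simp
next
  case (Suc n)
  show ?case using decomposes_mult[OF Suc.IH assms] by simp
qed

lemma decomposes_conj_rot:
  assumes x: "decomposes x \<sigma>" and a: "rot p \<in> carrier G"
  shows "decomposes (rot p \<otimes> x \<otimes> inv (rot p)) (\<lambda>i. \<sigma> ((i + p - 1) mod p))"
proof -
  note x = decomposesD[OF x]
  have "\<sigma> ((i + p - 1) mod p) \<in> carrier G" for i using x(2)[of "(i + p - 1) mod p"] p_gt_1 by simp
  moreover have "(rot p \<otimes> x \<otimes> inv (rot p)) (i # w) = i # \<sigma> ((i + p - 1) mod p) w"
    if i: "i < p" and w: "w \<in> tree p" for i w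
  proof -
    let ?j = "(i + p - 1) mod p"
    have j: "?j < p" using p_gt_1 by simp
    have ji: "(?j + 1) mod p = i"
    proof -
      have "(?j + 1) mod p = (i + p - 1 + 1) mod p" by (rule mod_add_left_eq)
      also have "i + p - 1 + 1 = i + p" using p_gt_1 by simp
      finally show ?thesis using i by simp
    qed
    have sw: "\<sigma> ?j w \<in> tree p" by (rule apply_in_tree[OF x(2)[OF j] w])
    have "rot p (?j # w) = i # w" using j w ji by (simp add: rot_def)
    hence ia: "(inv (rot p)) (i # w) = ?j # w" using inv_apply(1)[OF a, of "?j # w"] j w by simp
    have "(rot p \<otimes> x \<otimes> inv (rot p)) (i # w) = rot p (x (?j # w))"
      using mult_apply[of "rot p \<otimes> x" "inv (rot p)" "i # w"] mult_apply[OF a x(1), of "?j # w"] a x(1) i j w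
      by (simp add: ia)
    also have "\<dots> = i # \<sigma> ?j w" unfolding x(3)[OF j w] using j sw ji by (simp add: rot_def)
    finally show ?thesis .
  qed
  ultimately show ?thesis using x(1) a by (simp add: decomposes_def)
qed

lemma decomposes_letter_sec:
  assumes "decomposes x \<sigma>" "i < p"
  shows "x [i] = [i]" "sec p x [i] = \<sigma> i"
proof -
  note x = decomposesD[OF assms(1)]
  show "x [i] = [i]" using x(3)[OF assms(2) tree_Nil] Nil_apply[OF x(2)[OF assms(2)]] by simp
  show "sec p x [i] = \<sigma> i"
    by (rule extensionalityI[OF _ extensional[OF x(2)[OF assms(2)]]]) (use x(3)[OF assms(2)] in \<open>auto simp: sec_def\<close>)
qed

lemma decomposes_graft:
  assumes "decomposes x \<sigma>" "i < p" "\<And>j. j < p \<Longrightarrow> j \<noteq> i \<Longrightarrow> \<sigma> j = \<one>"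
  shows "graft p [i] (\<sigma> i) = x"
proof (rule extensionalityI[of _ "tree p"])
  note x = decomposesD[OF assms(1)]
  show "graft p [i] (\<sigma> i) \<in> extensional (tree p)" by (simp add: graft_def)
  show "x \<in> extensional (tree p)" by (rule extensional[OF x(1)])
  fix w assume w: "w \<in> tree p"
  show "graft p [i] (\<sigma> i) w = x w"
  proof (cases w)
    case Nil
    thus ?thesis using Nil_apply[OF x(1)] by (simp add: graft_def)
  next
    case (Cons j v)
    hence j: "j < p" "v \<in> tree p" using w by auto
    show ?thesis
      using x(3)[OF j] assms(3)[OF j(1)] one_apply[OF j(2)] w Cons by (cases "j = i") (auto simp: graft_def)
  qed
qed

lemma sec_rot_letter:
  assumes "rot p \<in> carrier G" "i < p"
  shows "sec p (rot p) [i] = \<one>"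
  by (rule extensionalityI[OF _ extensional[OF one_closed]])
    (use assms one_apply in \<open>auto simp: sec_def rot_def\<close>)

end

section \<open>Subgroups generated by rotational tree automorphisms\<close>

lemma rot_word_rotates:
  assumes "w \<in> tree p"
  shows "\<exists>r. \<forall>x<p. rot_word p (w @ [x]) = rot_word p w @ [(x + r) mod p]"
proof (cases w)
  case Nil
  thus ?thesis by (intro exI[of _ 1]) auto
next
  case (Cons i v)
  thus ?thesis by (intro exI[of _ 0]) auto
qed

lemma rotation_tree_group_subgroup_generated:
  assumes p: "Factorial_Ring.prime p" and S: "S \<subseteq> carrier (tree_aut p)"
    and rotates: "\<And>s w. s \<in> S \<Longrightarrow> w \<in> tree p \<Longrightarrow> \<exists>r. \<forall>x<p. s (w @ [x]) = s w @ [(x + r) mod p]"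
  shows "rotation_tree_group (subgroup_generated (tree_aut p) S) p"
    and "carrier (subgroup_generated (tree_aut p) S) = generate (subgroup_generated (tree_aut p) S) S"
    and "S \<subseteq> carrier (subgroup_generated (tree_aut p) S)"
proof -
  interpret A: group "tree_aut p" by (rule group_tree_aut)
  let ?G = "subgroup_generated (tree_aut p) S"
  have p1: "p > 1" using p prime_gt_1_nat by blast
  have carr: "carrier ?G = generate (tree_aut p) S"
    using S by (simp add: carrier_subgroup_generated Int_absorb1)
  have sub: "subgroup (generate (tree_aut p) S) (tree_aut p)" by (rule A.generate_is_subgroup[OF S])
  have G_def: "?G = (tree_aut p)\<lparr>carrier := generate (tree_aut p) S\<rparr>"
    using S by (simp add: subgroup_generated_def Int_absorb1)
  have carrA: "g \<in> carrier (tree_aut p)" if "g \<in> carrier ?G" for g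
    using that subgroup.mem_carrier[OF sub] carr by auto
  have Bij: "g \<in> Bij (tree p)" if "g \<in> carrier (tree_aut p)" for g
    using that by (simp add: tree_aut_def)
  have in_tree: "g w \<in> tree p" if "g \<in> carrier (tree_aut p)" "w \<in> tree p" for g w
    using funcset_mem[OF Bij_imp_funcset[OF Bij[OF that(1)]] that(2)] .
  have mult: "(g \<otimes>\<^bsub>tree_aut p\<^esub> h) w = g (h w)"
    if "g \<in> carrier (tree_aut p)" "h \<in> carrier (tree_aut p)" "w \<in> tree p" for g h w
  proof -
    have "g \<otimes>\<^bsub>tree_aut p\<^esub> h = compose (tree p) g h"
      using Bij[OF that(1)] Bij[OF that(2)] by (simp add: tree_aut_def BijGroup_def)
    thus ?thesis using that(3) by (simp add: compose_def)
  qed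
  have one_app: "\<one>\<^bsub>tree_aut p\<^esub> w = w" if "w \<in> tree p" for w using that by (simp add: one_tree_aut)
  have rot: "\<forall>w\<in>tree p. \<exists>r. \<forall>x<p. g (w @ [x]) = g w @ [(x + r) mod p]" if "g \<in> generate (tree_aut p) S" for g
    using that
  proof (induction g rule: generate.induct)
    case one
    have "\<one>\<^bsub>tree_aut p\<^esub> (w @ [x]) = \<one>\<^bsub>tree_aut p\<^esub> w @ [(x + 0) mod p]" if "w \<in> tree p" "x < p" for w x
      using one_app[of w] one_app[of "w @ [x]"] that by simp
    thus ?case by blast
  next
    case (incl h)
    thus ?case using rotates by blast
  next
    case (inv h)
    have hA: "h \<in> carrier (tree_aut p)" using inv S by blast
    let ?i = "inv\<^bsub>tree_aut p\<^esub> h"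
    have iA: "?i \<in> carrier (tree_aut p)" using hA by simp
    show ?case
    proof
      fix w assume w: "w \<in> tree p"
      define v where "v = ?i w"
      have v: "v \<in> tree p" unfolding v_def by (rule in_tree[OF iA w])
      have hv: "h v = w" unfolding v_def using mult[OF hA iA w] hA one_app[OF w] by simp
      obtain r where r: "\<forall>x<p. h (v @ [x]) = h v @ [(x + r) mod p]" using rotates[OF inv v] by blast
      have "?i (w @ [y]) = v @ [(y + (p - r mod p)) mod p]" if y: "y < p" for y
      proof -
        define z where "z = (y + (p - r mod p)) mod p"
        have z: "z < p" using p1 by (simp add: z_def)
        have rp: "r mod p < p" using p1 by simp
        have "(z + r) mod p = (y + (p - r mod p) + r mod p) mod p" by (simp add: z_def mod_simps)
        also have "y + (p - r mod p) + r mod p = y + p" using rp by simp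
        finally have zr: "(z + r) mod p = y" using y by simp
        have "h (v @ [z]) = w @ [y]" using r z hv zr by simp
        hence "?i (w @ [y]) = (?i \<otimes>\<^bsub>tree_aut p\<^esub> h) (v @ [z])"
          using mult[OF iA hA, of "v @ [z]"] v z by simp
        also have "\<dots> = v @ [z]" using hA one_app[of "v @ [z]"] v z by simp
        finally show ?thesis by (simp add: z_def)
      qed
      thus "\<exists>r. \<forall>x<p. ?i (w @ [x]) = ?i w @ [(x + r) mod p]" unfolding v_def[symmetric] by blast
    qed
  next
    case (eng h1 h2)
    have hA: "h1 \<in> carrier (tree_aut p)" "h2 \<in> carrier (tree_aut p)"
      using eng.hyps subgroup.mem_carrier[OF sub] by auto
    show ?case
    proof
      fix w assume w: "w \<in> tree p"
      have hw: "h2 w \<in> tree p" by (rule in_tree[OF hA(2) w])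
      obtain r2 where r2: "\<forall>x<p. h2 (w @ [x]) = h2 w @ [(x + r2) mod p]" using eng.IH(2) w by blast
      obtain r1 where r1: "\<forall>x<p. h1 (h2 w @ [x]) = h1 (h2 w) @ [(x + r1) mod p]" using eng.IH(1) hw by blast
      have "(h1 \<otimes>\<^bsub>tree_aut p\<^esub> h2) (w @ [x]) = (h1 \<otimes>\<^bsub>tree_aut p\<^esub> h2) w @ [(x + (r2 + r1)) mod p]" if x: "x < p" for x
      proof -
        have "(h1 \<otimes>\<^bsub>tree_aut p\<^esub> h2) (w @ [x]) = h1 (h2 w @ [(x + r2) mod p])"
          using mult[OF hA, of "w @ [x]"] r2 x w by simp
        also have "\<dots> = h1 (h2 w) @ [((x + r2) mod p + r1) mod p]" using r1 p1 by simp
        finally show ?thesis using mult[OF hA w] by (simp add: mod_simps add.assoc)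
      qed
      thus "\<exists>r. \<forall>x<p. (h1 \<otimes>\<^bsub>tree_aut p\<^esub> h2) (w @ [x]) = (h1 \<otimes>\<^bsub>tree_aut p\<^esub> h2) w @ [(x + r) mod p]" by blast
    qed
  qed
  show "rotation_tree_group ?G p"
  proof (rule rotation_tree_group.intro[OF A.group_subgroup_generated rotation_tree_group_axioms.intro])
    show "Factorial_Ring.prime p" by (rule p)
    show "g \<in> extensional (tree p)" if "g \<in> carrier ?G" for g
      using Bij[OF carrA[OF that]] by (simp add: Bij_def)
    show "(g \<otimes>\<^bsub>?G\<^esub> h) w = g (h w)" if "g \<in> carrier ?G" "h \<in> carrier ?G" "w \<in> tree p" for g h w
      using mult[OF carrA[OF that(1)] carrA[OF that(2)] that(3)] by (simp add: G_def)
    show "\<one>\<^bsub>?G\<^esub> w = w" if "w \<in> tree p" for w using one_app[OF that] by (simp add: G_def)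
    show "g [] = []" if "g \<in> carrier ?G" for g using carrA[OF that] by (simp add: tree_aut_def)
    show "\<exists>r. \<forall>x<p. g (w @ [x]) = g w @ [(x + r) mod p]" if "g \<in> carrier ?G" "w \<in> tree p" for g w
      using rot that carr by blast
  qed
  have incl: "S \<subseteq> generate (tree_aut p) S" by (auto intro: generate.incl)
  thus "S \<subseteq> carrier ?G" using carr by simp
  show "carrier ?G = generate ?G S"
    unfolding carr G_def using A.generate_consistent[OF incl sub] by simp
qed

section \<open>The Grigorchuk group\<close>

lemma rot_word_2_twice: "w \<in> tree 2 \<Longrightarrow> rot_word 2 (rot_word 2 w) = w"
  by (cases w) (auto simp: less_2_cases_iff)

lemma grig_word_relations:
  assumes "w \<in> tree 2"
  shows "grig_b_word (grig_b_word w) = w \<and> grig_c_word (grig_c_word w) = w \<and> grig_d_word (grig_d_word w) = w \<and>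
    grig_b_word (grig_c_word w) = grig_d_word w \<and> grig_c_word (grig_b_word w) = grig_d_word w \<and>
    grig_b_word (grig_d_word w) = grig_c_word w \<and> grig_d_word (grig_b_word w) = grig_c_word w \<and>
    grig_c_word (grig_d_word w) = grig_b_word w \<and> grig_d_word (grig_c_word w) = grig_b_word w"
  using assms by (induction w) (auto simp: rot_word_2_twice)

lemma grig_word_rotates:
  assumes "w \<in> tree 2"
  shows "(\<exists>r. \<forall>x<2. grig_b_word (w @ [x]) = grig_b_word w @ [(x + r) mod 2]) \<and>
    (\<exists>r. \<forall>x<2. grig_c_word (w @ [x]) = grig_c_word w @ [(x + r) mod 2]) \<and>
    (\<exists>r. \<forall>x<2. grig_d_word (w @ [x]) = grig_d_word w @ [(x + r) mod 2])"
  using assms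
proof (induction w)
  case Nil
  have "grig_b_word ([] @ [x]) = grig_b_word [] @ [(x + 0) mod 2]"
    "grig_c_word ([] @ [x]) = grig_c_word [] @ [(x + 0) mod 2]"
    "grig_d_word ([] @ [x]) = grig_d_word [] @ [(x + 0) mod 2]" if "x < 2" for x
    using that by simp_all
  thus ?case by blast
next
  case (Cons i w)
  have w: "w \<in> tree 2" using Cons.prems by simp
  have id: "\<exists>r. \<forall>x<2. w @ [x] = w @ [(x + r) mod 2]" by (intro exI[of _ 0]) simp
  show ?case using Cons.IH[OF w] rot_word_rotates[OF w] id by simp
qed

text \<open>
  \<open>b\<close> commutes with \<open>a\<close> and \<open>d\<close>, and \<open>a\<close>, \<open>d\<close> generate a dihedral group of order at most 8, so the normal forms
  \<open>(a d) ^ i y z\<close> with \<open>y\<close> a power of \<open>a\<close> and \<open>z\<close> a power of \<open>b\<close> exhaust the group.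
\<close>

lemma (in group) finite_quotient_of_grigorchuk_type:
  assumes G: "a \<in> carrier G" "b \<in> carrier G" "c \<in> carrier G" "d \<in> carrier G"
    and gen: "carrier G = generate G {a, b, c, d}"
    and rel: "a \<otimes> a = \<one>" "b \<otimes> b = \<one>" "d \<otimes> d = \<one>" "c = b \<otimes> d" "b \<otimes> d = d \<otimes> b" "b \<otimes> a = a \<otimes> b"
    and ad: "(a \<otimes> d) [^] (4 :: nat) = \<one>"
  shows "finite (carrier G)"
proof (rule finite_if_closed_under_generators[OF _ gen])
  let ?u = "a \<otimes> d"
  have u: "?u \<in> carrier G" using G by simp
  define F where "F = (\<lambda>(i :: nat, y, z). ?u [^] i \<otimes> y \<otimes> z) ` (UNIV \<times> {\<one>, a} \<times> {\<one>, b})"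
  have mem: "?u [^] (i :: nat) \<otimes> y \<otimes> z \<in> F" if "y \<in> {\<one>, a}" "z \<in> {\<one>, b}" for i y z
    unfolding F_def by (rule image_eqI[of _ _ "(i, y, z)"]) (use that in auto)
  have elim: "\<exists>i :: nat. \<exists>y z. y \<in> {\<one>, a} \<and> z \<in> {\<one>, b} \<and> x = ?u [^] i \<otimes> y \<otimes> z" if "x \<in> F" for x
    using that unfolding F_def by auto
  have pow: "?u [^] i = ?u [^] (i mod 4)" for i :: nat
  proof -
    have "?u [^] i = ?u [^] (4 * (i div 4) + i mod 4)" by simp
    also have "\<dots> = (?u [^] (4 :: nat)) [^] (i div 4) \<otimes> ?u [^] (i mod 4)"
      using u by (simp only: nat_pow_mult[symmetric] nat_pow_pow)
    finally show ?thesis using ad u by simp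
  qed
  show "{a, b, c, d} \<subseteq> carrier G" using G by simp
  have "F \<subseteq> (\<lambda>(i :: nat, y, z). ?u [^] i \<otimes> y \<otimes> z) ` ({..<4} \<times> {\<one>, a} \<times> {\<one>, b})"
  proof
    fix x assume "x \<in> F"
    then obtain i :: nat and y z where x: "y \<in> {\<one>, a}" "z \<in> {\<one>, b}" "x = ?u [^] i \<otimes> y \<otimes> z" using elim by blast
    show "x \<in> (\<lambda>(i :: nat, y, z). ?u [^] i \<otimes> y \<otimes> z) ` ({..<4} \<times> {\<one>, a} \<times> {\<one>, b})"
      by (rule image_eqI[of _ _ "(i mod 4, y, z)"]) (use x pow[of i] in auto)
  qed
  thus "finite F" by (rule finite_subset) simp
  show "F \<subseteq> carrier G" unfolding F_def using G by auto
  show "\<one> \<in> F" using mem[of \<one> \<one> 0] by simp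
  have Fb: "x \<otimes> b \<in> F" if xF: "x \<in> F" for x
  proof -
    obtain i :: nat and y z where x: "y \<in> {\<one>, a}" "z \<in> {\<one>, b}" "x = ?u [^] i \<otimes> y \<otimes> z" using elim[OF xF] by blast
    have "z \<otimes> b \<in> {\<one>, b}" using x(2) rel(2) G by auto
    moreover have "x \<otimes> b = ?u [^] i \<otimes> y \<otimes> (z \<otimes> b)" using x G u by (auto simp: m_assoc)
    ultimately show ?thesis using mem[OF x(1)] by simp
  qed
  have Fa: "x \<otimes> a \<in> F" if xF: "x \<in> F" for x
  proof -
    obtain i :: nat and y z where x: "y \<in> {\<one>, a}" "z \<in> {\<one>, b}" "x = ?u [^] i \<otimes> y \<otimes> z" using elim[OF xF] by blast
    have G': "y \<in> carrier G" "z \<in> carrier G" "?u [^] i \<in> carrier G" using x G u by auto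
    have "y \<otimes> a \<in> {\<one>, a}" using x(1) rel(1) G by auto
    moreover have za: "z \<otimes> a = a \<otimes> z" using x(2) rel(6) G by auto
    have "x \<otimes> a = ?u [^] i \<otimes> (y \<otimes> a) \<otimes> z"
      unfolding x(3) using G' G(1) za by (simp add: m_assoc)
    ultimately show ?thesis using mem[OF _ x(2)] by simp
  qed
  have Fd: "x \<otimes> d \<in> F" if xF: "x \<in> F" for x
  proof -
    obtain i :: nat and y z where x: "y \<in> {\<one>, a}" "z \<in> {\<one>, b}" "x = ?u [^] i \<otimes> y \<otimes> z" using elim[OF xF] by blast
    have G': "y \<in> carrier G" "z \<in> carrier G" "?u [^] i \<in> carrier G" using x G u by auto
    have zd: "z \<otimes> d = d \<otimes> z" using x(2) rel(5) G by auto
    have xd: "x \<otimes> d = ?u [^] i \<otimes> (y \<otimes> d) \<otimes> z" unfolding x(3) using G' G(4) zd by (simp add: m_assoc)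
    show ?thesis
    proof (cases "y = a")
      case True
      hence "x \<otimes> d = ?u [^] Suc i \<otimes> \<one> \<otimes> z" unfolding xd using G G' by simp
      thus ?thesis using mem[OF _ x(2), of \<one> "Suc i"] by simp
    next
      case False
      hence y: "y = \<one>" using x(1) by simp
      \<comment> \<open>\<open>d = (a d)\<^sup>3 a\<close>, as both \<open>(a d)\<^sup>4\<close> and \<open>d\<^sup>2\<close> are trivial.\<close>
      have "(?u [^] (3 :: nat) \<otimes> a) \<otimes> d = ?u [^] (3 :: nat) \<otimes> ?u" using G by (simp add: m_assoc)
      also have "\<dots> = ?u [^] (4 :: nat)" by (simp add: numeral_eq_Suc)
      also have "\<dots> = d \<otimes> d" using ad rel(3) by simp
      finally have "?u [^] (3 :: nat) \<otimes> a = d" using G by simp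
      hence "x \<otimes> d = (?u [^] i \<otimes> ?u [^] (3 :: nat)) \<otimes> a \<otimes> z"
        unfolding xd y using G G' by (simp add: m_assoc)
      also have "?u [^] i \<otimes> ?u [^] (3 :: nat) = ?u [^] (i + 3)" using u by (rule nat_pow_mult)
      finally show ?thesis using mem[OF _ x(2), of a "i + 3"] by simp
    qed
  qed
  have Fc: "x \<otimes> c \<in> F" if x: "x \<in> F" for x
  proof -
    have "x \<in> carrier G" using x \<open>F \<subseteq> carrier G\<close> by blast
    hence "x \<otimes> c = (x \<otimes> b) \<otimes> d" using rel(4) G by (simp add: m_assoc)
    thus ?thesis using Fd[OF Fb[OF x]] by simp
  qed
  show "x \<otimes> s \<in> F" if "x \<in> F" "s \<in> {a, b, c, d}" for x s
    using that Fa Fb Fc Fd by blast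
qed


lemma grig_decompositions:
  fixes G (structure)
  assumes "rotation_tree_group G 2" and S: "{grig_a, grig_b, grig_c, grig_d} \<subseteq> carrier G"
  shows "rotation_tree_group.decomposes G 2 grig_b (\<lambda>i. if i = 0 then grig_a else grig_c)"
    and "rotation_tree_group.decomposes G 2 grig_c (\<lambda>i. if i = 0 then grig_a else grig_d)"
    and "rotation_tree_group.decomposes G 2 grig_d (\<lambda>i. if i = 0 then \<one>\<^bsub>G\<^esub> else grig_b)"
proof -
  interpret rotation_tree_group G 2 by fact
  show "decomposes grig_b (\<lambda>i. if i = 0 then grig_a else grig_c)"
    "decomposes grig_c (\<lambda>i. if i = 0 then grig_a else grig_d)"
    "decomposes grig_d (\<lambda>i. if i = 0 then \<one>\<^bsub>G\<^esub> else grig_b)"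
    using S one_apply
    by (auto simp: decomposes_def grig_a_def grig_b_def grig_c_def grig_d_def rot_def less_2_cases_iff)
qed

text \<open>
  For \<open>t = (a b)\<^sup>2\<close>, the square of \<open>a b a d = (c, a b)\<close> is \<open>(1, t)\<close>. As \<open>a b a d = t c\<close>, this square is the product of
  \<open>t\<close> and of its conjugate by \<open>c\<close>. Modulo the normal closure, \<open>a\<close> and \<open>b\<close> commute, and \<open>(a d)\<^sup>2 = (b, b)\<close> has order 2.
\<close>

theorem grigorchuk_group_branching:
  fixes G (structure)
  assumes G_def: "G = grigorchuk_group"
  shows "\<exists>t. branching_self_similar_group G 2 {grig_a, grig_b, grig_c, grig_d} t"
proof -
  let ?S = "{grig_a, grig_b, grig_c, grig_d}"
  have p: "Factorial_Ring.prime (2 :: nat)" by (rule two_is_prime_nat)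
  have rotates: "\<exists>r. \<forall>x<2. s (w @ [x]) = s w @ [(x + r) mod 2]" if s: "s \<in> ?S" and w: "w \<in> tree 2" for s w
  proof -
    have wx: "w @ [x] \<in> tree 2" if "x < 2" for x using w that by simp
    show ?thesis using s rot_word_rotates[OF w] grig_word_rotates[OF w] w wx
      by (auto simp: grig_a_def grig_b_def grig_c_def grig_d_def rot_def)
  qed
  note gen = rotation_tree_group_subgroup_generated[OF p grig_carrier rotates,
      folded grigorchuk_group_def, folded G_def]
  interpret rotation_tree_group G 2 by (rule gen(1))
  note S = gen(3) and S_gen = gen(2)
  have carr: "grig_a \<in> carrier G" "grig_b \<in> carrier G" "grig_c \<in> carrier G" "grig_d \<in> carrier G"
    using S by auto
  have rotG: "rot 2 \<in> carrier G" using carr(1) by (simp add: grig_a_def)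
  note dec = grig_decompositions[OF gen(1) S]
  have word: "grig_a w = rot_word 2 w" "grig_b w = grig_b_word w" "grig_c w = grig_c_word w" "grig_d w = grig_d_word w"
    if "w \<in> tree 2" for w using that by (auto simp: grig_a_def grig_b_def grig_c_def grig_d_def rot_def)
  have in_tree: "rot_word 2 w \<in> tree 2" "grig_b_word w \<in> tree 2" "grig_c_word w \<in> tree 2" "grig_d_word w \<in> tree 2"
    if "w \<in> tree 2" for w using that rot_word_in_tree grig_word_in_tree by auto
  have invol: "grig_a \<otimes> grig_a = \<one>" "grig_b \<otimes> grig_b = \<one>" "grig_c \<otimes> grig_c = \<one>" "grig_d \<otimes> grig_d = \<one>"
    "grig_b \<otimes> grig_d = grig_c" "grig_d \<otimes> grig_b = grig_c"
    "grig_b \<otimes> grig_c = grig_d"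
    by (rule group_elem_eqI;
      simp add: carr mult_apply one_apply word in_tree rot_word_2_twice grig_word_relations)+
  have inv_a: "inv grig_a = grig_a" using inv_equality[OF invol(1)] carr by simp
  have conj: "decomposes (grig_a \<otimes> x \<otimes> grig_a) (\<lambda>i. if i = 0 then \<sigma> 1 else \<sigma> 0)" if "decomposes x \<sigma>" for x \<sigma>
    using decomposes_conj_rot[OF that rotG, folded grig_a_def, unfolded inv_a]
    by (rule decomposes_cong) (auto simp: less_2_cases_iff)
  define t where "t = grig_a \<otimes> grig_b \<otimes> grig_a \<otimes> grig_b"
  have tG: "t \<in> carrier G" using carr by (simp add: t_def)
  interpret L: normal "normal_closure G t" G by (rule normal_closure_normal[OF tG])
  have tL: "t \<in> normal_closure G t" by (rule mem_normal_closure[OF tG])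
  define abad where "abad = (grig_a \<otimes> grig_b \<otimes> grig_a) \<otimes> grig_d"
  have abadG: "abad \<in> carrier G" using carr by (simp add: abad_def)
  have ab: "grig_a \<otimes> grig_b \<in> carrier G" using carr by simp
  have dec_abad: "decomposes abad (\<lambda>i. if i = 0 then grig_c else grig_a \<otimes> grig_b)"
    unfolding abad_def
    by (rule decomposes_cong[OF decomposes_mult[OF conj[OF dec(1)] dec(3)]])
      (use carr in \<open>auto split: if_split\<close>)
  have dec_sq: "decomposes (abad \<otimes> abad) (\<lambda>i. if i = 0 then \<one> else t)"
    by (rule decomposes_cong[OF decomposes_mult[OF dec_abad dec_abad]])
      (simp add: carr invol(3) t_def m_assoc)
  have t_branch: "graft 2 [0] t \<in> normal_closure G t"
  proof -
    have "graft 2 [0] t = grig_a \<otimes> (abad \<otimes> abad) \<otimes> grig_a"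
      using decomposes_graft[OF conj[OF dec_sq], of 0] by simp
    moreover have "abad = t \<otimes> grig_c"
      unfolding abad_def t_def using carr by (simp add: m_assoc invol(7))
    hence "abad \<otimes> abad = t \<otimes> (grig_c \<otimes> t \<otimes> inv grig_c)"
    proof -
      have "inv grig_c = grig_c" using inv_equality[OF invol(3)] carr by simp
      thus ?thesis using \<open>abad = t \<otimes> grig_c\<close> carr tG by (simp add: m_assoc)
    qed
    hence "abad \<otimes> abad \<in> normal_closure G t" using tL L.inv_op_closed2[OF carr(3) tL] by simp
    hence "grig_a \<otimes> (abad \<otimes> abad) \<otimes> inv grig_a \<in> normal_closure G t" by (rule L.inv_op_closed2[OF carr(1)])
    ultimately show ?thesis using inv_a by simp
  qed
  have t_moves: "t [0, 0] \<noteq> [0, 0]"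
    unfolding t_def using carr
    by (simp add: mult_apply word in_tree)
  have inv_b: "inv grig_b = grig_b" using inv_equality[OF invol(2)] carr by simp
  have ba: "(grig_b \<otimes> grig_a) \<otimes> inv (grig_a \<otimes> grig_b) = inv t"
  proof -
    have iab: "inv (grig_a \<otimes> grig_b) = grig_b \<otimes> grig_a"
      using inv_mult_group[OF carr(1,2)] unfolding inv_a inv_b .
    have "t = (grig_a \<otimes> grig_b) \<otimes> (grig_a \<otimes> grig_b)"
      unfolding t_def by (simp only: m_assoc carr m_closed)
    hence "inv t = inv (grig_a \<otimes> grig_b) \<otimes> inv (grig_a \<otimes> grig_b)"
      by (simp only: inv_mult_group[OF ab ab])
    thus ?thesis unfolding iab by (rule sym)
  qed
  have "decomposes ((grig_a \<otimes> grig_d \<otimes> grig_a) \<otimes> grig_d) (\<lambda>i. grig_b)"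
    by (rule decomposes_cong[OF decomposes_mult[OF conj[OF dec(3)] dec(3)]]) (use carr in \<open>auto split: if_split\<close>)
  from decomposes_mult[OF this this]
  have "((grig_a \<otimes> grig_d \<otimes> grig_a) \<otimes> grig_d) \<otimes> ((grig_a \<otimes> grig_d \<otimes> grig_a) \<otimes> grig_d) = \<one>"
    by (rule decomposes_unique[OF _ decomposes_one]) (rule invol(2))
  hence ad4: "(grig_a \<otimes> grig_d) [^] (4 :: nat) = \<one>"
    using carr by (simp add: numeral_eq_Suc m_assoc)
  have t_index: "finite (rcosets (normal_closure G t))"
  proof -
    let ?Q = "G Mod normal_closure G t" and ?f = "\<lambda>x. normal_closure G t #> x"
    interpret Q: group ?Q by (rule L.factorgroup_is_group)
    interpret h: group_hom G ?Q ?f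
      by (intro group_hom.intro group_hom_axioms.intro is_group Q.is_group L.r_coset_hom_Mod)
    have hm: "?f x \<otimes>\<^bsub>?Q\<^esub> ?f y = ?f (x \<otimes> y)" if "x \<in> carrier G" "y \<in> carrier G" for x y
      by (rule h.hom_mult[OF that, symmetric])
    have h1: "?f \<one> = \<one>\<^bsub>?Q\<^esub>" by (rule h.hom_one)
    have "finite (carrier ?Q)"
    proof (rule Q.finite_quotient_of_grigorchuk_type[of "?f grig_a" "?f grig_b" "?f grig_c" "?f grig_d"])
      have "carrier ?Q = ?f ` carrier G" by (rule carrier_FactGroup)
      also have "\<dots> = ?f ` generate G ?S" by (rule arg_cong[OF S_gen])
      also have "\<dots> = generate ?Q (?f ` ?S)" by (rule h.generate_img[OF S, symmetric])
      finally show "carrier ?Q = generate ?Q {?f grig_a, ?f grig_b, ?f grig_c, ?f grig_d}"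
        by (simp only: image_insert image_empty)
      have "?f (grig_b \<otimes> grig_a) = ?f (grig_a \<otimes> grig_b)"
        unfolding rcos_eq_iff[OF L.subgroup_axioms m_closed[OF carr(2,1)] ab] ba by (rule L.m_inv_closed[OF tL])
      thus "?f grig_b \<otimes>\<^bsub>?Q\<^esub> ?f grig_a = ?f grig_a \<otimes>\<^bsub>?Q\<^esub> ?f grig_b"
        unfolding hm[OF carr(1,2)] hm[OF carr(2,1)] .
      have "?f ((grig_a \<otimes> grig_d) [^] (4 :: nat)) = \<one>\<^bsub>?Q\<^esub>" unfolding ad4 by (rule h1)
      thus "(?f grig_a \<otimes>\<^bsub>?Q\<^esub> ?f grig_d) [^]\<^bsub>?Q\<^esub> (4 :: nat) = \<one>\<^bsub>?Q\<^esub>"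
        unfolding hm[OF carr(1,4)] h.hom_nat_pow[OF m_closed[OF carr(1,4)]] .
      show "?f grig_c = ?f grig_b \<otimes>\<^bsub>?Q\<^esub> ?f grig_d" unfolding hm[OF carr(2,4)] invol(5) ..
      show "?f grig_b \<otimes>\<^bsub>?Q\<^esub> ?f grig_d = ?f grig_d \<otimes>\<^bsub>?Q\<^esub> ?f grig_b"
        unfolding hm[OF carr(2,4)] hm[OF carr(4,2)] invol(5,6) ..
      show "?f grig_a \<otimes>\<^bsub>?Q\<^esub> ?f grig_a = \<one>\<^bsub>?Q\<^esub>" unfolding hm[OF carr(1,1)] invol(1) by (rule h1)
      show "?f grig_b \<otimes>\<^bsub>?Q\<^esub> ?f grig_b = \<one>\<^bsub>?Q\<^esub>" unfolding hm[OF carr(2,2)] invol(2) by (rule h1)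
      show "?f grig_d \<otimes>\<^bsub>?Q\<^esub> ?f grig_d = \<one>\<^bsub>?Q\<^esub>" unfolding hm[OF carr(4,4)] invol(4) by (rule h1)
    qed (rule h.hom_closed[OF carr(1)] h.hom_closed[OF carr(2)] h.hom_closed[OF carr(3)] h.hom_closed[OF carr(4)])+
    thus ?thesis by (simp add: FactGroup_def)
  qed
  have frac: "\<exists>h\<in>carrier G. h [0] = [0] \<and> sec 2 h [0] = s" if "s \<in> ?S" for s
  proof -
    have *: "\<exists>h\<in>carrier G. h [0] = [0] \<and> sec 2 h [0] = \<sigma> 0" if "decomposes x \<sigma>" for x \<sigma>
      using decomposes_letter_sec[OF that, of 0] decomposesD(1)[OF that] by auto
    show ?thesis
      using that *[OF dec(1)] *[OF conj[OF dec(1)]] *[OF conj[OF dec(2)]] *[OF conj[OF dec(3)]] by auto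
  qed
  have secs: "sec 2 s [i] \<in> carrier G" if "s \<in> ?S" "i < 2" for s i
  proof -
    have *: "sec 2 x [i] \<in> carrier G" if "decomposes x \<sigma>" for x \<sigma>
      using decomposes_letter_sec(2)[OF that \<open>i < 2\<close>] decomposesD(2)[OF that \<open>i < 2\<close>] by simp
    have "sec 2 grig_a [i] = \<one>" unfolding grig_a_def using sec_rot_letter[OF rotG that(2)] .
    thus ?thesis using that(1) *[OF dec(1)] *[OF dec(2)] *[OF dec(3)] by auto
  qed
  have "self_similar_group G 2 ?S"
    by (rule self_similar_group.intro[OF rotation_tree_group_axioms self_similar_group_axioms.intro])
      (use S S_gen secs frac rotG in \<open>assumption | simp\<close>)+
  hence "branching_self_similar_group G 2 ?S t"
  proof (rule branching_self_similar_group.intro[OF _ branching_self_similar_group_axioms.intro])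
    show "\<exists>w\<in>tree 2. t w \<noteq> w" using t_moves by (intro bexI[of _ "[0, 0]"]) simp_all
  qed (use tG t_branch t_index in auto)
  thus ?thesis by blast
qed

section \<open>The Gupta-Sidki groups\<close>

lemma rot_word_funpow_rotates:
  assumes "w \<in> tree p"
  shows "\<exists>r. \<forall>x<p. (rot_word p ^^ k) (w @ [x]) = (rot_word p ^^ k) w @ [(x + r) mod p]"
proof (cases w)
  case Nil
  thus ?thesis by (intro exI[of _ k]) (simp add: rot_word_funpow)
next
  case (Cons i v)
  thus ?thesis by (intro exI[of _ 0]) (simp add: rot_word_funpow)
qed

lemma gs_b_word_rotates:
  assumes "w \<in> tree p"
  shows "\<exists>r. \<forall>x<p. gs_b_word p (w @ [x]) = gs_b_word p w @ [(x + r) mod p]"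
  using assms
proof (induction w)
  case Nil
  have "gs_b_word p ([] @ [x]) = gs_b_word p [] @ [(x + 0) mod p]" if "x < p" for x
    using that by simp
  thus ?case by blast
next
  case (Cons i w)
  have w: "w \<in> tree p" using Cons.prems by simp
  have id: "\<exists>r. \<forall>x<p. w @ [x] = w @ [(x + r) mod p]" by (intro exI[of _ 0]) simp
  show ?case
    using Cons.IH[OF w] rot_word_rotates[OF w] rot_word_funpow_rotates[OF w, of "p - 1"] id by simp
qed

lemma (in group) finite_if_generated_by_two_commuting:
  assumes G: "a \<in> carrier G" "b \<in> carrier G" and gen: "carrier G = generate G {a, b}"
    and comm: "b \<otimes> a = a \<otimes> b" and p: "p > 0" "a [^] (p :: nat) = \<one>" "b [^] (p :: nat) = \<one>"
  shows "finite (carrier G)"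
proof (rule finite_if_closed_under_generators[OF _ gen])
  show "{a, b} \<subseteq> carrier G" using G by simp
  define F where "F = (\<lambda>(i :: nat, j :: nat). a [^] i \<otimes> b [^] j) ` UNIV"
  have pow: "x [^] (i :: nat) = x [^] (i mod p)" if "x \<in> carrier G" "x [^] p = \<one>" for x i
  proof -
    have "x [^] i = x [^] (p * (i div p) + i mod p)" by simp
    also have "\<dots> = (x [^] p) [^] (i div p) \<otimes> x [^] (i mod p)"
      using that(1) by (simp only: nat_pow_mult[symmetric] nat_pow_pow)
    finally show ?thesis using that by simp
  qed
  have "F \<subseteq> (\<lambda>(i, j). a [^] i \<otimes> b [^] j) ` ({..<p} \<times> {..<p})"
  proof
    fix x assume "x \<in> F"
    then obtain i j :: nat where x: "x = a [^] i \<otimes> b [^] j" by (auto simp: F_def)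
    show "x \<in> (\<lambda>(i, j). a [^] i \<otimes> b [^] j) ` ({..<p} \<times> {..<p})"
      by (rule image_eqI[of _ _ "(i mod p, j mod p)"])
        (use x pow[OF G(1) p(2), of i] pow[OF G(2) p(3), of j] p(1) in auto)
  qed
  thus "finite F" by (rule finite_subset) simp
  show "F \<subseteq> carrier G" using G by (auto simp: F_def)
  have mem: "a [^] (i :: nat) \<otimes> b [^] (j :: nat) \<in> F" for i j
    unfolding F_def by (rule image_eqI[of _ _ "(i, j)"]) auto
  show "\<one> \<in> F" using mem[of 0 0] by simp
  fix x s assume x: "x \<in> F" and s: "s \<in> {a, b}"
  obtain i j :: nat where x: "x = a [^] i \<otimes> b [^] j" using x by (auto simp: F_def)
  show "x \<otimes> s \<in> F"
  proof (cases "s = a")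
    case True
    have "b [^] j \<otimes> a = a \<otimes> b [^] j" by (rule group_commutes_pow[OF comm G(2,1)])
    hence "x \<otimes> s = a [^] Suc i \<otimes> b [^] j" unfolding x True using G by (simp add: m_assoc)
    thus ?thesis using mem[of "Suc i" j] by simp
  next
    case False
    hence "s = b" using s by simp
    hence "x \<otimes> s = a [^] i \<otimes> b [^] Suc j" unfolding x using G by (simp add: m_assoc)
    thus ?thesis using mem[of i "Suc j"] by simp
  qed
qed

lemma (in group) generated_by_commuting_commutes:
  assumes G: "S \<subseteq> carrier G" "carrier G = generate G S"
    and comm: "\<And>x y. x \<in> S \<Longrightarrow> y \<in> S \<Longrightarrow> x \<otimes> y = y \<otimes> x"
    and xy: "x \<in> carrier G" "y \<in> carrier G"
  shows "x \<otimes> y = y \<otimes> x"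
proof -
  have cent: "subgroup {x \<in> carrier G. x \<otimes> z = z \<otimes> x} G" if z: "z \<in> carrier G" for z
  proof (rule subgroupI)
    show "{x \<in> carrier G. x \<otimes> z = z \<otimes> x} \<noteq> {}" using z by force
    fix x assume x: "x \<in> {x \<in> carrier G. x \<otimes> z = z \<otimes> x}"
    hence xG: "x \<in> carrier G" and xz: "x \<otimes> z = z \<otimes> x" by auto
    have "inv x \<otimes> z = inv x \<otimes> (z \<otimes> x) \<otimes> inv x" using xG z by (simp add: m_assoc)
    also have "\<dots> = z \<otimes> inv x" unfolding xz[symmetric] using xG z by (simp add: m_assoc[symmetric])
    finally show "inv x \<in> {x \<in> carrier G. x \<otimes> z = z \<otimes> x}" using xG by simp
  next
    fix x y assume xy: "x \<in> {x \<in> carrier G. x \<otimes> z = z \<otimes> x}" "y \<in> {x \<in> carrier G. x \<otimes> z = z \<otimes> x}"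
    hence xyG: "x \<in> carrier G" "y \<in> carrier G" and xz: "x \<otimes> z = z \<otimes> x" and yz: "y \<otimes> z = z \<otimes> y" by auto
    have "(x \<otimes> y) \<otimes> z = (x \<otimes> z) \<otimes> y" using xyG z yz by (simp add: m_assoc)
    also have "\<dots> = z \<otimes> (x \<otimes> y)" unfolding xz using xyG z by (simp add: m_assoc)
    finally show "x \<otimes> y \<in> {x \<in> carrier G. x \<otimes> z = z \<otimes> x}" using xyG by simp
  qed auto
  have S_central: "s \<otimes> z = z \<otimes> s" if s: "s \<in> S" and z: "z \<in> carrier G" for s z
  proof -
    have sG: "s \<in> carrier G" using s G(1) by blast
    have "S \<subseteq> {x \<in> carrier G. x \<otimes> s = s \<otimes> x}" using G(1) comm[OF _ s] by blast
    hence "generate G S \<subseteq> {x \<in> carrier G. x \<otimes> s = s \<otimes> x}"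
      by (rule generate_subgroup_incl[OF _ cent[OF sG]])
    hence "z \<in> {x \<in> carrier G. x \<otimes> s = s \<otimes> x}" using z G(2) by blast
    thus ?thesis by simp
  qed
  have "S \<subseteq> {x \<in> carrier G. x \<otimes> y = y \<otimes> x}" using G(1) S_central[OF _ xy(2)] by blast
  hence "generate G S \<subseteq> {x \<in> carrier G. x \<otimes> y = y \<otimes> x}"
    by (rule generate_subgroup_incl[OF _ cent[OF xy(2)]])
  thus ?thesis using xy(1) G(2) by auto
qed

lemma gs_b_decomposes:
  fixes G (structure)
  assumes "rotation_tree_group G p" and S: "gs_a p \<in> carrier G" "gs_b p \<in> carrier G" and p: "p \<ge> 3"
  shows "rotation_tree_group.decomposes G p (gs_b p)
    (\<lambda>i. if i = 0 then gs_a p else if i = 1 then inv (gs_a p) else if i = p - 1 then gs_b p else \<one>)"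
proof -
  interpret rotation_tree_group G p by fact
  have rot_inv: "(inv (gs_a p)) w = (rot_word p ^^ (p - 1)) w" if w: "w \<in> tree p" for w
  proof -
    let ?v = "(rot_word p ^^ (p - 1)) w"
    have v: "?v \<in> tree p" by (rule rot_word_funpow_in_tree[OF w])
    have "gs_a p ?v = rot_word p ?v" using v by (simp add: gs_a_def rot_def)
    also have "\<dots> = (rot_word p ^^ Suc (p - 1)) w" by simp
    also have "\<dots> = w" using w p by (auto simp: rot_word_funpow simp del: funpow.simps split: list.splits)
    finally show ?thesis using inv_apply(1)[OF S(1) v] by simp
  qed
  show ?thesis
    using S p one_apply rot_inv by (auto simp: decomposes_def gs_b_def) (auto simp: gs_a_def rot_def)
qed

text \<open>
  Modulo the normal closure of \<open>t = [a, b\<^sup>2]\<close> the group is abelian, because \<open>b\<close> is a power of \<open>b\<^sup>2\<close>; so it suffices to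
  write \<open>(t, 1, ..., 1)\<close> as a commutator. With \<open>b1 = a b a\<^sup>-\<^sup>1 = (b, a, a\<^sup>-\<^sup>1, 1, ..., 1)\<close> and \<open>p \<ge> 5\<close>, it is the
  commutator of \<open>b\<close> and \<open>b1\<^sup>2\<close>, since the components other than the first commute. For \<open>p = 3\<close> the last components
  \<open>b\<close> and \<open>a\<^sup>-\<^sup>1\<close> do not commute. Then take the commutator of \<open>b b1 = (a b, 1, b a\<^sup>-\<^sup>1)\<close> and
  \<open>b1 b3 = (b a\<^sup>-\<^sup>1, a b, 1)\<close>, where \<open>b3 = a b1 a\<^sup>-\<^sup>1\<close>; the commutator of \<open>a b\<close> and \<open>b a\<^sup>-\<^sup>1\<close> is again \<open>t\<close>.
\<close>

theorem gupta_sidki_group_branching: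
  fixes G (structure)
  assumes G_def: "G = gupta_sidki_group p" and p: "Factorial_Ring.prime p" "p \<ge> 3"
  shows "\<exists>t. branching_self_similar_group G p {gs_a p, gs_b p} t"
proof -
  let ?S = "{gs_a p, gs_b p}"
  have rotates: "\<exists>r. \<forall>x<p. s (w @ [x]) = s w @ [(x + r) mod p]" if s: "s \<in> ?S" and w: "w \<in> tree p" for s w
  proof -
    have wx: "w @ [x] \<in> tree p" if "x < p" for x using w that by simp
    show ?thesis using s rot_word_rotates[OF w] gs_b_word_rotates[OF w] w wx
      by (auto simp: gs_a_def gs_b_def rot_def)
  qed
  note gen = rotation_tree_group_subgroup_generated[OF p(1) gs_carrier rotates,
      folded gupta_sidki_group_def, folded G_def]
  interpret rotation_tree_group G p by (rule gen(1))
  note S = gen(3) and S_gen = gen(2)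
  define a where "a = gs_a p"
  define b where "b = gs_b p"
  have carr: "a \<in> carrier G" "b \<in> carrier G" using S by (auto simp: a_def b_def)
  have rot_a: "rot p = a" by (simp add: a_def gs_a_def)
  have rotG: "rot p \<in> carrier G" using carr(1) by (simp add: rot_a)
  define \<beta> where "\<beta> i = (if i = 0 then a else if i = 1 then inv a else if i = p - 1 then b else \<one>)" for i
  have dec_b: "decomposes b \<beta>"
    using gs_b_decomposes[OF gen(1) _ _ p(2)] carr unfolding \<beta>_def a_def b_def by blast
  have \<beta>: "\<beta> i \<in> carrier G" for i using carr by (simp add: \<beta>_def)
  define b1 where "b1 = a \<otimes> b \<otimes> inv a"
  define \<beta>1 where "\<beta>1 i = \<beta> ((i + p - 1) mod p)" for i
  have b1G: "b1 \<in> carrier G" using carr by (simp add: b1_def)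
  have dec_b1: "decomposes b1 \<beta>1"
    unfolding b1_def \<beta>1_def using decomposes_conj_rot[OF dec_b rotG] unfolding rot_a .
  have \<beta>1: "\<beta>1 i \<in> carrier G" for i using \<beta> by (simp add: \<beta>1_def)
  have pred: "(i + p - 1) mod p = (if i = 0 then p - 1 else i - 1)" if "i < p" for i
  proof (cases "i = 0")
    case False
    hence e: "i + p - 1 = (i - 1) + p" by simp
    show ?thesis unfolding e mod_add_self2 using that False by simp
  qed (use p in simp)
  have \<beta>1_values: "\<beta>1 0 = b" "\<beta>1 1 = a" "\<beta>1 2 = inv a"
    using p pred[of 0] pred[of 1] pred[of 2] by (auto simp: \<beta>1_def \<beta>_def)
  have a_pow: "a [^] p = \<one>"
  proof (rule group_elem_eqI)
    fix w assume w: "w \<in> tree p"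
    have "(a [^] k) w = (rot_word p ^^ k) w" for k :: nat
    proof (induction k)
      case 0
      show ?case using one_apply[OF w] by simp
    next
      case (Suc k)
      have t: "(rot_word p ^^ k) w \<in> tree p" by (rule rot_word_funpow_in_tree[OF w])
      have "(a [^] Suc k) w = a ((a [^] k) w)"
        unfolding nat_pow_Suc2[OF carr(1)] by (rule mult_apply[OF carr(1) nat_pow_closed[OF carr(1)] w])
      also have "\<dots> = rot_word p ((rot_word p ^^ k) w)"
        unfolding Suc.IH using t by (simp add: a_def gs_a_def rot_def)
      finally show ?case by simp
    qed
    hence "(a [^] p) w = (rot_word p ^^ p) w" .
    also have "\<dots> = w" using w p by (auto simp: rot_word_funpow split: list.splits)
    finally show "(a [^] p) w = \<one> w" using one_apply[OF w] by simp
  qed (use carr in auto)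
  have b_pow: "b [^] p = \<one>"
  proof (rule group_elem_eqI)
    fix w assume "w \<in> tree p"
    thus "(b [^] p) w = \<one> w"
    proof (induction w)
      case Nil
      show ?case using Nil_apply[of "b [^] p"] one_apply[of "[]"] carr by simp
    next
      case (Cons i w)
      hence iw: "i < p" "w \<in> tree p" by auto
      have "(inv a) [^] p = \<one>" using a_pow carr by (simp add: nat_pow_inv)
      hence "(\<beta> i [^] p) w = \<one> w"
        using a_pow Cons.IH[OF iw(2)] by (simp add: \<beta>_def)
      thus ?case
        using decomposesD(3)[OF decomposes_pow[OF dec_b] iw, of p] one_apply[OF iw(2)] one_apply[of "i # w"] iw by simp
    qed
  qed (use carr in auto)
  define b2 where "b2 = b \<otimes> b"
  have b2G: "b2 \<in> carrier G" using carr by (simp add: b2_def)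
  define t where "t = a \<otimes> b2 \<otimes> inv a \<otimes> inv b2"
  have tG: "t \<in> carrier G" using carr b2G by (simp add: t_def)
  interpret L: normal "normal_closure G t" G by (rule normal_closure_normal[OF tG])
  have tL: "t \<in> normal_closure G t" by (rule mem_normal_closure[OF tG])
  let ?Q = "G Mod normal_closure G t" and ?f = "\<lambda>x. normal_closure G t #> x"
  interpret Q: group ?Q by (rule L.factorgroup_is_group)
  interpret h: group_hom G ?Q ?f
    by (intro group_hom.intro group_hom_axioms.intro is_group Q.is_group L.r_coset_hom_Mod)
  have hm: "?f x \<otimes>\<^bsub>?Q\<^esub> ?f y = ?f (x \<otimes> y)" if "x \<in> carrier G" "y \<in> carrier G" for x y
    by (rule h.hom_mult[OF that, symmetric])
  have h1: "?f \<one> = \<one>\<^bsub>?Q\<^esub>" by (rule h.hom_one)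
  have fa: "?f a \<in> carrier ?Q" and fb: "?f b \<in> carrier ?Q" and fb2: "?f b2 \<in> carrier ?Q"
    by (rule h.hom_closed[OF carr(1)] h.hom_closed[OF carr(2)] h.hom_closed[OF b2G])+
  have Q_gen: "carrier ?Q = generate ?Q {?f a, ?f b}"
  proof -
    have "carrier ?Q = ?f ` carrier G" by (rule carrier_FactGroup)
    also have "\<dots> = ?f ` generate G ?S" by (rule arg_cong[OF S_gen])
    also have "\<dots> = generate ?Q (?f ` ?S)" by (rule h.generate_img[OF S, symmetric])
    finally show ?thesis by (simp only: image_insert image_empty a_def b_def)
  qed
  have eq_t: "(x \<otimes> y) \<otimes> inv (y \<otimes> x) = x \<otimes> y \<otimes> inv x \<otimes> inv y" if "x \<in> carrier G" "y \<in> carrier G" for x y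
    unfolding inv_mult_group[OF that(2,1)] using that by (simp only: m_assoc inv_closed m_closed)
  have comm2: "?f b2 \<otimes>\<^bsub>?Q\<^esub> ?f a = ?f a \<otimes>\<^bsub>?Q\<^esub> ?f b2"
  proof -
    have "?f (a \<otimes> b2) = ?f (b2 \<otimes> a)"
      unfolding rcos_eq_iff[OF L.subgroup_axioms m_closed[OF carr(1) b2G] m_closed[OF b2G carr(1)]]
        eq_t[OF carr(1) b2G] t_def[symmetric] by (rule tL)
    thus ?thesis unfolding hm[OF b2G carr(1)] hm[OF carr(1) b2G] by (rule sym)
  qed
  \<comment> \<open>\<open>2 * ((p + 1) / 2) = p + 1\<close>, and \<open>b\<close> has order dividing \<open>p\<close>.\<close>
  have b_root: "b2 [^] (Suc p div 2) = b"
  proof -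
    have "odd p" using p primes_dvd_imp_eq[OF two_is_prime_nat p(1)] by auto
    hence e: "2 * (Suc p div 2) = Suc p" by simp
    have "b2 = b [^] (2 :: nat)" using carr by (simp add: b2_def numeral_2_eq_2)
    hence "b2 [^] (Suc p div 2) = b [^] (2 * (Suc p div 2))" using nat_pow_pow[OF carr(2)] by simp
    also have "\<dots> = b [^] Suc p" by (rule arg_cong[OF e])
    also have "\<dots> = b" using b_pow carr by simp
    finally show ?thesis .
  qed
  have comm: "?f b \<otimes>\<^bsub>?Q\<^esub> ?f a = ?f a \<otimes>\<^bsub>?Q\<^esub> ?f b"
  proof -
    have "?f b = ?f b2 [^]\<^bsub>?Q\<^esub> (Suc p div 2)" unfolding h.hom_nat_pow[OF b2G, symmetric] b_root ..
    thus ?thesis using Q.group_commutes_pow[OF comm2 fb2 fa, of "Suc p div 2"] by (simp only:)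
  qed
  have commutator_mem: "x \<otimes> y \<otimes> inv x \<otimes> inv y \<in> normal_closure G t" if xy: "x \<in> carrier G" "y \<in> carrier G" for x y
  proof -
    have cS: "u \<otimes>\<^bsub>?Q\<^esub> v = v \<otimes>\<^bsub>?Q\<^esub> u" if "u \<in> {?f a, ?f b}" "v \<in> {?f a, ?f b}" for u v
      using that comm by (elim insertE emptyE) (simp_all only:)
    have sub: "{?f a, ?f b} \<subseteq> carrier ?Q" using fa fb by blast
    have "?f x \<otimes>\<^bsub>?Q\<^esub> ?f y = ?f y \<otimes>\<^bsub>?Q\<^esub> ?f x"
      by (rule Q.generated_by_commuting_commutes[OF sub Q_gen cS h.hom_closed[OF xy(1)] h.hom_closed[OF xy(2)]])
    hence "?f (x \<otimes> y) = ?f (y \<otimes> x)" unfolding hm[OF xy] hm[OF xy(2,1)] .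
    thus ?thesis
      unfolding rcos_eq_iff[OF L.subgroup_axioms m_closed[OF xy] m_closed[OF xy(2,1)]] eq_t[OF xy] .
  qed
  have t_index: "finite (rcosets (normal_closure G t))"
  proof -
    have "finite (carrier ?Q)"
    proof (rule Q.finite_if_generated_by_two_commuting[OF fa fb Q_gen comm])
      show "0 < p" using p by simp
      show "?f a [^]\<^bsub>?Q\<^esub> p = \<one>\<^bsub>?Q\<^esub>" unfolding h.hom_nat_pow[OF carr(1), symmetric] a_pow by (rule h1)
      show "?f b [^]\<^bsub>?Q\<^esub> p = \<one>\<^bsub>?Q\<^esub>" unfolding h.hom_nat_pow[OF carr(2), symmetric] b_pow by (rule h1)
    qed
    thus ?thesis by (simp add: FactGroup_def)
  qed
  have graft_commutator: "graft p [0] t \<in> normal_closure G t"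
    if x: "decomposes x \<sigma>" and y: "decomposes y \<tau>" and zero: "\<sigma> 0 \<otimes> \<tau> 0 \<otimes> inv (\<sigma> 0) \<otimes> inv (\<tau> 0) = t"
      and other: "\<And>i. i < p \<Longrightarrow> i \<noteq> 0 \<Longrightarrow> \<sigma> i = \<one> \<or> \<tau> i = \<one> \<or> \<sigma> i \<otimes> \<tau> i = \<tau> i \<otimes> \<sigma> i" for x y \<sigma> \<tau>
  proof -
    let ?\<gamma> = "\<lambda>i. \<sigma> i \<otimes> \<tau> i \<otimes> inv (\<sigma> i) \<otimes> inv (\<tau> i)"
    have dec: "decomposes (x \<otimes> y \<otimes> inv x \<otimes> inv y) ?\<gamma>"
      by (rule decomposes_mult[OF decomposes_mult[OF decomposes_mult[OF x y] decomposes_inv[OF x]] decomposes_inv[OF y]])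
    have one: "?\<gamma> i = \<one>" if i: "i < p" "i \<noteq> 0" for i
    proof -
      have st: "\<sigma> i \<in> carrier G" "\<tau> i \<in> carrier G" using decomposesD(2)[OF x i(1)] decomposesD(2)[OF y i(1)] by auto
      have "\<sigma> i \<otimes> \<tau> i = \<tau> i \<otimes> \<sigma> i" using other[OF i] st by auto
      hence "(\<sigma> i \<otimes> \<tau> i) \<otimes> inv (\<tau> i \<otimes> \<sigma> i) = \<one>" using st by simp
      thus ?thesis unfolding eq_t[OF st] .
    qed
    have "graft p [0] (?\<gamma> 0) = x \<otimes> y \<otimes> inv x \<otimes> inv y"
      by (rule decomposes_graft[OF dec _ one]) (use p in auto)
    thus ?thesis
      unfolding zero using commutator_mem[OF decomposesD(1)[OF x] decomposesD(1)[OF y]] by simp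
  qed
  have t_branch: "graft p [0] t \<in> normal_closure G t"
  proof (cases "p = 3")
    case False
    have "p \<noteq> 4" using p(1) by (metis even_numeral primes_dvd_imp_eq two_is_prime_nat numeral_eq_iff semiring_norm(85,88) num.distinct(1,3) num.inject(1))
    hence p5: "p \<ge> 5" using p(2) False by simp
    show ?thesis
    proof (rule graft_commutator[OF dec_b decomposes_mult[OF dec_b1 dec_b1]])
      show "\<beta> 0 \<otimes> (\<beta>1 0 \<otimes> \<beta>1 0) \<otimes> inv (\<beta> 0) \<otimes> inv (\<beta>1 0 \<otimes> \<beta>1 0) = t"
        unfolding \<beta>1_values by (simp add: \<beta>_def t_def b2_def)
      fix i assume i: "i < p" "i \<noteq> 0"
      consider "i = 1" | "i = p - 1" | "i \<noteq> 1" "i \<noteq> p - 1" by blast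
      thus "\<beta> i = \<one> \<or> \<beta>1 i \<otimes> \<beta>1 i = \<one> \<or> \<beta> i \<otimes> (\<beta>1 i \<otimes> \<beta>1 i) = (\<beta>1 i \<otimes> \<beta>1 i) \<otimes> \<beta> i"
      proof cases
        case 1
        have "\<beta> i = inv a" "\<beta>1 i = a" using 1 \<beta>1_values(2) by (simp_all add: \<beta>_def)
        moreover have "inv a \<otimes> (a \<otimes> a) = a \<otimes> a \<otimes> inv a" using carr by (simp add: m_assoc inv_mult_cancel)
        ultimately show ?thesis by simp
      next
        case 2
        have "\<beta>1 i = \<beta> (p - 2)" using 2 p5 pred[OF i(1)] by (simp add: \<beta>1_def numeral_2_eq_2)
        moreover have "p - 2 \<noteq> 0" "p - 2 \<noteq> 1" "p - 2 \<noteq> p - 1" using p5 by linarith+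
        ultimately have "\<beta>1 i = \<one>" by (simp only: \<beta>_def if_False)
        thus ?thesis by simp
      next
        case 3
        thus ?thesis using i by (simp add: \<beta>_def)
      qed
    qed
  next
    case True
    define b3 where "b3 = a \<otimes> b1 \<otimes> inv a"
    define \<beta>2 where "\<beta>2 i = \<beta>1 ((i + p - 1) mod p)" for i
    have dec_b3: "decomposes b3 \<beta>2"
      unfolding b3_def \<beta>2_def using decomposes_conj_rot[OF dec_b1 rotG] unfolding rot_a .
    have \<beta>_values: "\<beta> 0 = a" "\<beta> 1 = inv a" "\<beta> 2 = b" using True by (simp_all add: \<beta>_def)
    have \<beta>2_values: "\<beta>2 0 = inv a" "\<beta>2 1 = b" "\<beta>2 2 = a"
      using True pred[of 0] pred[of 1] pred[of 2] \<beta>1_values by (auto simp: \<beta>2_def)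
    show ?thesis
    proof (rule graft_commutator[OF decomposes_mult[OF dec_b dec_b1] decomposes_mult[OF dec_b1 dec_b3]])
      show "\<beta> 0 \<otimes> \<beta>1 0 \<otimes> (\<beta>1 0 \<otimes> \<beta>2 0) \<otimes> inv (\<beta> 0 \<otimes> \<beta>1 0) \<otimes> inv (\<beta>1 0 \<otimes> \<beta>2 0) = t"
        unfolding \<beta>1_values \<beta>_values \<beta>2_values t_def b2_def
        using carr by (simp add: m_assoc inv_mult_group inv_mult_cancel)
      fix i assume i: "i < p" "i \<noteq> 0"
      hence "i = 1 \<or> i = 2" using True by auto
      thus "\<beta> i \<otimes> \<beta>1 i = \<one> \<or> \<beta>1 i \<otimes> \<beta>2 i = \<one> \<or>
          \<beta> i \<otimes> \<beta>1 i \<otimes> (\<beta>1 i \<otimes> \<beta>2 i) = \<beta>1 i \<otimes> \<beta>2 i \<otimes> (\<beta> i \<otimes> \<beta>1 i)"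
        using \<beta>1_values \<beta>_values \<beta>2_values carr by auto
    qed
  qed
  have t_moves: "\<exists>w\<in>tree p. t w \<noteq> w"
  proof
    have "decomposes (a \<otimes> b2 \<otimes> inv a) (\<lambda>i. \<beta> ((i + p - 1) mod p) \<otimes> \<beta> ((i + p - 1) mod p))"
      using decomposes_conj_rot[OF decomposes_mult[OF dec_b dec_b] rotG] unfolding rot_a b2_def .
    moreover have "decomposes (inv b2) (\<lambda>i. inv (\<beta> i \<otimes> \<beta> i))"
      unfolding b2_def by (rule decomposes_inv[OF decomposes_mult[OF dec_b dec_b]])
    ultimately have dec_t: "decomposes t (\<lambda>i. (\<beta> ((i + p - 1) mod p) \<otimes> \<beta> ((i + p - 1) mod p)) \<otimes> inv (\<beta> i \<otimes> \<beta> i))"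
      unfolding t_def by (rule decomposes_mult)
    \<comment> \<open>The first component of \<open>t\<close> is \<open>b\<^sup>2 a\<^sup>-\<^sup>2\<close>, and \<open>b\<close> fixes level 1.\<close>
    have t2: "[2] \<in> tree p" "[0] \<in> tree p" using p by auto
    have bb: "(b \<otimes> b) [0] = [0]"
      using mult_apply[OF carr(2,2) t2(2)] decomposes_letter_sec(1)[OF dec_b, of 0] p by simp
    have "a [i] = [(i + 1) mod p]" if "i < p" for i using that by (simp add: a_def gs_a_def rot_def)
    hence "(a \<otimes> a) [0] = [2]" using mult_apply[OF carr(1,1) t2(2)] p by (simp add: numeral_2_eq_2)
    hence aa: "(inv (a \<otimes> a)) [2] = [0]" using inv_apply(1)[OF m_closed[OF carr(1,1)] t2(2)] by simp
    have "t (0 # [2]) = 0 # ((b \<otimes> b) \<otimes> inv (a \<otimes> a)) [2]"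
    proof -
      have "\<beta> ((0 + p - 1) mod p) = b" "\<beta> 0 = a"
        using \<beta>1_values(1) unfolding \<beta>1_def by (simp_all add: \<beta>_def)
      moreover have "0 < p" using p by simp
      ultimately show ?thesis using decomposesD(3)[OF dec_t _ t2(1), of 0] by (simp only:)
    qed
    also have "((b \<otimes> b) \<otimes> inv (a \<otimes> a)) [2] = [0]"
      using mult_apply[OF m_closed[OF carr(2,2)] inv_closed[OF m_closed[OF carr(1,1)]] t2(1)] aa bb by simp
    finally show "t [0, 2] \<noteq> [0, 2]" by simp
    show "[0, 2] \<in> tree p" using p by simp
  qed
  have frac: "\<exists>h\<in>carrier G. h [0] = [0] \<and> sec p h [0] = s" if "s \<in> ?S" for s
  proof -
    have *: "\<exists>h\<in>carrier G. h [0] = [0] \<and> sec p h [0] = \<sigma> 0" if "decomposes x \<sigma>" for x \<sigma>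
      using decomposes_letter_sec[OF that, of 0] decomposesD(1)[OF that] p by auto
    have "\<beta> 0 = a" by (simp add: \<beta>_def)
    thus ?thesis using that *[OF dec_b] *[OF dec_b1] \<beta>1_values(1) by (auto simp: a_def b_def)
  qed
  have secs: "sec p s [i] \<in> carrier G" if "s \<in> ?S" "i < p" for s i
  proof -
    have "sec p a [i] = \<one>" using sec_rot_letter[OF rotG that(2)] unfolding rot_a .
    moreover have "sec p b [i] \<in> carrier G" using decomposes_letter_sec(2)[OF dec_b that(2)] \<beta> by simp
    ultimately show ?thesis using that(1) by (auto simp: a_def b_def)
  qed
  have "self_similar_group G p ?S"
    by (rule self_similar_group.intro[OF rotation_tree_group_axioms self_similar_group_axioms.intro])
      (use S S_gen secs frac rotG in \<open>assumption | simp\<close>)+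
  hence "branching_self_similar_group G p ?S t"
    by (rule branching_self_similar_group.intro[OF _ branching_self_similar_group_axioms.intro])
      (rule tG t_moves t_branch t_index)+
  thus ?thesis by blast
qed

section \<open>Orbit growth for the Grigorchuk and the Gupta-Sidki groups\<close>

theorem theorem7:
  fixes p :: nat and G :: "(nat list \<Rightarrow> nat list) monoid" and f :: "nat \<Rightarrow> nat"
  assumes G: "(p = 2 \<and> G = grigorchuk_group) \<or> (Factorial_Ring.prime p \<and> p \<ge> 3 \<and> G = gupta_sidki_group p)"
    and mono: "mono f"
    and lower: "filterlim (\<lambda>n. real (f n) / real n) at_top sequentially"
    and upper: "(\<lambda>n. real (f n) / real (p ^ n)) \<longlonglongrightarrow> 0"
  shows "\<exists>(\<Omega> :: (nat list \<Rightarrow> nat list) set set) \<phi>.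
    transitive_action G \<Omega> \<phi> \<and>
    (\<forall>\<^sub>F n in sequentially. max_orbits (p ^ n) G \<Omega> \<phi> \<le> f n) \<and>
    (\<exists>\<^sub>\<infinity>n. real (max_orbits (p ^ n) G \<Omega> \<phi>) \<ge> 1 / real p * real (f n))"
proof -
  obtain S t where "branching_self_similar_group G p S t"
    using G grigorchuk_group_branching gupta_sidki_group_branching by metis
  then interpret branching_self_similar_group G p S t .
  show ?thesis by (rule exists_action_with_orbit_growth[OF lower upper])
qed

end
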